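(* Let $J$ be an $m\times m$ signature matrix, $n\in\mathbb N_0$, $(A_j)_{j=0}^n$ a $J$-Potapov sequence, (if $n\ge1$) $V_n\in\mathcal Y_{n,J}$, $W_n\in\mathcal Z_{n,J}$, and $\pi_{n,J},\rho_{n,J},\sigma_{n,J},\tau_{n,J}$ the associated polynomials. If $f\in\mathcal P_{J,0}[\mathbb D,(A_j)_{j=0}^n]$, then there exists $S\in\mathcal S_{m\times m}(\mathbb D)$ such that, as meromorphic functions of $w\in\mathbb D$, $$f=\big(wJ\tilde\tau_{n,J}^{[n]}\sqrt{L_{n+1,J}}^+S\sqrt{R_{n+1,J}}+\pi_{n,J}\big)\big(wJ\tilde\sigma_{n,J}^{[n]}\sqrt{L_{n+1,J}}^+S\sqrt{R_{n+1,J}}+\rho_{n,J}\big)^{-1}$$ and $$f=\big(w\sqrt{L_{n+1,J}}S\sqrt{R_{n+1,J}}^+\tilde\pi_{n,J}^{[n]}J+\tau_{n,J}\big)^{-1}\big(w\sqrt{L_{n+1,J}}S\sqrt{R_{n+1,J}}^+\tilde\rho_{n,J}^{[n]}J+\sigma_{n,J}\big).$$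
   Context: $m\in\mathbb N$, $\mathbb D=\{z\in\mathbb C:|z|<1\}$. An $m\times m$ signature matrix is $J\in\mathbb C^{m\times m}$ with $J^*=J$, $J^2=I_m$. A matrix $A$ is $J$-contractive if $J-A^*JA\ge0$. For $f$ meromorphic in $\mathbb D$, $\mathbb H_f$ is its set of holomorphy points. $\mathcal P_{J,0}(\mathbb D)$: $\mathbb C^{m\times m}$-valued $f$ meromorphic in $\mathbb D$ with $0\in\mathbb H_f$ and $f(w)$ $J$-contractive for $w\in\mathbb H_f$. $\mathcal S_{m\times m}(\mathbb D)$: holomorphic $S:\mathbb D\to\mathbb C^{m\times m}$ with $\|S(w)\|\le1$. $\mathcal P_{J,0}[\mathbb D,(A_j)_{j=0}^n]$: those $f\in\mathcal P_{J,0}(\mathbb D)$ with $f^{(j)}(0)/j!=A_j$, $j=0,\dots,n$. For $k\in\mathbb N_0$, $S_k$ is the block lower triangular Toeplitz matrix with $(i,l)$ block $A_{i-l}$ ($i\ge l$), $0$ otherwise ($0\le i,l\le k$); $J_{[k]}:=\mathrm{diag}(J,\dots,J)$ ($k+1$ blocks). $(A_j)_{j=0}^n$ is a $J$-Potapov sequence if $J_{[n]}-S_n^*J_{[n]}S_n\ge0$. $P_{k,J}:=J_{[k]}-S_kJ_{[k]}S_k^*$, $Q_{k,J}:=J_{[k]}-S_k^*J_{[k]}S_k$, $y_k:=(A_1^*,\dots,A_k^* )^*$, $z_k:=(A_k,\dots,A_1)$. $X^+$: Moore–Penrose inverse; $\sqrt X$: nonnegative square root; $\sqrt X^+:=(\sqrt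 X)^+$. $L_{1,J}:=J-A_0JA_0^*$, $R_{1,J}:=J-A_0^*JA_0$; for $n\ge1$, $L_{n+1,J}:=J-A_0JA_0^*-z_nQ_{n-1,J}^+z_n^*$, $R_{n+1,J}:=J-A_0^*JA_0-y_n^*P_{n-1,J}^+y_n$. $e_{k,m}(w):=(I_m,wI_m,\dots,w^kI_m)$, $\varepsilon_{k,m}(w):=$ block column $(w^kI_m;\dots;I_m)$. For $b(w)=\sum_{k=0}^nw^kB_k$, $\tilde b^{[n]}(w):=\sum_{k=0}^nw^{n-k}B_k^*$. For $n\ge1$: $\mathcal Y_{n,J}:=\{V\in\mathbb C^{nm\times m}:Q_{n-1,J}V=S_{n-1}^*J_{[n-1]}y_n\}$, $\mathcal Z_{n,J}:=\{W\in\mathbb C^{m\times nm}:WP_{n-1,J}=z_nJ_{[n-1]}S_{n-1}^*\}$. Associated polynomials: $\pi_{n,J}(w)=A_0+we_{n-1,m}(w)(y_n+S_{n-1}V_n)$, $\rho_{n,J}(w)=I_m+we_{n-1,m}(w)V_n$, $\sigma_{n,J}(w)=(W_nS_{n-1}+z_n)w\varepsilon_{n-1,m}(w)+A_0$, $\tau_{n,J}(w)=W_nw\varepsilon_{n-1,m}(w)+I_m$; for $n=0$: $\pi_{0,J}=\sigma_{0,J}=A_0$, $\rho_{0,J}=\tau_{0,J}=I_m$. *)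

theory Defs
  imports "HOL-Analysis.Analysis" "Jordan_Normal_Form.Schur_Decomposition"
begin

definition vnorm :: "complex vec \<Rightarrow> real" where
  "vnorm v = sqrt (\<Sum>i<dim_vec v. (cmod (v $ i))\<^sup>2)"

definition psd :: "complex mat \<Rightarrow> bool" where
  "psd A \<longleftrightarrow> dim_row A = dim_col A \<and> mat_adjoint A = A \<and>
     (\<forall>v \<in> carrier_vec (dim_col A). 0 \<le> Re ((A *\<^sub>v v) \<bullet>c v))"

definition norm_le_one :: "complex mat \<Rightarrow> bool" where
  "norm_le_one A \<longleftrightarrow> (\<forall>v \<in> carrier_vec (dim_col A). vnorm (A *\<^sub>v v) \<le> vnorm v)"

definition mp_inv :: "complex mat \<Rightarrow> complex mat" where
  "mp_inv A = (THE X. X \<in> carrier_mat (dim_col A) (dim_row A) \<and>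
      A * X * A = A \<and> X * A * X = X \<and>
      mat_adjoint (A * X) = A * X \<and> mat_adjoint (X * A) = X * A)"

definition msqrt :: "complex mat \<Rightarrow> complex mat" where
  "msqrt A = (THE B. psd B \<and> B \<in> carrier_mat (dim_row A) (dim_row A) \<and> B * B = A)"

definition minv :: "complex mat \<Rightarrow> complex mat" where
  "minv A = (THE B. B \<in> carrier_mat (dim_row A) (dim_row A) \<and>
      A * B = 1\<^sub>m (dim_row A) \<and> B * A = 1\<^sub>m (dim_row A))"

definition signature_mat :: "nat \<Rightarrow> complex mat \<Rightarrow> bool" where
  "signature_mat m J \<longleftrightarrow> J \<in> carrier_mat m m \<and> mat_adjoint J = J \<and> J * J = 1\<^sub>m m"

definition J_contractive :: "complex mat \<Rightarrow> complex mat \<Rightarrow> bool" where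
  "J_contractive J A \<longleftrightarrow> psd (J - mat_adjoint A * J * A)"

definition S_mat :: "nat \<Rightarrow> (nat \<Rightarrow> complex mat) \<Rightarrow> nat \<Rightarrow> complex mat" where
  "S_mat m A k = mat (Suc k * m) (Suc k * m) (\<lambda>(i, j).
     if j div m \<le> i div m then A (i div m - j div m) $$ (i mod m, j mod m) else 0)"

definition Jblk :: "nat \<Rightarrow> complex mat \<Rightarrow> nat \<Rightarrow> complex mat" where
  "Jblk m J k = mat (Suc k * m) (Suc k * m) (\<lambda>(i, j).
     if i div m = j div m then J $$ (i mod m, j mod m) else 0)"

definition potapov_seq :: "nat \<Rightarrow> complex mat \<Rightarrow> nat \<Rightarrow> (nat \<Rightarrow> complex mat) \<Rightarrow> bool" where
  "potapov_seq m J n A \<longleftrightarrow> (\<forall>j\<le>n. A j \<in> carrier_mat m m) \<and>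
     psd (Jblk m J n - mat_adjoint (S_mat m A n) * Jblk m J n * S_mat m A n)"

definition P_mat :: "nat \<Rightarrow> complex mat \<Rightarrow> (nat \<Rightarrow> complex mat) \<Rightarrow> nat \<Rightarrow> complex mat" where
  "P_mat m J A k = Jblk m J k - S_mat m A k * Jblk m J k * mat_adjoint (S_mat m A k)"

definition Q_mat :: "nat \<Rightarrow> complex mat \<Rightarrow> (nat \<Rightarrow> complex mat) \<Rightarrow> nat \<Rightarrow> complex mat" where
  "Q_mat m J A k = Jblk m J k - mat_adjoint (S_mat m A k) * Jblk m J k * S_mat m A k"

definition y_vec :: "nat \<Rightarrow> (nat \<Rightarrow> complex mat) \<Rightarrow> nat \<Rightarrow> complex mat" where
  "y_vec m A k = mat (k * m) m (\<lambda>(i, j). A (Suc (i div m)) $$ (i mod m, j))"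

definition z_vec :: "nat \<Rightarrow> (nat \<Rightarrow> complex mat) \<Rightarrow> nat \<Rightarrow> complex mat" where
  "z_vec m A k = mat m (k * m) (\<lambda>(i, j). A (k - j div m) $$ (i, j mod m))"

definition Lnext :: "nat \<Rightarrow> complex mat \<Rightarrow> (nat \<Rightarrow> complex mat) \<Rightarrow> nat \<Rightarrow> complex mat" where
  "Lnext m J A n = (if n = 0 then J - A 0 * J * mat_adjoint (A 0)
     else J - A 0 * J * mat_adjoint (A 0)
            - z_vec m A n * mp_inv (Q_mat m J A (n - 1)) * mat_adjoint (z_vec m A n))"

definition Rnext :: "nat \<Rightarrow> complex mat \<Rightarrow> (nat \<Rightarrow> complex mat) \<Rightarrow> nat \<Rightarrow> complex mat" where
  "Rnext m J A n = (if n = 0 then J - mat_adjoint (A 0) * J * A 0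
     else J - mat_adjoint (A 0) * J * A 0
            - mat_adjoint (y_vec m A n) * mp_inv (P_mat m J A (n - 1)) * y_vec m A n)"

definition Y_set :: "nat \<Rightarrow> complex mat \<Rightarrow> (nat \<Rightarrow> complex mat) \<Rightarrow> nat \<Rightarrow> complex mat set" where
  "Y_set m J A n = {V \<in> carrier_mat (n * m) m.
     Q_mat m J A (n - 1) * V = mat_adjoint (S_mat m A (n - 1)) * Jblk m J (n - 1) * y_vec m A n}"

definition Z_set :: "nat \<Rightarrow> complex mat \<Rightarrow> (nat \<Rightarrow> complex mat) \<Rightarrow> nat \<Rightarrow> complex mat set" where
  "Z_set m J A n = {W \<in> carrier_mat m (n * m).
     W * P_mat m J A (n - 1) = z_vec m A n * Jblk m J (n - 1) * mat_adjoint (S_mat m A (n - 1))}"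

definition e_row :: "nat \<Rightarrow> nat \<Rightarrow> complex \<Rightarrow> complex mat" where
  "e_row m k w = mat m (Suc k * m) (\<lambda>(i, j). if i = j mod m then w ^ (j div m) else 0)"

definition eps_col :: "nat \<Rightarrow> nat \<Rightarrow> complex \<Rightarrow> complex mat" where
  "eps_col m k w = mat (Suc k * m) m (\<lambda>(i, j). if i mod m = j then w ^ (k - i div m) else 0)"

definition pi_poly :: "nat \<Rightarrow> (nat \<Rightarrow> complex mat) \<Rightarrow> nat \<Rightarrow> complex mat \<Rightarrow> complex \<Rightarrow> complex mat" where
  "pi_poly m A n V w = (if n = 0 then A 0
     else A 0 + w \<cdot>\<^sub>m (e_row m (n - 1) w * (y_vec m A n + S_mat m A (n - 1) * V)))"

definition rho_poly :: "nat \<Rightarrow> nat \<Rightarrow> complex mat \<Rightarrow> complex \<Rightarrow> complex mat" where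
  "rho_poly m n V w = (if n = 0 then 1\<^sub>m m
     else 1\<^sub>m m + w \<cdot>\<^sub>m (e_row m (n - 1) w * V))"

definition sigma_poly :: "nat \<Rightarrow> (nat \<Rightarrow> complex mat) \<Rightarrow> nat \<Rightarrow> complex mat \<Rightarrow> complex \<Rightarrow> complex mat" where
  "sigma_poly m A n W w = (if n = 0 then A 0
     else (W * S_mat m A (n - 1) + z_vec m A n) * (w \<cdot>\<^sub>m eps_col m (n - 1) w) + A 0)"

definition tau_poly :: "nat \<Rightarrow> nat \<Rightarrow> complex mat \<Rightarrow> complex \<Rightarrow> complex mat" where
  "tau_poly m n W w = (if n = 0 then 1\<^sub>m m
     else W * (w \<cdot>\<^sub>m eps_col m (n - 1) w) + 1\<^sub>m m)"

definition taylor_coeff :: "nat \<Rightarrow> (complex \<Rightarrow> complex mat) \<Rightarrow> nat \<Rightarrow> complex mat" where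
  "taylor_coeff m f k = mat m m (\<lambda>(i, j). (deriv ^^ k) (\<lambda>w. f w $$ (i, j)) 0 / fact k)"

text \<open>For b(w) = sum_{k=0}^n w^k B_k: tilde b^[n](w) = sum_{k=0}^n w^(n-k) B_k^*.\<close>
definition tilde :: "nat \<Rightarrow> nat \<Rightarrow> (complex \<Rightarrow> complex mat) \<Rightarrow> complex \<Rightarrow> complex mat" where
  "tilde m n b w = mat m m (\<lambda>(i, j).
     \<Sum>k\<le>n. w ^ (n - k) * mat_adjoint (taylor_coeff m b k) $$ (i, j))"

abbreviation unit_disc :: "complex set" where "unit_disc \<equiv> ball 0 1"

definition mat_holomorphic_on :: "nat \<Rightarrow> (complex \<Rightarrow> complex mat) \<Rightarrow> complex set \<Rightarrow> bool" where
  "mat_holomorphic_on m f U \<longleftrightarrow> (\<forall>i<m. \<forall>j<m. (\<lambda>w. f w $$ (i, j)) holomorphic_on U)"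

definition hol_pts :: "nat \<Rightarrow> (complex \<Rightarrow> complex mat) \<Rightarrow> complex set" where
  "hol_pts m f = {z \<in> unit_disc. \<exists>r>0. mat_holomorphic_on m f (ball z r)}"

definition meromorphic_disc :: "nat \<Rightarrow> (complex \<Rightarrow> complex mat) \<Rightarrow> bool" where
  "meromorphic_disc m f \<longleftrightarrow>
     (\<forall>w\<in>unit_disc. f w \<in> carrier_mat m m) \<and>
     (\<forall>z\<in>unit_disc. \<not> z islimpt (unit_disc - hol_pts m f)) \<and>
     (\<forall>z\<in>unit_disc - hol_pts m f. \<exists>k r g. r > 0 \<and>
        (\<forall>i<m. \<forall>j<m. g i j holomorphic_on ball z r \<and>
           (\<forall>w\<in>ball z r - {z}. (w - z) ^ k * f w $$ (i, j) = g i j w)))"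

definition P_J0 :: "nat \<Rightarrow> complex mat \<Rightarrow> (complex \<Rightarrow> complex mat) set" where
  "P_J0 m J = {f. meromorphic_disc m f \<and> 0 \<in> hol_pts m f \<and>
      (\<forall>w\<in>hol_pts m f. J_contractive J (f w))}"

definition P_J0_int :: "nat \<Rightarrow> complex mat \<Rightarrow> nat \<Rightarrow> (nat \<Rightarrow> complex mat) \<Rightarrow> (complex \<Rightarrow> complex mat) set" where
  "P_J0_int m J n A = {f \<in> P_J0 m J. \<forall>j\<le>n. taylor_coeff m f j = A j}"

definition schur_class :: "nat \<Rightarrow> (complex \<Rightarrow> complex mat) set" where
  "schur_class m = {S. (\<forall>w\<in>unit_disc. S w \<in> carrier_mat m m \<and> norm_le_one (S w)) \<and>
      mat_holomorphic_on m S unit_disc}"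

end

theory Submission
  imports Defs "HOL-Complex_Analysis.Complex_Analysis"
begin

text \<open>With P and Q the projections onto the eigenspaces of J, the Potapov--Ginzburg transform
  turns f into a contractive function. Hence f acts as a J-contraction on truncated power series with
  respect to all its Taylor coefficients at 0. The conditions defining V and W
  say that f rho - pi and tau f - sigma vanish to order n, and that the reversed polynomials satisfy
  dual relations in which L and R appear as the first nonzero coefficients. From these relations f is
  a linear fractional transform of the solution \<Phi> of the fixed point equation
  \<Phi> = L^+ k (rho + w J sigma' \<Phi>), where k is the quotient of tau f - sigma by w^(n + 1) and
  sigma' is the reverse of sigma. Evaluating the J-contractivity of f on the series
  rho p + w J sigma' \<Phi> p shows that the truncations of S = sqrt L \<Phi> (sqrt R)^+ are
  contractive, so that S is the Taylor series of a Schur function. The two formulas, which so far hold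
  between Taylor series, extend to the disc by the identity theorem.\<close>

section \<open>Potapov power series over rings with involution\<close>

text \<open>Two degeneracies shape the argument: \<open>f\<close> may have poles, and L and R may be
  singular. Poles are avoided by working with the germ at 0 and with finite truncations. A
  J-contraction has no norm bound, but its Ginzburg transform is bounded, hence extends over the
  poles and yields an inequality for every truncation. Singular L and R are handled by positivity: a
  row annihilating L also annihilates k, and \<Phi> annihilates the kernel of R. This is what allows
  the pseudo-inverses to be cancelled. The fixed point equation comes from the remainders. With f
  rho - pi = w^(n + 1) h and J tau' - f J sigma' = w^n B', where primes denote reversed polynomials,
  one has tau h = k rho and tau B' = L - w k J sigma'. As tau is invertible as a series, h = B'
  \<Phi> holds exactly when L \<Phi> = k (rho + w J sigma' \<Phi>). Coefficients do not commute, so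
  the second formula is not a consequence of the first by algebra alone; the same S serves both
  because the other dual remainder, multiplied by rho + w J sigma' \<Phi>, gives the constant
  R.\<close>

lemma fps_eq_X_power_mult_shift:
  fixes a :: "'a::ring_1 fps"
  assumes "\<And>i. i < k \<Longrightarrow> fps_nth a i = 0"
  shows "a = fps_X ^ k * fps_shift k a"
  by (rule fps_ext) (auto simp: fps_X_power_mult_nth assms)

lemma fps_X_power_mult_cancel:
  fixes a :: "'a::ring_1 fps"
  assumes "fps_X ^ k * a = fps_X ^ k * b"
  shows "a = b"
proof (rule fps_ext)
  fix i
  have "fps_nth (fps_X ^ k * a) (i + k) = fps_nth (fps_X ^ k * b) (i + k)" by (simp add: assms)
  then show "fps_nth a i = fps_nth b i" by (simp add: fps_X_power_mult_nth)
qed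

text \<open>Over a noncommutative ring the left and the right recursive inverse of a series are
  separate objects; associativity identifies them.\<close>

lemma fps_ring_1_inverse:
  fixes f :: "'a::ring_1 fps"
  assumes "x * fps_nth f 0 = 1" "fps_nth f 0 * y = 1"
  obtains g where "g * f = 1" "f * g = 1"
proof -
  have l: "fps_left_inverse f x * f = 1" using assms(1) by (rule fps_left_inverse)
  have r: "f * fps_right_inverse f y = 1" using assms(2) by (rule fps_right_inverse)
  have "fps_left_inverse f x = fps_left_inverse f x * (f * fps_right_inverse f y)"
    by (simp only: r mult_1_right)
  also have "\<dots> = fps_right_inverse f y"
    by (simp only: l mult_1_left mult.assoc[symmetric])
  finally show ?thesis using l r that by metis
qed

section \<open>Truncations and degree bounds of series with noncommuting coefficients\<close>

definition fps_trunc :: "nat \<Rightarrow> 'a::zero fps \<Rightarrow> 'a fps" where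
  "fps_trunc n b = Abs_fps (\<lambda>i. if i \<le> n then fps_nth b i else 0)"

lemma fps_trunc_nth [simp]: "fps_nth (fps_trunc n b) i = (if i \<le> n then fps_nth b i else 0)"
  by (simp add: fps_trunc_def)

lemma fps_mult_nth_trunc:
  fixes a :: "'a::ring_1 fps"
  shows "k \<le> n \<Longrightarrow> fps_nth (a * fps_trunc n b) k = fps_nth (a * b) k"
  by (auto simp: fps_mult_nth intro!: sum.cong)

definition fps_deg_le :: "nat \<Rightarrow> 'a::zero fps \<Rightarrow> bool" where
  "fps_deg_le n b \<longleftrightarrow> (\<forall>i>n. fps_nth b i = 0)"

lemma fps_deg_leD: "fps_deg_le n b \<Longrightarrow> n < i \<Longrightarrow> fps_nth b i = 0"
  by (simp add: fps_deg_le_def)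

lemma fps_deg_le_trunc [simp]: "fps_deg_le n (fps_trunc n b)"
  by (simp add: fps_deg_le_def)

lemma fps_deg_le_const [simp]: "fps_deg_le n (fps_const c)"
  by (simp add: fps_deg_le_def)

lemma fps_deg_le_diff: "fps_deg_le n a \<Longrightarrow> fps_deg_le n b \<Longrightarrow> fps_deg_le n (a - b :: 'a::ring_1 fps)"
  by (simp add: fps_deg_le_def)

lemma fps_deg_le_mult:
  fixes a b :: "'a::ring_1 fps"
  assumes "fps_deg_le n a" "fps_deg_le k b"
  shows "fps_deg_le (n + k) (a * b)"
  unfolding fps_deg_le_def fps_mult_nth
proof (intro allI impI sum.neutral ballI)
  fix i j assume "n + k < i" "j \<in> {0..i}"
  then have "n < j \<or> k < i - j" by auto
  then show "fps_nth a j * fps_nth b (i - j) = 0"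
    using assms by (auto simp: fps_deg_le_def)
qed

lemma fps_deg_le_const_mult: "fps_deg_le n b \<Longrightarrow> fps_deg_le n (fps_const c * b :: 'a::ring_1 fps)"
  by (simp add: fps_deg_le_def)

lemma fps_deg_le_mult_const: "fps_deg_le n b \<Longrightarrow> fps_deg_le n (b * fps_const c :: 'a::ring_1 fps)"
  by (simp add: fps_deg_le_def)

lemma fps_mult_nth_deg_le:
  fixes a b :: "'a::ring_1 fps"
  assumes "fps_deg_le n a" "fps_deg_le k b"
  shows "fps_nth (a * b) l = (\<Sum>i\<le>n. \<Sum>j\<le>k. if i + j = l then fps_nth a i * fps_nth b j else 0)"
proof -
  have "fps_nth (a * b) l = (\<Sum>i\<le>l. fps_nth a i * fps_nth b (l - i))"
    by (simp add: fps_mult_nth atLeast0AtMost)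
  also have "\<dots> = (\<Sum>i\<in>{..l} \<inter> {..n}. fps_nth a i * fps_nth b (l - i))"
    using assms(1) by (intro sum.mono_neutral_right) (auto simp: fps_deg_le_def not_le[symmetric])
  also have "\<dots> = (\<Sum>i\<in>{..n} \<inter> {..l}. fps_nth a i * fps_nth b (l - i))"
    by (simp add: Int_commute)
  also have "\<dots> = (\<Sum>i\<le>n. if i \<in> {..l} then fps_nth a i * fps_nth b (l - i) else 0)"
    by (rule sum.inter_restrict) simp
  also have "\<dots> = (\<Sum>i\<le>n. \<Sum>j\<le>k. if i + j = l then fps_nth a i * fps_nth b j else 0)"
  proof (rule sum.cong[OF refl])
    fix i assume "i \<in> {..n}"
    show "(if i \<in> {..l} then fps_nth a i * fps_nth b (l - i) else 0)
       = (\<Sum>j\<le>k. if i + j = l then fps_nth a i * fps_nth b j else 0)"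
    proof (cases "i \<le> l \<and> l - i \<le> k")
      case True
      then have "(\<Sum>j\<le>k. if i + j = l then fps_nth a i * fps_nth b j else 0)
        = (\<Sum>j\<le>k. if j = l - i then fps_nth a i * fps_nth b j else 0)"
        by (intro sum.cong) auto
      with True show ?thesis by simp
    next
      case False
      then have "(\<Sum>j\<le>k. if i + j = l then fps_nth a i * fps_nth b j else 0) = 0"
        by (intro sum.neutral) auto
      with False show ?thesis using fps_deg_leD[OF assms(2), of "l - i"] by auto
    qed
  qed
  finally show ?thesis .
qed

text \<open>Modelled on square matrices with adjoint and semidefiniteness. Definiteness enters as
  \<open>pos_minus_square\<close>; finite dimension enters only as \<open>invertible\<close>, by
  which an injective left multiplication has a two-sided inverse.\<close>

locale star_ring =
  fixes star :: "'a::ring_1 \<Rightarrow> 'a" and pos :: "'a \<Rightarrow> bool"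
  assumes star_add [simp]: "star (x + y) = star x + star y"
    and star_mult [simp]: "star (x * y) = star y * star x"
    and star_star [simp]: "star (star x) = x"
    and pos_add: "pos x \<Longrightarrow> pos y \<Longrightarrow> pos (x + y)"
    and pos_square: "pos (star x * x)"
    and pos_minus_square: "pos (- (star x * x)) \<Longrightarrow> x = 0"
    and invertible: "(\<And>a. t * a = 0 \<Longrightarrow> a = 0) \<Longrightarrow> \<exists>s. s * t = 1 \<and> t * s = (1::'a)"
begin

lemma star_zero [simp]: "star 0 = 0"
  using star_add[of 0 0] by simp

lemma star_minus [simp]: "star (- x) = - star x"
  using star_add[of x "- x"] by (simp add: eq_neg_iff_add_eq_0 add.commute)

lemma star_diff [simp]: "star (x - y) = star x - star y"
  using star_add[of x "- y"] by simp

lemma star_one [simp]: "star 1 = 1"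
  by (metis mult_1_right star_mult star_star)

lemma star_sum: "star (sum g I) = (\<Sum>i\<in>I. star (g i))"
  by (induction I rule: infinite_finite_induct) auto

lemma star_eq_iff: "star x = y \<longleftrightarrow> x = star y"
  by auto

lemma pos_zero [simp]: "pos 0"
  using pos_square[of 0] by simp

lemma pos_sum: "(\<And>i. i \<in> I \<Longrightarrow> pos (g i)) \<Longrightarrow> pos (sum g I)"
  by (induction I rule: infinite_finite_induct) (auto intro: pos_add)

text \<open>Adding the squares with index other than \<open>j\<close> leaves the negative of a
  single square, to which definiteness applies.\<close>

lemma pos_minus_sum_squares:
  assumes "finite I" "pos (- (\<Sum>i\<in>I. star (x i) * x i))" "j \<in> I"
  shows "x j = 0"
proof -
  have "pos (- (\<Sum>i\<in>I. star (x i) * x i) + (\<Sum>i\<in>I - {j}. star (x i) * x i))"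
    by (intro pos_add assms pos_sum pos_square)
  also have "- (\<Sum>i\<in>I. star (x i) * x i) + (\<Sum>i\<in>I - {j}. star (x i) * x i) = - (star (x j) * x j)"
    using sum.remove[OF assms(1,3), of "\<lambda>i. star (x i) * x i"] by simp
  finally show ?thesis by (rule pos_minus_square)
qed

text \<open>On coefficients, this is the reciprocal polynomial that the theorem writes with a tilde
  and the superscript n.\<close>

definition rev :: "nat \<Rightarrow> 'a fps \<Rightarrow> 'a fps" where
  "rev n b = Abs_fps (\<lambda>i. if i \<le> n then star (fps_nth b (n - i)) else 0)"

lemma rev_nth [simp]: "fps_nth (rev n b) i = (if i \<le> n then star (fps_nth b (n - i)) else 0)"
  by (simp add: rev_def)

lemma rev_deg_le [simp]: "fps_deg_le n (rev n b)"
  by (simp add: fps_deg_le_def)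

lemma rev_rev: "fps_deg_le n b \<Longrightarrow> rev n (rev n b) = b"
  by (rule fps_ext) (auto simp: fps_deg_leD)

lemma rev_add: "rev n (a + b) = rev n a + rev n b"
  by (rule fps_ext) simp

lemma rev_diff: "rev n (a - b) = rev n a - rev n b"
  by (rule fps_ext) simp

lemma rev_const_mult: "rev n (fps_const c * b) = rev n b * fps_const (star c)"
  by (rule fps_ext) simp

lemma rev_mult_const: "rev n (b * fps_const c) = fps_const (star c) * rev n b"
  by (rule fps_ext) simp

lemma rev_X_mult: "rev (Suc n) (fps_X * b) = rev n b"
  by (rule fps_ext) (auto simp: Suc_diff_le)

lemma rev_Suc: "fps_deg_le n b \<Longrightarrow> rev (Suc n) b = fps_X * rev n b"
  by (rule fps_ext) (auto simp: fps_deg_leD Suc_diff_le)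

lemma rev_mult:
  assumes "fps_deg_le n a" "fps_deg_le k b"
  shows "rev (n + k) (a * b) = rev k b * rev n a"
proof (rule fps_ext)
  fix l
  show "fps_nth (rev (n + k) (a * b)) l = fps_nth (rev k b * rev n a) l"
  proof (cases "l \<le> n + k")
    case False
    then show ?thesis using fps_deg_leD[OF fps_deg_le_mult[OF rev_deg_le rev_deg_le], of k n l]
      by simp
  next
    case True
    have "fps_nth (rev k b * rev n a) l
      = (\<Sum>j\<le>k. \<Sum>i\<le>n. if j + i = l then star (fps_nth b (k - j)) * star (fps_nth a (n - i)) else 0)"
      by (subst fps_mult_nth_deg_le[OF rev_deg_le rev_deg_le])
        (auto intro!: sum.cong)
    also have "\<dots> = (\<Sum>j\<le>k. \<Sum>i\<le>n. if (k - j) + i = l then star (fps_nth b j) * star (fps_nth a (n - i)) else 0)"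
      by (rule sum.reindex_bij_witness[of _ "\<lambda>j. k - j" "\<lambda>j. k - j"]) auto
    also have "\<dots> = (\<Sum>j\<le>k. \<Sum>i\<le>n. if (k - j) + (n - i) = l then star (fps_nth b j) * star (fps_nth a i) else 0)"
      by (rule sum.cong[OF refl], rule sum.reindex_bij_witness[of _ "\<lambda>j. n - j" "\<lambda>j. n - j"]) auto
    also have "\<dots> = (\<Sum>j\<le>k. \<Sum>i\<le>n. if i + j = n + k - l then star (fps_nth b j) * star (fps_nth a i) else 0)"
      using True by (intro sum.cong) auto
    also have "\<dots> = (\<Sum>i\<le>n. \<Sum>j\<le>k. if i + j = n + k - l then star (fps_nth b j) * star (fps_nth a i) else 0)"
      by (rule sum.swap)
    also have "\<dots> = star (fps_nth (a * b) (n + k - l))"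
      unfolding fps_mult_nth_deg_le[OF assms] star_sum
      by (intro sum.cong refl) auto
    finally show ?thesis using True by simp
  qed
qed

text \<open>Coefficient \<open>n\<close> is the Hermitian product of two coefficient columns, so
  that identities between products with reversed polynomials can be read as values of quadratic
  forms.\<close>

lemma rev_mult_nth: "fps_nth (rev n a * b) n = (\<Sum>i\<le>n. star (fps_nth a i) * fps_nth b i)"
  unfolding fps_mult_nth atLeast0AtMost
  by (rule sum.reindex_bij_witness[of _ "\<lambda>j. n - j" "\<lambda>j. n - j"]) auto

lemma mult_rev_nth: "fps_nth (b * rev n a) n = (\<Sum>i\<le>n. fps_nth b i * star (fps_nth a i))"
  unfolding fps_mult_nth atLeast0AtMost
  by (rule sum.cong) auto

text \<open>For a self-reciprocal polynomial of degree at most \<open>n + n\<close>, vanishing below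
  the middle forces vanishing above it, and only the middle coefficient survives.\<close>

lemma rev_self_eq_X_power:
  assumes "fps_deg_le (n + n) D" "rev (n + n) D = D" "\<And>i. i < n \<Longrightarrow> fps_nth D i = 0"
  shows "D = fps_X ^ n * fps_const (fps_nth D n)"
proof (rule fps_ext)
  fix i
  have "fps_nth D i = 0" if "i > n"
  proof (cases "i \<le> n + n")
    case True
    have "fps_nth D i = star (fps_nth D (n + n - i))"
      using True by (subst assms(2)[symmetric]) simp
    then show ?thesis using assms(3)[of "n + n - i"] that True by simp
  qed (simp add: fps_deg_leD[OF assms(1)])
  then show "fps_nth D i = fps_nth (fps_X ^ n * fps_const (fps_nth D n)) i"
    using assms(3)[of i] by (cases i n rule: linorder_cases) (auto simp: fps_X_power_mult_nth)
qed

end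

section \<open>Indefinite forms and the Ginzburg transform\<close>

locale krein = star_ring +
  fixes P
  assumes star_P [simp]: "star P = P" and P_P: "P * P = P"
begin

text \<open>The projection \<open>P\<close> is the datum and \<open>J\<close> is derived from it,
  because recovering \<open>P\<close> as half of \<open>1 + J\<close> would need a division by two
  in the ring.\<close>

definition Q where "Q = 1 - P"
definition J where "J = P - Q"

lemma star_Q [simp]: "star Q = Q"
  and Q_Q: "Q * Q = Q" and P_Q: "P * Q = 0" and Q_P: "Q * P = 0" and P_plus_Q: "P + Q = 1"
  by (auto simp: Q_def algebra_simps P_P)

lemma star_J [simp]: "star J = J" and J_J [simp]: "J * J = 1"
  and P_J: "P * J = P" and Q_J: "Q * J = - Q"
  by (simp add: J_def) (simp_all add: J_def algebra_simps P_P Q_Q P_Q Q_P P_plus_Q)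

lemma J_J_mult [simp]: "J * (J * x) = x"
  by (simp add: mult.assoc[symmetric] J_J)

lemma PQ_mult [simp]: "P * (P * x) = P * x" "Q * (Q * x) = Q * x" "P * (Q * x) = 0" "Q * (P * x) = 0"
  by (simp_all add: mult.assoc[symmetric] P_P Q_Q P_Q Q_P)

text \<open>J-contractivity of \<open>A\<close> says that \<open>form a (A * a)\<close> is
  nonnegative for all \<open>a\<close>, that is, the form is nonnegative on the graph of
  \<open>A\<close>.\<close>

definition form :: "'a \<Rightarrow> 'a \<Rightarrow> 'a" where
  "form x y = star x * J * x - star y * J * y"

text \<open>The Potapov--Ginzburg transform turns the indefinite form of a graph into a definite one.\<close>

lemma form_eq:
  "form x y = star (P * x + Q * y) * (P * x + Q * y) - star (P * y + Q * x) * (P * y + Q * x)"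
proof -
  have "star (P * x + Q * y) * (P * x + Q * y) = star x * P * x + star y * Q * y" for x y
    by (simp add: algebra_simps)
  then show ?thesis
    by (simp add: form_def J_def algebra_simps)
qed

text \<open>On pairs whose positive component \<open>P * x + Q * y\<close> vanishes the form is
  minus a square, so nonnegativity kills the other component too; the two components determine the
  pair.\<close>

lemma form_neutral:
  assumes "P * x + Q * y = 0" "pos (form x y)"
  shows "x = 0 \<and> y = 0"
proof -
  have "pos (- (star (P * y + Q * x) * (P * y + Q * x)))"
    using assms by (simp add: form_eq)
  then have d: "P * y + Q * x = 0" by (rule pos_minus_square)
  have "P * x = 0" "Q * y = 0" "P * y = 0" "Q * x = 0"
    using arg_cong[OF assms(1), of "\<lambda>z. P * z"] arg_cong[OF assms(1), of "\<lambda>z. Q * z"]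
      arg_cong[OF d, of "\<lambda>z. P * z"] arg_cong[OF d, of "\<lambda>z. Q * z"]
    by (simp_all add: distrib_left)
  moreover have "x = P * x + Q * x" "y = P * y + Q * y"
    by (simp_all add: P_plus_Q distrib_right[symmetric])
  ultimately show ?thesis by simp
qed

text \<open>An \<open>a\<close> in the kernel of \<open>P + Q * A0\<close> gives the graph point
  \<open>(a, A0 * a)\<close> without positive component, which is zero by
  \<open>form_neutral\<close>.\<close>

lemma ginzburg_invertible:
  assumes "\<And>a. pos (form a (A0 * a))"
  obtains s where "s * (P + Q * A0) = 1" "(P + Q * A0) * s = 1"
proof -
  have "a = 0" if "(P + Q * A0) * a = 0" for a
    using form_neutral[of a "A0 * a"] that assms[of a] by (simp add: algebra_simps)
  then show ?thesis using invertible[of "P + Q * A0"] that by blast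
qed

text \<open>This is J-contractivity of the block lower triangular Toeplitz matrices of all orders,
  tested on block columns \<open>b\<close>: products of series encode Toeplitz matrices acting on
  coefficients.\<close>

definition potapov :: "'a fps \<Rightarrow> bool" where
  "potapov f \<longleftrightarrow> (\<forall>b N. pos (\<Sum>k\<le>N. form (fps_nth b k) (fps_nth (f * b) k)))"

lemma potapovD: "potapov f \<Longrightarrow> pos (\<Sum>k\<le>N. form (fps_nth b k) (fps_nth (f * b) k))"
  by (simp add: potapov_def)

lemma potapov_0: "potapov f \<Longrightarrow> pos (form a (fps_nth f 0 * a))"
  using potapovD[where N = 0 and b = "fps_const a"] by simp

text \<open>The pairs (J star (c f), J star c) span the orthogonal complement of the graph of f;
  as the graph is maximal nonnegative, its complement is nonpositive.\<close>

lemma potapov_dual: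
  assumes "potapov f"
  shows "pos (\<Sum>k\<le>N. fps_nth c k * J * star (fps_nth c k)
     - fps_nth (c * f) k * J * star (fps_nth (c * f) k))"
proof -
  define x where "x i = J * star (fps_nth (c * f) (N - i))" for i
  define y where "y i = J * star (fps_nth c (N - i))" for i
  define U where "U = fps_const P + fps_const Q * f"
  obtain s where s: "s * (P + Q * fps_nth f 0) = 1" "(P + Q * fps_nth f 0) * s = 1"
    using ginzburg_invertible potapov_0[OF assms] by blast
  then obtain V where "U * V = 1"
    using fps_ring_1_inverse[of s U s] by (auto simp: U_def)
  \<comment> \<open>Inverting \<open>U\<close> selects the graph point \<open>(b, f * b)\<close>
    with the same positive component as \<open>(x, y)\<close>. The difference \<open>(d, e)\<close>
    then has only a negative component.\<close>
  define b where "b = V * Abs_fps (\<lambda>i. P * x i + Q * y i)"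
  have "U * b = Abs_fps (\<lambda>i. P * x i + Q * y i)"
    unfolding b_def mult.assoc[symmetric] by (simp add: \<open>U * V = 1\<close>)
  then have "fps_nth (U * b) i = P * x i + Q * y i" for i by simp
  then have b: "P * fps_nth b i + Q * fps_nth (f * b) i = P * x i + Q * y i" for i
    by (simp add: U_def distrib_right mult.assoc)
  define d where "d i = x i - fps_nth b i" for i
  define e where "e i = y i - fps_nth (f * b) i" for i
  define z where "z i = P * e i + Q * d i" for i
  have de: "form (d i) (e i) = - (star (z i) * z i)" for i
    using b[of i] by (simp add: form_eq z_def d_def e_def algebra_simps)
  define cr where "cr i = star (x i) * J * fps_nth b i - star (y i) * J * fps_nth (f * b) i" for i
  \<comment> \<open>Orthogonality to the graph: because of the index reversal in \<open>x\<close>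
    and \<open>y\<close>, both halves of the sum are coefficient \<open>N\<close> of
    \<open>c * f * b\<close>.\<close>
  have cr: "(\<Sum>i\<le>N. cr i) = 0"
  proof -
    have "cr i = fps_nth (c * f) (N - i) * fps_nth b i - fps_nth c (N - i) * fps_nth (f * b) i" for i
      by (simp add: cr_def x_def y_def mult.assoc J_J)
    then have "(\<Sum>i\<le>N. cr i) = (\<Sum>i\<le>N. fps_nth (c * f) (N - i) * fps_nth b i)
        - (\<Sum>i\<le>N. fps_nth c (N - i) * fps_nth (f * b) i)"
      by (simp add: sum_subtractf)
    also have "(\<Sum>i\<le>N. fps_nth (c * f) (N - i) * fps_nth b i) = fps_nth ((c * f) * b) N"
      unfolding fps_mult_nth[of "c * f" b] atLeast0AtMost
      by (rule sum.reindex_bij_witness[of _ "\<lambda>j. N - j" "\<lambda>j. N - j"]) auto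
    also have "(\<Sum>i\<le>N. fps_nth c (N - i) * fps_nth (f * b) i) = fps_nth (c * (f * b)) N"
      unfolding fps_mult_nth[of c "f * b"] atLeast0AtMost
      by (rule sum.reindex_bij_witness[of _ "\<lambda>j. N - j" "\<lambda>j. N - j"]) auto
    finally show ?thesis by (simp add: mult.assoc)
  qed
  \<comment> \<open>The form of the difference is expanded. Once the cross terms cancel in the sum,
    minus the form of \<open>(x, y)\<close> is a sum of squares plus the form on the graph, hence
    nonnegative.\<close>
  have "- form (x i) (y i) = star (z i) * z i + form (fps_nth b i) (fps_nth (f * b) i) - cr i - star (cr i)" for i
  proof -
    have "form (d i) (e i) = form (x i) (y i) + form (fps_nth b i) (fps_nth (f * b) i) - cr i - star (cr i)"
      by (simp add: form_def d_def e_def cr_def algebra_simps)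
    then show ?thesis by (simp add: de algebra_simps)
  qed
  then have "(\<Sum>i\<le>N. - form (x i) (y i)) = (\<Sum>i\<le>N. star (z i) * z i)
      + (\<Sum>i\<le>N. form (fps_nth b i) (fps_nth (f * b) i)) - (\<Sum>i\<le>N. cr i) - star (\<Sum>i\<le>N. cr i)"
    by (simp add: sum.distrib sum_subtractf star_sum)
  also have "\<dots> = (\<Sum>i\<le>N. star (z i) * z i) + (\<Sum>i\<le>N. form (fps_nth b i) (fps_nth (f * b) i))"
    by (simp add: cr)
  finally have "pos (\<Sum>i\<le>N. - form (x i) (y i))"
    by (simp only:) (intro pos_add pos_sum pos_square potapovD assms)
  also have "(\<Sum>i\<le>N. - form (x i) (y i)) = (\<Sum>k\<le>N. fps_nth c k * J * star (fps_nth c k)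
     - fps_nth (c * f) k * J * star (fps_nth (c * f) k))"
    by (rule sum.reindex_bij_witness[of _ "\<lambda>j. N - j" "\<lambda>j. N - j"])
      (auto simp: form_def x_def y_def mult.assoc J_J)
  finally show ?thesis .
qed

text \<open>The pairs \<open>(a, u + a * fps_nth f 0)\<close> form a translate of a maximal
  nonnegative graph. One of them has no positive component, because the adjoint constant term is
  again J-contractive by \<open>potapov_dual\<close>. By \<open>form_neutral\<close> that pair is
  zero, which forces \<open>u = 0\<close>.\<close>

lemma dual_form_extend_zero:
  assumes "potapov f"
    and pos: "\<And>a. pos (a * J * star a - (u + a * fps_nth f 0) * J * star (u + a * fps_nth f 0))"
  shows "u = 0"
proof -
  let ?A = "star (fps_nth f 0)"
  have "pos (form a (?A * a))" for a
    using potapov_dual[OF assms(1), where N = 0 and c = "fps_const (star a)"] by (simp add: form_def mult.assoc)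
  then obtain s where s: "(P + Q * ?A) * s = 1"
    using ginzburg_invertible by blast
  define a where "a = - (s * (Q * star u))"
  define b where "b = star u + ?A * a"
  have "(P + Q * ?A) * a = - (Q * star u)"
    unfolding a_def by (simp add: mult.assoc[symmetric] s)
  then have "P * a + Q * b = 0"
    by (simp add: b_def distrib_left distrib_right mult.assoc add.left_commute[of "P * a"])
  moreover have "pos (form a b)"
    using pos[of "star a"] by (simp add: form_def b_def)
  ultimately have "a = 0" "b = 0" using form_neutral by blast+
  then have "star u = 0" by (simp add: b_def)
  then show ?thesis by (simp add: star_eq_iff)
qed

end

section \<open>Identities between the associated polynomials and their remainders\<close>

text \<open>The polynomials \<open>rho\<close>, \<open>pi\<close>, \<open>tau\<close>, \<open>sig\<close> are, up to normalisation,
  solutions of the two Pade-type conditions at the origin satisfied by the associated polynomials.\<close>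

locale potapov_interpolation = krein +
  fixes f rho pi sig tau :: "'a fps" and n :: nat and L R :: 'a
  assumes potapov: "potapov f"
    and deg: "fps_deg_le n rho" "fps_deg_le n pi" "fps_deg_le n sig" "fps_deg_le n tau"
    and rho_0: "fps_nth rho 0 = 1" and tau_0: "fps_nth tau 0 = 1"
    and right_approx: "\<And>i. i \<le> n \<Longrightarrow> fps_nth (f * rho) i = fps_nth pi i"
    and left_approx: "\<And>i. i \<le> n \<Longrightarrow> fps_nth (tau * f) i = fps_nth sig i"
    and right_dual: "\<And>i. i \<le> n \<Longrightarrow>
      fps_nth (rev n rho * fps_const J - rev n pi * fps_const J * f) i = (if i = n then R else 0)"
    and left_dual: "\<And>i. i \<le> n \<Longrightarrow>
      fps_nth (fps_const J * rev n tau - f * fps_const J * rev n sig) i = (if i = n then L else 0)"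
begin

abbreviation X :: "'a fps" where "X \<equiv> fps_X"
abbreviation C where "C \<equiv> fps_const"

text \<open>\<open>h\<close> and \<open>k\<close> are the right and left interpolation remainders
  divided by \<open>X ^ Suc n\<close>; \<open>A'\<close> and \<open>B'\<close> are the remainders of
  the dual relations divided by \<open>X ^ n\<close>, with constant terms \<open>R\<close> and
  \<open>L\<close>.\<close>

definition h where "h = fps_shift (Suc n) (f * rho - pi)"
definition k where "k = fps_shift (Suc n) (tau * f - sig)"
definition A' where "A' = fps_shift n (rev n rho * C J - rev n pi * C J * f)"
definition B' where "B' = fps_shift n (C J * rev n tau - f * C J * rev n sig)"

lemma CJ [simp]: "C J * (C J * x) = x" "C J * C J = 1"
  by (simp_all add: mult.assoc[symmetric] J_J)

lemma X_comm: "a * X ^ i = X ^ i * a" "a * X = X * a"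
  by (simp_all add: fps_mult_fps_X_power_commute fps_mult_fps_X_commute)

lemma X_comm_mult: "a * (X ^ i * b) = X ^ i * (a * b)" "a * (X * b) = X * (a * b)"
  by (metis X_comm mult.assoc)+

text \<open>Instances only, since the general rules loop on products of powers of \<open>X\<close>.\<close>

lemmas X_left = X_comm_mult[of "C c" for c] X_comm_mult[of "rev j b" for j b] X_comm_mult[of f]
  X_comm_mult[of rho] X_comm_mult[of pi] X_comm_mult[of tau] X_comm_mult[of sig]
  X_comm[of "C c" for c] X_comm[of "rev j b" for j b] X_comm[of f]
  X_comm[of rho] X_comm[of pi] X_comm[of tau] X_comm[of sig]

lemma h: "f * rho - pi = X ^ n * (X * h)"
  using fps_eq_X_power_mult_shift[of "Suc n" "f * rho - pi"]
  by (simp add: right_approx h_def[symmetric] power_Suc2 mult.assoc del: power_Suc)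

lemma k: "tau * f - sig = X ^ n * (X * k)"
  using fps_eq_X_power_mult_shift[of "Suc n" "tau * f - sig"]
  by (simp add: left_approx k_def[symmetric] power_Suc2 mult.assoc del: power_Suc)

lemma A': "rev n rho * C J - rev n pi * C J * f = X ^ n * A'"
  unfolding A'_def by (rule fps_eq_X_power_mult_shift) (use right_dual in fastforce)

lemma B': "C J * rev n tau - f * C J * rev n sig = X ^ n * B'"
  unfolding B'_def by (rule fps_eq_X_power_mult_shift) (use left_dual in fastforce)

lemma A'_0: "fps_nth A' 0 = R"
  using right_dual[of n] by (simp add: A'_def)

lemma B'_0: "fps_nth B' 0 = L"
  using left_dual[of n] by (simp add: B'_def)

text \<open>Inserting \<open>f\<close> expresses the left side through remainders, so it vanishes
  below degree \<open>n\<close> and has coefficient \<open>R\<close> there. It is also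
  self-reciprocal of degree at most \<open>n + n\<close>, so nothing else remains.\<close>

lemma right_identity: "rev n rho * C J * rho - rev n pi * C J * pi = X ^ n * C R"
proof -
  let ?D = "rev n rho * C J * rho - rev n pi * C J * pi"
  have D: "?D = (rev n rho * C J - rev n pi * C J * f) * rho + rev n pi * C J * (f * rho - pi)"
    by (simp add: algebra_simps)
  also have "\<dots> = X ^ n * (A' * rho + X * (rev n pi * C J * h))"
    unfolding A' h by (simp add: algebra_simps X_left)
  finally have eq: "?D = X ^ n * (A' * rho + X * (rev n pi * C J * h))" .
  have rev: "rev (n + n) (rev n b * C J * b) = rev n b * C J * b" if "fps_deg_le n b" for b
  proof -
    have "rev (n + n) (rev n b * (C J * b)) = rev n (C J * b) * rev n (rev n b)"
      by (intro rev_mult rev_deg_le fps_deg_le_const_mult that)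
    then show ?thesis by (simp add: rev_rev that rev_const_mult mult.assoc)
  qed
  have "?D = X ^ n * C (fps_nth ?D n)"
  proof (rule rev_self_eq_X_power)
    show "fps_deg_le (n + n) ?D"
      by (intro fps_deg_le_diff fps_deg_le_mult fps_deg_le_mult_const rev_deg_le deg)
    show "rev (n + n) ?D = ?D" by (simp add: rev_diff rev deg)
    show "fps_nth ?D i = 0" if "i < n" for i
      unfolding eq using that by (simp add: fps_X_power_mult_nth)
  qed
  moreover have "fps_nth ?D n = R"
    unfolding eq by (simp add: fps_X_power_mult_nth A'_0 rho_0)
  ultimately show ?thesis by simp
qed

text \<open>Mirror image of \<open>right_identity\<close>, with \<open>L\<close> entering through
  the constant term of \<open>B'\<close>.\<close>

lemma left_identity: "tau * C J * rev n tau - sig * C J * rev n sig = X ^ n * C L"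
proof -
  let ?D = "tau * C J * rev n tau - sig * C J * rev n sig"
  have D: "?D = tau * (C J * rev n tau - f * C J * rev n sig) + (tau * f - sig) * C J * rev n sig"
    by (simp add: algebra_simps)
  also have "\<dots> = X ^ n * (tau * B' + X * (k * C J * rev n sig))"
    unfolding B' k by (simp add: algebra_simps X_left)
  finally have eq: "?D = X ^ n * (tau * B' + X * (k * C J * rev n sig))" .
  have rev: "rev (n + n) (b * C J * rev n b) = b * C J * rev n b" if "fps_deg_le n b" for b
  proof -
    have "rev (n + n) ((b * C J) * rev n b) = rev n (rev n b) * rev n (b * C J)"
      by (intro rev_mult rev_deg_le fps_deg_le_mult_const that)
    then show ?thesis by (simp add: rev_rev that rev_mult_const mult.assoc)
  qed
  have "?D = X ^ n * C (fps_nth ?D n)"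
  proof (rule rev_self_eq_X_power)
    show "fps_deg_le (n + n) ?D"
      by (intro fps_deg_le_diff fps_deg_le_mult fps_deg_le_mult_const rev_deg_le deg)
    show "rev (n + n) ?D = ?D" by (simp add: rev_diff rev deg)
    show "fps_nth ?D i = 0" if "i < n" for i
      unfolding eq using that by (simp add: fps_X_power_mult_nth)
  qed
  moreover have "fps_nth ?D n = L"
    unfolding eq by (simp add: fps_X_power_mult_nth B'_0 tau_0)
  ultimately show ?thesis by simp
qed

text \<open>The difference \<open>sig * rho - tau * pi\<close> has degree at most
  \<open>n + n\<close>. The interpolation remainders kill its coefficients up to \<open>n\<close>,
  and the dual remainders kill the coefficients of its reversal below \<open>n\<close>, that is, its
  own coefficients above \<open>n\<close>.\<close>

lemma rev_mixed_identity: "rev n rho * rev n sig = rev n pi * rev n tau"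
  and mixed_identity: "sig * rho = tau * pi"
proof -
  let ?D = "sig * rho - tau * pi"
  have "?D = tau * (f * rho - pi) - (tau * f - sig) * rho"
    by (simp add: algebra_simps)
  also have "\<dots> = X ^ n * (X * (tau * h - k * rho))"
    unfolding h k by (simp add: algebra_simps X_left)
  finally have low: "fps_nth ?D i = 0" if "i \<le> n" for i
    using that by (simp add: fps_X_power_mult_nth)
  have rD: "rev (n + n) ?D = rev n rho * rev n sig - rev n pi * rev n tau"
    by (simp add: rev_diff rev_mult deg)
  also have "\<dots> = (rev n rho * C J - rev n pi * C J * f) * C J * rev n sig
      - rev n pi * C J * (C J * rev n tau - f * C J * rev n sig)"
    by (simp add: algebra_simps)
  also have "\<dots> = X ^ n * (A' * C J * rev n sig - rev n pi * C J * B')"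
    unfolding A' B' by (simp add: algebra_simps X_left)
  finally have "fps_nth (rev (n + n) ?D) i = 0" if "i < n" for i
    using that by (simp add: fps_X_power_mult_nth)
  moreover have "fps_nth ?D i = star (fps_nth (rev (n + n) ?D) (n + n - i))" if "i \<le> n + n" for i
    using that by simp
  ultimately have "fps_nth ?D i = 0" if "n < i" "i \<le> n + n" for i
    using that by (metis less_diff_conv2 nat_add_left_cancel_less star_zero)
  moreover have "fps_nth ?D i = 0" if "n + n < i" for i
    using that by (intro fps_deg_leD[of "n + n"] fps_deg_le_diff fps_deg_le_mult deg)
  ultimately have "?D = 0"
    using low by (intro fps_ext) (metis fps_zero_nth not_le)
  then show "sig * rho = tau * pi" by simp
  have "rev (n + n) ?D = 0"
    by (simp only: \<open>?D = 0\<close>) (rule fps_ext, simp)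
  then show "rev n rho * rev n sig = rev n pi * rev n tau"
    using rD by simp
qed

text \<open>Coefficient \<open>n\<close> of \<open>right_identity\<close> is the form on the graph
  of \<open>f\<close> at the input \<open>rho\<close>, where the output agrees with
  \<open>pi\<close> up to degree \<open>n\<close>.\<close>

lemma pos_R: "pos R"
proof -
  have "R = fps_nth (rev n rho * (C J * rho) - rev n pi * (C J * pi)) n"
    using right_identity by (simp add: fps_X_power_mult_nth mult.assoc)
  also have "\<dots> = (\<Sum>i\<le>n. form (fps_nth rho i) (fps_nth (f * rho) i))"
    by (simp add: rev_mult_nth form_def right_approx sum_subtractf mult.assoc)
  finally show ?thesis using potapovD[OF potapov] by simp
qed

lemma L_eq_sum: "L = (\<Sum>i\<le>n. fps_nth tau i * J * star (fps_nth tau i)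
    - fps_nth sig i * J * star (fps_nth sig i))"
proof -
  have "L = fps_nth ((tau * C J) * rev n tau - (sig * C J) * rev n sig) n"
    using left_identity by (simp add: fps_X_power_mult_nth)
  then show ?thesis by (simp only: fps_sub_nth mult_rev_nth sum_subtractf) simp
qed

text \<open>Here \<open>tau\<close> multiplies \<open>f\<close> from the left, so the dual
  inequality is the one that applies.\<close>

lemma pos_L: "pos L"
  using potapov_dual[OF potapov, where c = tau and N = n]
  by (simp add: L_eq_sum left_approx)

text \<open>Both sides are \<open>tau * f * rho\<close> minus the common polynomial
  \<open>sig * rho = tau * pi\<close>, divided by \<open>X ^ Suc n\<close>.\<close>

lemma tau_h: "tau * h = k * rho"
proof (rule fps_X_power_mult_cancel)
  have "tau * (f * rho - pi) = (tau * f - sig) * rho"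
    by (simp add: algebra_simps mixed_identity)
  then show "X ^ Suc n * (tau * h) = X ^ Suc n * (k * rho)"
    unfolding h k by (simp add: mult.assoc X_left power_Suc2 del: power_Suc)
qed

text \<open>\<open>left_identity\<close> with the polynomials replaced by remainders and
  \<open>X ^ n\<close> cancelled; \<open>A'_rho\<close> does the same with
  \<open>right_identity\<close>.\<close>

lemma tau_B': "tau * B' = C L - X * (k * C J * rev n sig)"
proof (rule fps_X_power_mult_cancel)
  have "X ^ n * (tau * B') = tau * (C J * rev n tau - f * C J * rev n sig)"
    by (simp add: B' X_left)
  also have "\<dots> = X ^ n * C L - (tau * f - sig) * C J * rev n sig"
    by (simp add: left_identity[symmetric] algebra_simps)
  finally show "X ^ n * (tau * B') = X ^ n * (C L - X * (k * C J * rev n sig))"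
    unfolding k by (simp add: algebra_simps X_left)
qed

lemma A'_rho: "A' * rho = C R - X * (rev n pi * C J * h)"
proof (rule fps_X_power_mult_cancel)
  have "X ^ n * (A' * rho) = (rev n rho * C J - rev n pi * C J * f) * rho"
    by (simp only: A' mult.assoc[symmetric])
  also have "\<dots> = X ^ n * C R - rev n pi * C J * (f * rho - pi)"
    by (simp add: right_identity[symmetric] algebra_simps)
  finally show "X ^ n * (A' * rho) = X ^ n * (C R - X * (rev n pi * C J * h))"
    unfolding h by (simp add: algebra_simps X_left)
qed

lemma A'_sig: "A' * C J * rev n sig = rev n pi * C J * B'"
proof (rule fps_X_power_mult_cancel)
  have "(rev n rho * C J - rev n pi * C J * f) * C J * rev n sig
      = rev n pi * C J * (C J * rev n tau - f * C J * rev n sig)"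
    by (simp add: algebra_simps rev_mixed_identity)
  then show "X ^ n * (A' * C J * rev n sig) = X ^ n * (rev n pi * C J * B')"
    unfolding A' B' by (simp add: mult.assoc X_left)
qed

text \<open>A row \<open>v\<close> with \<open>v * L = 0\<close> makes \<open>v * tau\<close> a
  neutral input for the dual form up to degree \<open>n\<close>. If the first nonzero coefficient of
  \<open>v * k\<close> occurred at \<open>j\<close>, perturbing the input by an arbitrary
  \<open>a\<close> at that output degree would leave exactly the form of the pair
  \<open>(a, v * fps_nth k j + a * fps_nth f 0)\<close>, and \<open>dual_form_extend_zero\<close>
  excludes this.\<close>

lemma left_null_k:
  assumes "v * L = 0"
  shows "v * fps_nth k j = 0"
proof (induction j rule: less_induct)
  case (less j)
  define N where "N = Suc n + j"
  have "pos (a * J * star a - (v * fps_nth k j + a * fps_nth f 0) * J * star (v * fps_nth k j + a * fps_nth f 0))"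
    (is "pos ?E") for a
  proof -
    let ?c = "C v * tau + C a * X ^ N"
    have "?c * f = C v * (tau * f) + X ^ N * (C a * f)"
      by (simp add: algebra_simps X_comm X_comm_mult)
    also have "tau * f = sig + X ^ Suc n * k" using k by (simp add: power_Suc2 mult.assoc algebra_simps del: power_Suc)
    finally have cf: "?c * f = C v * sig + X ^ Suc n * (C v * k) + X ^ N * (C a * f)"
      by (simp only: distrib_left X_comm_mult(1)[of "C v"])
    \<comment> \<open>Between \<open>n\<close> and \<open>N\<close> the input vanishes, and so does
      the output by the induction hypothesis; the form is concentrated on the indices up to
      \<open>n\<close> and on \<open>N\<close>.\<close>
    have g: "fps_nth ?c i * J * star (fps_nth ?c i) - fps_nth (?c * f) i * J * star (fps_nth (?c * f) i)
      = (if i \<le> n then v * (fps_nth tau i * J * star (fps_nth tau i) - fps_nth sig i * J * star (fps_nth sig i)) * star v else 0)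
        + (if i = N then ?E else 0)" if "i \<le> N" for i
    proof -
      consider "i \<le> n" | "n < i" "i < N" | "i = N" using \<open>i \<le> N\<close> by linarith
      then show ?thesis
      proof cases
        case 1
        then have "i < Suc n" "i < N" "i \<noteq> N" by (auto simp: N_def)
        with 1 show ?thesis unfolding cf
          by (simp add: fps_X_power_mult_nth fps_X_power_mult_right_nth algebra_simps del: power_Suc)
      next
        case 2
        then have "v * fps_nth k (i - Suc n) = 0"
          by (intro less.IH) (auto simp: N_def)
        then have "fps_nth (X ^ Suc n * (C v * k)) i = 0"
          using 2 by (subst fps_X_power_mult_nth) auto
        with 2 show ?thesis unfolding cf
          by (simp add: fps_X_power_mult_nth fps_X_power_mult_right_nth
              fps_deg_leD[OF deg(3)] fps_deg_leD[OF deg(4)] del: power_Suc)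
      next
        case 3
        then have "fps_nth (X ^ Suc n * (C v * k)) i = v * fps_nth k j"
          by (subst fps_X_power_mult_nth) (simp add: N_def)
        moreover have "n < i" using 3 by (simp add: N_def)
        ultimately show ?thesis unfolding cf using 3
          by (simp add: fps_X_power_mult_nth fps_X_power_mult_right_nth
              fps_deg_leD[OF deg(3)] fps_deg_leD[OF deg(4)] del: power_Suc)
      qed
    qed
    have "(\<Sum>i\<le>N. fps_nth ?c i * J * star (fps_nth ?c i) - fps_nth (?c * f) i * J * star (fps_nth (?c * f) i))
      = (\<Sum>i\<le>N. if i \<in> {..n} then v * (fps_nth tau i * J * star (fps_nth tau i) - fps_nth sig i * J * star (fps_nth sig i)) * star v else 0)
        + (\<Sum>i\<le>N. if i = N then ?E else 0)"
      by (simp only: sum.distrib[symmetric] atMost_iff, rule sum.cong[OF refl], rule g) simp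
    also have "(\<Sum>i\<le>N. if i \<in> {..n} then v * (fps_nth tau i * J * star (fps_nth tau i) - fps_nth sig i * J * star (fps_nth sig i)) * star v else 0)
      = (\<Sum>i\<le>n. v * (fps_nth tau i * J * star (fps_nth tau i) - fps_nth sig i * J * star (fps_nth sig i)) * star v)"
      by (subst sum.inter_restrict[symmetric]) (auto simp: N_def intro!: sum.cong)
    also have "\<dots> = v * L * star v"
      by (simp add: L_eq_sum sum_distrib_left sum_distrib_right)
    finally show ?thesis
      using potapov_dual[OF potapov, where c = ?c and N = N] assms by simp
  qed
  then show ?case by (rule dual_form_extend_zero[OF potapov])
qed

end

section \<open>The fixed point equation and the contractive parameter\<close>

locale potapov_interpolation_sqrt = potapov_interpolation +
  fixes l li r ri :: 'a
  assumes l: "star l = l" "l * l = L" "l * li * l = l" "li * l * li = li" "li * l = l * li"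
    and r: "star r = r" "r * r = R" "r * ri * r = r" "ri * r * ri = ri" "ri * r = r * ri"
      "star (r * ri) = r * ri"
begin

lemma l_mult: "l * (li * (l * x)) = l * x" "li * (l * (li * x)) = li * x"
  and r_mult: "r * (ri * (r * x)) = r * x" "ri * (r * (ri * x)) = ri * x"
  by (metis l(3) mult.assoc, metis l(4) mult.assoc, metis r(3) mult.assoc, metis r(4) mult.assoc)

text \<open>\<open>li * li\<close> serves as the pseudo-inverse of \<open>L\<close>, and the product
  is the projection \<open>l * li\<close> onto the range of \<open>L\<close>.\<close>

lemma L_inverse: "L * (li * li) = l * li"
proof -
  have "L * (li * li) = l * (l * li) * li" by (simp add: l(2)[symmetric] mult.assoc)
  also have "\<dots> = l * (li * l) * li" by (simp only: l(5))
  finally show ?thesis by (simp add: mult.assoc l_mult)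
qed

lemma R_inverse: "(ri * ri) * R = ri * r"
proof -
  have "(ri * ri) * R = ri * (ri * r) * r" by (simp add: r(2)[symmetric] mult.assoc)
  also have "\<dots> = ri * (r * ri) * r" by (simp only: r(5))
  finally show ?thesis by (simp add: mult.assoc r_mult)
qed

text \<open>The complementary projection \<open>1 - l * li\<close> annihilates \<open>L\<close> from
  the left, hence \<open>k\<close> by \<open>left_null_k\<close>. This replaces invertibility of
  \<open>L\<close> in \<open>L_\<Phi>\<close>.\<close>

lemma range_k: "C (l * li) * k = k"
proof (rule fps_ext)
  fix j
  have "l * (li * (l * l)) = l * l" by (rule l_mult)
  then have "(1 - l * li) * L = 0"
    by (simp add: left_diff_distrib l(2)[symmetric] mult.assoc)
  then have "(1 - l * li) * fps_nth k j = 0" by (rule left_null_k)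
  then show "fps_nth (C (l * li) * k) j = fps_nth k j"
    by (simp add: algebra_simps)
qed

definition k' where "k' = C (li * li) * k"

definition \<Phi> where "\<Phi> = (SOME \<Phi>. \<Phi> = k' * (rho + X * (C J * rev n sig * \<Phi>)))"

text \<open>The series multiplying \<Phi> after rearrangement is \<open>1\<close> plus a multiple of
  \<open>X\<close>, hence invertible; the solution is \<open>g * (k' * rho)\<close> with
  \<open>g\<close> its inverse.\<close>

lemma \<Phi>: "\<Phi> = k' * (rho + X * (C J * rev n sig * \<Phi>))"
proof -
  obtain g where "(1 - X * (k' * C J * rev n sig)) * g = 1"
    by (rule fps_ring_1_inverse[of 1 "1 - X * (k' * C J * rev n sig)" 1]) simp_all
  then have "g - X * (k' * C J * rev n sig) * g = 1" by (simp add: left_diff_distrib)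
  then have g: "g = 1 + X * (k' * C J * rev n sig) * g" by (simp add: algebra_simps)
  have "g * (k' * rho) = k' * rho + X * (k' * C J * rev n sig) * g * (k' * rho)"
    by (subst g) (simp only: distrib_right mult_1_left)
  also have "\<dots> = k' * (rho + X * (C J * rev n sig * (g * (k' * rho))))"
    by (simp add: distrib_left mult.assoc X_comm_mult(2)[of k'])
  finally show ?thesis unfolding \<Phi>_def by (rule someI)
qed

definition G where "G = rho + X * (C J * rev n sig * \<Phi>)"

lemma L_\<Phi>: "C L * \<Phi> = k * G"
proof -
  have "C L * k' = C (L * (li * li)) * k"
    unfolding k'_def by (simp only: mult.assoc[symmetric] fps_const_mult)
  also have "\<dots> = k" by (simp only: L_inverse range_k)
  finally have "C L * k' = k" .
  then show ?thesis
    by (subst \<Phi>) (simp only: mult.assoc[symmetric] G_def)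
qed

lemma range_\<Phi>: "C (li * l) * \<Phi> = \<Phi>"
proof -
  have "C (li * l) * k' = C (li * l * (li * li)) * k"
    unfolding k'_def by (simp only: mult.assoc[symmetric] fps_const_mult)
  also have "\<dots> = k'" by (simp add: k'_def mult.assoc l_mult)
  finally have "C (li * l) * k' = k'" .
  then show ?thesis
    by (subst (1 2) \<Phi>) (simp only: mult.assoc[symmetric])
qed

text \<open>This is the purpose of the fixed point equation. After multiplication by
  \<open>tau\<close>, which is invertible as a series, both sides become \<open>k * rho\<close>, by
  \<open>tau_h\<close> and by \<open>tau_B'\<close> together with \<open>L_\<Phi>\<close>.\<close>

lemma h_eq: "h = B' * \<Phi>"
proof -
  obtain g where g: "g * tau = 1"
    by (rule fps_ring_1_inverse[of 1 tau 1]) (simp_all add: tau_0)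
  have "tau * (B' * \<Phi>) = C L * \<Phi> - X * (k * C J * rev n sig * \<Phi>)"
    by (simp only: mult.assoc[symmetric] tau_B' left_diff_distrib)
  also have "\<dots> = k * rho"
    unfolding L_\<Phi> G_def by (simp add: distrib_left mult.assoc X_comm_mult(2)[of k])
  finally have "tau * h = tau * (B' * \<Phi>)" by (simp add: tau_h)
  then have "g * tau * h = g * tau * (B' * \<Phi>)" by (simp only: mult.assoc)
  then show ?thesis by (simp add: g)
qed

lemma right_remainder: "f * rho - pi = X * ((C J * rev n tau - f * C J * rev n sig) * \<Phi>)"
  unfolding h h_eq B' by (simp add: mult.assoc X_comm_mult(1)[of X])

lemma right_equation:
  "f * (rho + X * (C J * rev n sig * \<Phi>)) = pi + X * (C J * rev n tau * \<Phi>)"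
proof -
  have "f * (rho + X * (C J * rev n sig * \<Phi>)) = (f * rho - pi) + pi + X * (f * C J * rev n sig * \<Phi>)"
    by (simp add: distrib_left mult.assoc X_comm_mult(2)[of f])
  then show ?thesis unfolding right_remainder by (simp add: algebra_simps)
qed

text \<open>The input is \<open>rho p + X J rev sig u\<close> with u the truncation of \<open>\<Phi> p\<close>. The output of
  \<open>f\<close> agrees with \<open>pi p + X J rev tau u\<close> up to the degree of these polynomials, because
  \<open>J rev tau - f J rev sig\<close> vanishes to order n.\<close>

lemma pos_\<Phi>_polynomial:
  assumes p: "fps_deg_le N p"
  shows "pos (\<Sum>i\<le>N. star (fps_nth p i) * R * fps_nth p i
     - star (fps_nth (\<Phi> * p) i) * L * fps_nth (\<Phi> * p) i)"
proof -
  \<comment> \<open>The truncation keeps input and approximate output polynomials, so that their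
    forms can be evaluated through reversed products.\<close>
  define u where "u = fps_trunc N (\<Phi> * p)"
  define w where "w = fps_shift (Suc N) (\<Phi> * p - u)"
  have w: "\<Phi> * p = u + X ^ Suc N * w"
    using fps_eq_X_power_mult_shift[of "Suc N" "\<Phi> * p - u"]
    by (simp add: u_def w_def algebra_simps del: power_Suc)
  define b where "b = rho * p + X * (C J * rev n sig * u)"
  define a where "a = pi * p + X * (C J * rev n tau * u)"
  define M where "M = Suc (n + N)"
  have "f * b = a + (f * rho - pi) * p - X * ((C J * rev n tau - f * C J * rev n sig) * u)"
    by (simp add: b_def a_def algebra_simps X_left)
  also have "(f * rho - pi) * p = X * ((C J * rev n tau - f * C J * rev n sig) * (u + X ^ Suc N * w))"
    unfolding right_remainder w[symmetric] by (simp only: mult.assoc)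
  finally have "f * b = a + X * (X ^ n * B' * (X ^ Suc N * w))"
    unfolding B' by (simp add: distrib_left del: power_Suc)
  also have "X * (X ^ n * B' * (X ^ Suc N * w)) = X ^ (Suc n + Suc N) * (B' * w)"
    by (simp only: mult.assoc X_comm_mult[of B'] power_add power_Suc)
  \<comment> \<open>The error starts in degree \<open>n + N + 2\<close>, one above \<open>M\<close>,
    so all outputs entering the form up to \<open>M\<close> are those of \<open>a\<close>.\<close>
  finally have f_b: "f * b = a + X ^ (Suc n + Suc N) * (B' * w)" .
  have fb: "fps_nth (f * b) i = fps_nth a i" if "i \<le> M" for i
  proof -
    have "fps_nth (X ^ (Suc n + Suc N) * (B' * w)) i = 0"
      using that by (subst fps_X_power_mult_nth) (simp add: M_def)
    then show ?thesis by (simp only: f_b fps_add_nth add_0_right)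
  qed
  have u: "fps_deg_le N u" by (simp add: u_def)
  \<comment> \<open>\<open>rho * p\<close> has degree at most \<open>n + N\<close>, one less than
    \<open>M\<close>, which produces the factor \<open>X\<close>; the other summand of
    \<open>b\<close> already carries an \<open>X\<close>, which the reversal absorbs.\<close>
  have rev_b: "rev M b = X * (rev N p * rev n rho) + rev N u * sig * C J"
  proof -
    have "rev M (rho * p) = X * (rev N p * rev n rho)"
      unfolding M_def using deg p by (subst rev_Suc) (auto intro: fps_deg_le_mult simp: rev_mult)
    moreover have "rev M (X * (C J * rev n sig * u)) = rev N u * sig * C J"
      unfolding M_def rev_X_mult using u deg
      by (subst rev_mult) (auto intro: fps_deg_le_const_mult simp: rev_const_mult rev_rev mult.assoc)
    ultimately show ?thesis by (simp add: b_def rev_add)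
  qed
  have rev_a: "rev M a = X * (rev N p * rev n pi) + rev N u * tau * C J"
  proof -
    have "rev M (pi * p) = X * (rev N p * rev n pi)"
      unfolding M_def using deg p by (subst rev_Suc) (auto intro: fps_deg_le_mult simp: rev_mult)
    moreover have "rev M (X * (C J * rev n tau * u)) = rev N u * tau * C J"
      unfolding M_def rev_X_mult using u deg
      by (subst rev_mult) (auto intro: fps_deg_le_const_mult simp: rev_const_mult rev_rev mult.assoc)
    ultimately show ?thesis by (simp add: a_def rev_add)
  qed
  \<comment> \<open>Of the four groups of products the two mixed ones vanish by the mixed
    identities, and the other two collapse to \<open>X ^ n\<close> times \<open>R\<close> and
    \<open>L\<close>. Coefficient \<open>M\<close> of the result is the asserted sum.\<close>
  have "rev M b * C J * b - rev M a * C J * a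
    = X * (rev N p * (rev n rho * C J * rho - rev n pi * C J * pi) * p)
      + X * (X * (rev N p * (rev n rho * rev n sig - rev n pi * rev n tau) * u))
      + rev N u * (sig * rho - tau * pi) * p
      - X * (rev N u * (tau * C J * rev n tau - sig * C J * rev n sig) * u)"
    unfolding rev_a rev_b unfolding a_def b_def
    by (simp add: algebra_simps X_left X_comm_mult(2)[of "rev N u * a" for a])
  also have "\<dots> = X * (rev N p * (X ^ n * C R) * p) - X * (rev N u * (X ^ n * C L) * u)"
    by (simp add: right_identity left_identity rev_mixed_identity mixed_identity)
  also have "\<dots> = X ^ Suc n * (rev N p * (C R * p) - rev N u * (C L * u))"
    by (simp add: algebra_simps X_left X_comm_mult(1)[of X])
  finally have "fps_nth (rev M b * C J * b - rev M a * C J * a) M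
    = fps_nth (rev N p * (C R * p) - rev N u * (C L * u)) N"
    by (simp only: fps_X_power_mult_nth[of "Suc n"]) (simp add: M_def)
  also have "\<dots> = (\<Sum>i\<le>N. star (fps_nth p i) * R * fps_nth p i
     - star (fps_nth (\<Phi> * p) i) * L * fps_nth (\<Phi> * p) i)"
    by (simp add: rev_mult_nth sum_subtractf u_def mult.assoc)
  also have "fps_nth (rev M b * C J * b - rev M a * C J * a) M
     = (\<Sum>i\<le>M. form (fps_nth b i) (fps_nth (f * b) i))"
    by (simp add: mult.assoc rev_mult_nth form_def fb sum_subtractf)
  finally show ?thesis using potapovD[OF potapov, of b M] by simp
qed

text \<open>With the projection \<open>E\<close> onto the kernel of \<open>R\<close> as constant
  input, the inequality leaves minus a sum of squares of coefficients of
  \<open>l * \<Phi> * E\<close>. These vanish, and \<open>li\<close> removes the factor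
  \<open>l\<close> because \<Phi> lies in the range of \<open>L\<close>.\<close>

lemma \<Phi>_range_R: "\<Phi> * C (ri * r) = \<Phi>"
proof -
  define E where "E = 1 - ri * r"
  have "r * E = 0" by (simp add: E_def right_diff_distrib mult.assoc[symmetric] r(3))
  then have "R * E = 0" by (simp add: r(2)[symmetric] mult.assoc)
  have "fps_nth (\<Phi> * C E) j = 0" for j
  proof -
    let ?x = "\<lambda>i. l * fps_nth (\<Phi> * C E) i"
    have "star (fps_nth (C E) i) * R * fps_nth (C E) i = 0" for i
      using \<open>R * E = 0\<close> by (simp add: mult.assoc)
    then have "pos (- (\<Sum>i\<le>j. star (?x i) * ?x i))"
      using pos_\<Phi>_polynomial[of j "C E"]
      by (simp add: sum_negf mult.assoc l(1) l(2)[symmetric])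
    then have "?x j = 0" by (rule pos_minus_sum_squares[rotated]) auto
    then have "fps_nth (C (li * l) * (\<Phi> * C E)) j = 0" by (simp add: mult.assoc)
    then show ?thesis by (simp only: mult.assoc[symmetric] range_\<Phi>)
  qed
  then have "\<Phi> * C E = 0" by (intro fps_ext) simp
  moreover have "C E = 1 - C (ri * r)" by (simp add: E_def fps_const_sub[symmetric])
  ultimately show ?thesis by (simp add: right_diff_distrib)
qed

definition S where "S = C l * \<Phi> * C ri"

lemma \<Phi>_eq_S: "C li * S * C r = \<Phi>"
proof -
  have "C li * S * C r = C (li * l) * \<Phi> * C (ri * r)"
    by (simp only: S_def mult.assoc fps_const_mult[symmetric])
  then show ?thesis by (simp only: range_\<Phi> \<Phi>_range_R)
qed

text \<open>The inequality for \<Phi> is applied to the input \<open>ri * q\<close>. It misses only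
  the square of the component \<open>(1 - r * ri) * q\<close> in the kernel of \<open>R\<close>, and
  adding this square preserves positivity.\<close>

lemma S_contractive: "pos (\<Sum>i\<le>N. star (fps_nth q i) * fps_nth q i
     - star (fps_nth (S * q) i) * fps_nth (S * q) i)"
proof -
  \<comment> \<open>\<open>pos_\<Phi>_polynomial\<close> requires a polynomial input; truncation
    does not affect the coefficients up to \<open>N\<close>.\<close>
  define t where "t = fps_trunc N q"
  have e: "star (fps_nth (C ri * t) i) * R * fps_nth (C ri * t) i
      - star (fps_nth (\<Phi> * (C ri * t)) i) * L * fps_nth (\<Phi> * (C ri * t)) i
    = star (fps_nth q i) * fps_nth q i - star (fps_nth (S * q) i) * fps_nth (S * q) i
      - star ((1 - r * ri) * fps_nth q i) * ((1 - r * ri) * fps_nth q i)" if "i \<le> N" for i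
  proof -
    have "S * t = C l * (\<Phi> * (C ri * t))" by (simp only: S_def mult.assoc)
    then have "fps_nth (S * q) i = l * fps_nth (\<Phi> * (C ri * t)) i"
      using that fps_mult_nth_trunc[OF that, of S q] by (simp add: t_def)
    then have 1: "star (fps_nth (S * q) i) * fps_nth (S * q) i
        = star (fps_nth (\<Phi> * (C ri * t)) i) * L * fps_nth (\<Phi> * (C ri * t)) i"
      by (simp add: l(1) l(2)[symmetric] mult.assoc)
    have proj: "star (r * ri) * (r * ri) = r * ri"
      by (simp only: r(6)) (simp only: mult.assoc[symmetric] r(3))
    have "star ri * R * ri = star (r * ri) * (r * ri)"
      by (simp add: r(1) r(2)[symmetric] mult.assoc)
    then have R: "star ri * (R * (ri * x)) = r * (ri * x)" for x
      using proj by (metis mult.assoc)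
    have "star (1 - r * ri) * (1 - r * ri) = 1 - r * ri"
      using proj r(6) by (simp add: left_diff_distrib right_diff_distrib)
    then have "star ((1 - r * ri) * x) * ((1 - r * ri) * x) = star x * ((1 - r * ri) * x)" for x
      by (metis mult.assoc star_mult)
    then have 2: "star ((1 - r * ri) * x) * ((1 - r * ri) * x) = star x * x - star x * (r * (ri * x))" for x
      by (simp add: algebra_simps)
    show ?thesis unfolding 1 2 using that by (simp add: t_def mult.assoc R)
  qed
  have "(\<Sum>i\<le>N. star (fps_nth q i) * fps_nth q i - star (fps_nth (S * q) i) * fps_nth (S * q) i)
    = (\<Sum>i\<le>N. star (fps_nth (C ri * t) i) * R * fps_nth (C ri * t) i
      - star (fps_nth (\<Phi> * (C ri * t)) i) * L * fps_nth (\<Phi> * (C ri * t)) i)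
    + (\<Sum>i\<le>N. star ((1 - r * ri) * fps_nth q i) * ((1 - r * ri) * fps_nth q i))"
    unfolding sum.distrib[symmetric] by (rule sum.cong[OF refl], subst e) auto
  also have "pos \<dots>"
    by (intro pos_add pos_\<Phi>_polynomial pos_sum pos_square fps_deg_le_const_mult)
      (simp add: t_def)
  finally show ?thesis .
qed

lemma right_representation:
  "f * (X * (C J * rev n sig * C li * S * C r) + rho)
    = X * (C J * rev n tau * C li * S * C r) + pi"
  using right_equation by (simp only: mult.assoc \<Phi>_eq_S[unfolded mult.assoc] add.commute)

text \<open>From \<open>A' * G = C R\<close> and the absorption of the right projection by \<Phi>,
  the product of \<open>L\<close>, \<Phi>, the pseudo-inverse of \<open>R\<close>, \<open>A'\<close>
  and \<open>G\<close> equals \<open>k * G\<close>. As \<open>G\<close> has constant term 1 it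
  cancels, and the resulting formula for \<open>k\<close>, multiplied by \<open>X ^ Suc n\<close>,
  is the claim.\<close>

lemma left_representation:
  "(X * (C l * S * C ri * rev n pi * C J) + tau) * f
    = X * (C l * S * C ri * rev n rho * C J) + sig"
proof -
  obtain g where g: "G * g = 1"
    by (rule fps_ring_1_inverse[of 1 G 1]) (simp_all add: G_def rho_0)
  define Ri where "Ri = ri * ri"
  have LS: "C l * S * C ri = C L * \<Phi> * C Ri"
    by (simp only: S_def Ri_def l(2)[symmetric] mult.assoc fps_const_mult[symmetric])
  have "A' * G = A' * rho + X * (A' * C J * rev n sig * \<Phi>)"
    by (simp add: G_def distrib_left mult.assoc X_comm_mult(2)[of A'])
  also have "\<dots> = C R"
    unfolding A'_rho A'_sig h_eq by (simp add: mult.assoc)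
  finally have "C L * \<Phi> * C Ri * A' * G = C L * (\<Phi> * C (Ri * R))"
    by (simp only: mult.assoc fps_const_mult[symmetric])
  also have "\<dots> = k * G"
    by (simp only: Ri_def R_inverse \<Phi>_range_R L_\<Phi>)
  finally have "C L * \<Phi> * C Ri * A' * G * g = k * G * g" by simp
  then have "k = C L * \<Phi> * C Ri * A'" by (simp add: mult.assoc g)
  then have "tau * f - sig = X ^ n * (X * (C l * S * C ri * A'))"
    unfolding k LS by simp
  also have "\<dots> = X * (C l * S * C ri * (X ^ n * A'))"
    by (simp only: X_comm_mult(1)[of "C l * S * C ri"] X_comm_mult(2)[of "X ^ n"])
  also have "\<dots> = X * (C l * S * C ri * (rev n rho * C J - rev n pi * C J * f))"
    by (simp only: A')
  finally show ?thesis by (simp add: algebra_simps)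
qed

end

section \<open>Positive semidefinite matrices\<close>

unbundle no vec_syntax

lemma mat_adjoint_dim [simp]: "dim_row (mat_adjoint A) = dim_col A" "dim_col (mat_adjoint A) = dim_row A"
  by (simp_all add: mat_adjoint_def)

lemma mat_adjoint_index [simp]:
  "i < dim_col A \<Longrightarrow> j < dim_row A \<Longrightarrow> mat_adjoint (A :: complex mat) $$ (i, j) = cnj (A $$ (j, i))"
  by (simp add: mat_adjoint_def mat_of_rows_index)

lemma mat_adjoint_carrier [simp]: "mat_adjoint A \<in> carrier_mat n m \<longleftrightarrow> A \<in> carrier_mat m n"
  unfolding carrier_mat_def by (simp add: conj_commute)

lemma mat_adjoint_adjoint [simp]: "mat_adjoint (mat_adjoint A) = (A :: complex mat)"
  by (rule eq_matI) auto

lemma mat_adjoint_one [simp]: "mat_adjoint (1\<^sub>m n :: complex mat) = 1\<^sub>m n"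
  by (rule eq_matI) auto

lemma mat_adjoint_zero [simp]: "mat_adjoint (0\<^sub>m n m :: complex mat) = 0\<^sub>m m n"
  by (rule eq_matI) auto

lemma mat_adjoint_add:
  "A \<in> carrier_mat n m \<Longrightarrow> B \<in> carrier_mat n m \<Longrightarrow> mat_adjoint (A + B) = mat_adjoint A + mat_adjoint (B :: complex mat)"
  by (rule eq_matI) auto

lemma mat_adjoint_minus:
  "A \<in> carrier_mat n m \<Longrightarrow> B \<in> carrier_mat n m \<Longrightarrow> mat_adjoint (A - B) = mat_adjoint A - mat_adjoint (B :: complex mat)"
  by (rule eq_matI) auto

lemma mat_adjoint_mult:
  "dim_col A = dim_row B \<Longrightarrow> mat_adjoint (A * B) = mat_adjoint B * mat_adjoint (A :: complex mat)"
  by (rule eq_matI) (auto simp: scalar_prod_def intro!: sum.cong)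

lemma mat_mult_assoc:
  "dim_col A = dim_row B \<Longrightarrow> dim_col B = dim_row C \<Longrightarrow> A * B * C = A * (B * (C :: complex mat))"
  by (rule assoc_mult_mat[of _ "dim_row A" "dim_col A" _ "dim_col B" _ "dim_col C"]) auto

lemma mat_mult_carrier [simp]:
  "A * B \<in> carrier_mat n m \<longleftrightarrow> dim_row A = n \<and> dim_col B = m"
  unfolding carrier_mat_def by (simp add: conj_commute)

lemma cscalar_prod_adjoint:
  assumes "A \<in> carrier_mat n m" "v \<in> carrier_vec m" "w \<in> carrier_vec n"
  shows "(A *\<^sub>v v) \<bullet>c w = v \<bullet>c (mat_adjoint A *\<^sub>v (w :: complex vec))"
proof -
  have "(A *\<^sub>v v) \<bullet>c w = (\<Sum>i<n. \<Sum>j<m. A $$ (i, j) * v $ j * cnj (w $ i))"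
    using assms by (auto simp: scalar_prod_def sum_distrib_right atLeast0LessThan intro!: sum.cong)
  also have "\<dots> = (\<Sum>j<m. \<Sum>i<n. A $$ (i, j) * v $ j * cnj (w $ i))"
    by (rule sum.swap)
  also have "\<dots> = v \<bullet>c (mat_adjoint A *\<^sub>v w)"
    using assms by (auto simp: scalar_prod_def sum_distrib_left atLeast0LessThan intro!: sum.cong)
  finally show ?thesis .
qed

lemma cscalar_prod_self: "v \<bullet>c v = complex_of_real (\<Sum>i<dim_vec v. (cmod (v $ i))\<^sup>2)"
  by (simp add: scalar_prod_def atLeast0LessThan complex_mult_cnj cmod_power2)

lemma psdI:
  assumes "A \<in> carrier_mat n n" "mat_adjoint A = A"
    and "\<And>v. v \<in> carrier_vec n \<Longrightarrow> 0 \<le> Re ((A *\<^sub>v v) \<bullet>c v)"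
  shows "psd A"
  using assms by (auto simp: psd_def)

lemma psd_adjoint: "psd A \<Longrightarrow> mat_adjoint A = A"
  by (simp add: psd_def)

lemma psdD: "psd A \<Longrightarrow> A \<in> carrier_mat n n \<Longrightarrow> v \<in> carrier_vec n \<Longrightarrow> 0 \<le> Re ((A *\<^sub>v v) \<bullet>c v)"
  by (auto simp: psd_def)

lemma psd_add:
  assumes "psd A" "psd B" "A \<in> carrier_mat n n" "B \<in> carrier_mat n n"
  shows "psd (A + B)"
proof (rule psdI)
  fix v :: "complex vec" assume v: "v \<in> carrier_vec n"
  have "((A + B) *\<^sub>v v) \<bullet>c v = (A *\<^sub>v v) \<bullet>c v + (B *\<^sub>v v) \<bullet>c v"
    using assms v by (simp add: add_mult_distrib_mat_vec add_scalar_prod_distrib[of _ n])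
  then show "0 \<le> Re (((A + B) *\<^sub>v v) \<bullet>c v)"
    using psdD[OF assms(1,3) v] psdD[OF assms(2,4) v] by simp
qed (use assms in \<open>auto simp: mat_adjoint_add psd_adjoint\<close>)

lemma psd_adjoint_mult_self:
  assumes "A \<in> carrier_mat m n"
  shows "psd (mat_adjoint A * A)"
proof (rule psdI)
  fix v :: "complex vec" assume v: "v \<in> carrier_vec n"
  have "(mat_adjoint A * A) *\<^sub>v v = mat_adjoint A *\<^sub>v (A *\<^sub>v v)"
    using assms v by (intro assoc_mult_mat_vec[of _ n m _ n]) auto
  moreover have "(mat_adjoint A *\<^sub>v (A *\<^sub>v v)) \<bullet>c v = (A *\<^sub>v v) \<bullet>c (A *\<^sub>v v)"
    using assms v cscalar_prod_adjoint[of "mat_adjoint A" n m "A *\<^sub>v v" v] by simp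
  ultimately have "((mat_adjoint A * A) *\<^sub>v v) \<bullet>c v = complex_of_real (\<Sum>i<m. (cmod ((A *\<^sub>v v) $ i))\<^sup>2)"
    using assms by (simp add: cscalar_prod_self)
  then show "0 \<le> Re (((mat_adjoint A * A) *\<^sub>v v) \<bullet>c v)"
    by (simp add: sum_nonneg)
qed (use assms in \<open>auto simp: mat_adjoint_mult\<close>)

lemma quadratic_form_unit_vec:
  assumes "A \<in> carrier_mat n n" "i < n"
  shows "(A *\<^sub>v unit_vec n i) \<bullet>c unit_vec n i = (A $$ (i, i) :: complex)"
proof -
  have "conjugate (unit_vec n i) = (unit_vec n i :: complex vec)"
    by (rule eq_vecI) (auto simp: unit_vec_def)
  then show ?thesis
    using assms scalar_prod_right_unit[of i n "A *\<^sub>v unit_vec n i"] by simp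
qed

lemma psd_diag:
  assumes "psd A" "A \<in> carrier_mat n n" "i < n"
  shows "Im (A $$ (i, i)) = 0" "0 \<le> Re (A $$ (i, i))"
proof -
  have "mat_adjoint A $$ (i, i) = A $$ (i, i)" using assms by (simp add: psd_adjoint)
  then have "cnj (A $$ (i, i)) = A $$ (i, i)" using assms by simp
  then show "Im (A $$ (i, i)) = 0" by (simp add: complex_eq_iff)
  show "0 \<le> Re (A $$ (i, i))"
    using psdD[OF assms(1,2), of "unit_vec n i"] assms by (simp add: quadratic_form_unit_vec)
qed

lemma psd_conj:
  assumes "psd A" "A \<in> carrier_mat n n" "U \<in> carrier_mat n k"
  shows "psd (mat_adjoint U * A * U)"
proof (rule psdI)
  fix v :: "complex vec" assume v: "v \<in> carrier_vec k"
  have "((mat_adjoint U * A * U) *\<^sub>v v) = mat_adjoint U *\<^sub>v (A *\<^sub>v (U *\<^sub>v v))"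
    using assms v by (simp add: assoc_mult_mat_vec[of _ k n _ k] assoc_mult_mat_vec[of _ k n _ n])
  then have "((mat_adjoint U * A * U) *\<^sub>v v) \<bullet>c v = (A *\<^sub>v (U *\<^sub>v v)) \<bullet>c (U *\<^sub>v v)"
    using assms v cscalar_prod_adjoint[of "mat_adjoint U" k n "A *\<^sub>v (U *\<^sub>v v)" v] by simp
  then show "0 \<le> Re (((mat_adjoint U * A * U) *\<^sub>v v) \<bullet>c v)"
    using psdD[OF assms(1,2), of "U *\<^sub>v v"] assms v by simp
qed (use assms in \<open>auto simp: mat_adjoint_mult mat_adjoint_mult mat_adjoint_mult psd_adjoint mat_mult_assoc\<close>)

section \<open>Unitary diagonalization of Hermitian matrices\<close>

definition real_diag :: "nat \<Rightarrow> (nat \<Rightarrow> real) \<Rightarrow> complex mat" where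
  "real_diag n d = mat n n (\<lambda>(i, j). if i = j then complex_of_real (d i) else 0)"

lemma real_diag_carrier [simp]: "real_diag n d \<in> carrier_mat n n"
  by (simp add: real_diag_def)

lemma real_diag_dim [simp]: "dim_row (real_diag n d) = n" "dim_col (real_diag n d) = n"
  by (simp_all add: real_diag_def)

lemma real_diag_index [simp]: "i < n \<Longrightarrow> j < n \<Longrightarrow> real_diag n d $$ (i, j) = (if i = j then complex_of_real (d i) else 0)"
  by (simp add: real_diag_def)

lemma real_diag_adjoint [simp]: "mat_adjoint (real_diag n d) = real_diag n d"
  by (rule eq_matI) auto

lemma real_diag_mult: "real_diag n d * real_diag n e = real_diag n (\<lambda>i. d i * e i)"
  by (rule eq_matI) (auto simp: scalar_prod_def if_distrib[of "\<lambda>x. x * _"] sum.delta cong: if_cong)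

text \<open>A Householder reflection maps the first basis vector to an eigenvector of norm one; its
  phase is chosen such that the reflection vector does not vanish.\<close>

lemma householder:
  fixes v :: "complex vec"
  assumes v: "v \<in> carrier_vec n" "v \<noteq> 0\<^sub>v n" and n: "n > 0"
  obtains H c where "H \<in> carrier_mat n n" "mat_adjoint H = H" "H * H = 1\<^sub>m n"
    "c \<noteq> 0" "H *\<^sub>v unit_vec n 0 = c \<cdot>\<^sub>v v"
proof -
  define s where "s = sqrt (\<Sum>i<n. (cmod (v $ i))\<^sup>2)"
  have "\<exists>i<n. v $ i \<noteq> 0" using v by (metis carrier_vecD eq_vecI index_zero_vec)
  then have "(\<Sum>i<n. (cmod (v $ i))\<^sup>2) > 0"
    by (auto intro!: sum_pos2)
  then have s: "s > 0" and s2: "s\<^sup>2 = (\<Sum>i<n. (cmod (v $ i))\<^sup>2)"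
    by (simp_all add: s_def)
  define t where "t = (if v $ 0 = 0 then 1 else - cnj (v $ 0) / cmod (v $ 0))"
  have t: "cmod t = 1" by (auto simp: t_def norm_divide)
  have tv: "t * v $ 0 = - complex_of_real (cmod (v $ 0))"
  proof (cases "v $ 0 = 0")
    case False
    have "cnj (v $ 0) * v $ 0 = complex_of_real (cmod (v $ 0)) * complex_of_real (cmod (v $ 0))"
      using complex_norm_square[of "v $ 0"] by (simp add: power2_eq_square mult.commute[of "v $ 0"])
    with False show ?thesis by (simp add: t_def)
  qed (simp add: t_def)
  define c where "c = t / s"
  have c: "c \<noteq> 0" using t s by (auto simp: c_def)
  define u where "u = c \<cdot>\<^sub>v v"
  have u: "u \<in> carrier_vec n" using v by (simp add: u_def)
  have ui: "i < n \<Longrightarrow> u $ i = c * v $ i" for i using v by (simp add: u_def)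
  have u0: "u $ 0 = - complex_of_real (cmod (v $ 0) / s)"
    using ui[OF n] tv by (simp add: c_def field_simps)
  have un: "(\<Sum>i<n. u $ i * cnj (u $ i)) = 1"
  proof -
    have "u $ i * cnj (u $ i) = complex_of_real ((cmod (v $ i))\<^sup>2 / s\<^sup>2)" if "i < n" for i
    proof -
      have "cmod (u $ i) = cmod (v $ i) / s"
        using t s by (simp add: ui[OF that] c_def norm_mult norm_divide)
      then show ?thesis using complex_norm_square[of "u $ i"] by (simp add: power_divide)
    qed
    then have "(\<Sum>i<n. u $ i * cnj (u $ i)) = complex_of_real ((\<Sum>i<n. (cmod (v $ i))\<^sup>2) / s\<^sup>2)"
      by (simp add: sum_divide_distrib)
    then show ?thesis using s by (simp add: s2[symmetric])
  qed
  \<comment> \<open>\<open>- r\<close> is the first entry of the reflection vector \<open>z\<close>,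
    the difference of \<open>u\<close> and the first basis vector, and \<open>2 * r\<close> is its
    squared norm; hence \<open>H\<close> divides by \<open>r\<close>.\<close>
  define r where "r = 1 + cmod (v $ 0) / s"
  have r: "r > 0" using s by (simp add: r_def add_pos_nonneg)
  define z where "z i = u $ i - (if i = 0 then 1 else 0)" for i
  have z0: "z 0 = - complex_of_real r" by (simp add: z_def u0 r_def)
  have zn: "(\<Sum>i<n. cnj (z i) * z i) = 2 * complex_of_real r"
  proof -
    have "cnj (z i) * z i = u $ i * cnj (u $ i) + (if i = 0 then 1 - u $ 0 - cnj (u $ 0) else 0)" for i
      by (simp add: z_def algebra_simps)
    then have "(\<Sum>i<n. cnj (z i) * z i) = 1 + (1 - u $ 0 - cnj (u $ 0))"
      using n by (simp add: sum.distrib un)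
    then show ?thesis by (simp add: u0 r_def)
  qed
  define H where "H = mat n n (\<lambda>(i, j). (if i = j then 1 else 0) - z i * cnj (z j) / r)"
  have "H * H = 1\<^sub>m n"
  proof (rule eq_matI)
    fix i j assume ij: "i < dim_row (1\<^sub>m n :: complex mat)" "j < dim_col (1\<^sub>m n :: complex mat)"
    have "(H * H) $$ (i, j) = (\<Sum>k<n. ((if i = k then 1 else 0) - z i * cnj (z k) / r)
        * ((if k = j then 1 else 0) - z k * cnj (z j) / r))"
      using ij by (simp add: H_def scalar_prod_def atLeast0LessThan)
    also have "\<dots> = (\<Sum>k<n. (if k = i then (if i = j then 1 else 0) - z i * cnj (z j) / r else 0)
        - (if k = j then z i * cnj (z j) / r else 0)
        + z i * cnj (z j) / (complex_of_real r)\<^sup>2 * (cnj (z k) * z k))"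
      by (rule sum.cong) (auto simp: algebra_simps power2_eq_square)
    also have "\<dots> = (if i = j then 1 else 0) - z i * cnj (z j) / r - z i * cnj (z j) / r
        + z i * cnj (z j) / (complex_of_real r)\<^sup>2 * (\<Sum>k<n. cnj (z k) * z k)"
      using ij by (simp add: sum.distrib sum_subtractf sum_distrib_left)
    also have "\<dots> = (if i = j then 1 else 0)"
      unfolding zn using r by (simp add: power2_eq_square field_simps)
    finally show "(H * H) $$ (i, j) = 1\<^sub>m n $$ (i, j)" using ij by simp
  qed (simp_all add: H_def)
  moreover have "mat_adjoint H = H" by (rule eq_matI) (auto simp: H_def)
  moreover have "H *\<^sub>v unit_vec n 0 = c \<cdot>\<^sub>v v"
  proof (rule eq_vecI)
    fix i assume "i < dim_vec (c \<cdot>\<^sub>v v)"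
    then have i: "i < n" using v by simp
    have "(H *\<^sub>v unit_vec n 0) $ i = H $$ (i, 0)"
      using i n by (simp add: H_def)
    also have "\<dots> = u $ i" using i n r by (simp add: H_def z0) (auto simp: z_def u0 r_def)
    finally show "(H *\<^sub>v unit_vec n 0) $ i = (c \<cdot>\<^sub>v v) $ i" by (simp add: u_def)
  qed (use v in \<open>simp add: H_def\<close>)
  ultimately show ?thesis using that[of H c] c by (simp add: H_def)
qed

lemma mat_adjoint_four_block:
  assumes "A \<in> carrier_mat n1 m1" "B \<in> carrier_mat n1 m2" "C \<in> carrier_mat n2 m1" "D \<in> carrier_mat n2 m2"
  shows "mat_adjoint (four_block_mat A B C D)
    = four_block_mat (mat_adjoint A) (mat_adjoint C) (mat_adjoint B) (mat_adjoint (D :: complex mat))"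
  using assms by (intro eq_matI) (auto simp: not_less)

lemma hermitian_eigenvector:
  fixes A :: "complex mat"
  assumes "A \<in> carrier_mat n n" "n > 0"
  obtains v k where "v \<in> carrier_vec n" "v \<noteq> 0\<^sub>v n" "A *\<^sub>v v = k \<cdot>\<^sub>v v"
proof -
  have "degree (char_poly A) \<noteq> 0" using degree_monic_char_poly[OF assms(1)] assms(2) by simp
  then obtain k where "poly (char_poly A) k = 0"
    using Fundamental_Theorem_Algebra.fundamental_theorem_of_algebra[of "char_poly A"] by (auto simp: constant_degree)
  then show ?thesis
    using eigenvalue_root_char_poly[OF assms(1)] assms that
    by (auto simp: eigenvalue_def eigenvector_def)
qed

text \<open>Conjugation by a Householder reflection moves an eigenvector to the first basis vector.
  The first column is then a multiple of that vector, and by symmetry so is the first row, which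
  leaves a Hermitian block of size one less.\<close>

lemma hermitian_diagonalization:
  fixes A :: "complex mat"
  assumes "A \<in> carrier_mat n n" "mat_adjoint A = A"
  shows "\<exists>U d. U \<in> carrier_mat n n \<and> mat_adjoint U * U = 1\<^sub>m n \<and> U * mat_adjoint U = 1\<^sub>m n
    \<and> A = U * real_diag n d * mat_adjoint U"
  using assms
proof (induction n arbitrary: A)
  case 0
  then show ?case by (intro exI[of _ "1\<^sub>m 0"] exI[of _ "\<lambda>_. 0"]) (auto intro!: eq_matI)
next
  case (Suc n)
  let ?n = "Suc n"
  note A = Suc.prems
  obtain v k where v: "v \<in> carrier_vec ?n" "v \<noteq> 0\<^sub>v ?n" "A *\<^sub>v v = k \<cdot>\<^sub>v v"
    using hermitian_eigenvector[OF A(1)] by auto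
  obtain H c where H: "H \<in> carrier_mat ?n ?n" "mat_adjoint H = H" "H * H = 1\<^sub>m ?n"
    and c: "c \<noteq> 0" "H *\<^sub>v unit_vec ?n 0 = c \<cdot>\<^sub>v v"
    using householder[OF v(1,2)] by auto
  define M where "M = H * A * H"
  have M: "M \<in> carrier_mat ?n ?n" using A H by (simp add: M_def)
  have Mh: "mat_adjoint M = M"
    using A H by (simp add: M_def mat_adjoint_mult mat_mult_assoc)
  have "M *\<^sub>v unit_vec ?n 0 = H *\<^sub>v (A *\<^sub>v (c \<cdot>\<^sub>v v))"
    using A H by (simp add: M_def assoc_mult_mat_vec[of _ ?n ?n _ ?n] c(2)[symmetric])
  also have "\<dots> = k \<cdot>\<^sub>v (H *\<^sub>v (c \<cdot>\<^sub>v v))"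
    using A H v by (simp add: mult_mat_vec[of _ ?n ?n] smult_smult_assoc mult.commute)
  also have "H *\<^sub>v (c \<cdot>\<^sub>v v) = unit_vec ?n 0"
    using H by (simp add: c(2)[symmetric] assoc_mult_mat_vec[symmetric, of _ ?n ?n _ ?n])
  finally have "M *\<^sub>v unit_vec ?n 0 = k \<cdot>\<^sub>v unit_vec ?n 0" .
  moreover have "(M *\<^sub>v unit_vec ?n 0) $ i = M $$ (i, 0)" if "i < ?n" for i
    using M that by simp
  ultimately have col: "M $$ (i, 0) = (if i = 0 then k else 0)" if "i < ?n" for i
    using that by (metis index_smult_vec(1) index_unit_vec(1) index_unit_vec(3) mult_zero_right mult_1_right zero_less_Suc)
  have sym: "M $$ (i, j) = cnj (M $$ (j, i))" if "i < ?n" "j < ?n" for i j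
    using M that by (subst Mh[symmetric]) simp
  define A' where "A' = mat n n (\<lambda>(i, j). M $$ (Suc i, Suc j))"
  have A': "A' \<in> carrier_mat n n" by (simp add: A'_def)
  moreover have "mat_adjoint A' = A'"
    by (rule eq_matI) (auto simp: A'_def sym[symmetric])
  ultimately obtain U d where U: "U \<in> carrier_mat n n" "mat_adjoint U * U = 1\<^sub>m n" "U * mat_adjoint U = 1\<^sub>m n"
    and A'_eq: "A' = U * real_diag n d * mat_adjoint U"
    using Suc.IH by blast
  have "cnj k = k" using sym[of 0 0] col[of 0] by simp
  then have k: "complex_of_real (Re k) = k" by (simp add: Reals_cnj_iff)
  define B where "B X = four_block_mat (1\<^sub>m 1) (0\<^sub>m 1 n) (0\<^sub>m n 1) X" for X :: "complex mat"
  have B: "B X \<in> carrier_mat ?n ?n" if "X \<in> carrier_mat n n" for X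
    unfolding B_def using that four_block_carrier_mat[of "1\<^sub>m 1" 1 1 X n n] by simp
  have B_mult: "B X * B Y = B (X * Y)" if "X \<in> carrier_mat n n" "Y \<in> carrier_mat n n" for X Y
    unfolding B_def using that by (subst mult_four_block_mat[of _ 1 1 _ n _ n]) auto
  have B_adj: "mat_adjoint (B X) = B (mat_adjoint X)" if "X \<in> carrier_mat n n" for X
    unfolding B_def using that by (subst mat_adjoint_four_block[of _ 1 1 _ n _ n]) auto
  have B_1: "B (1\<^sub>m n) = 1\<^sub>m ?n" unfolding B_def by simp
  have BU: "B U \<in> carrier_mat ?n ?n" "B (mat_adjoint U) \<in> carrier_mat ?n ?n" using B U by auto
  define D where "D = real_diag ?n (case_nat (Re k) d)"
  define V where "V = H * B U"
  have V: "V \<in> carrier_mat ?n ?n" using H BU by (simp add: V_def)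
  have Va: "mat_adjoint V = B (mat_adjoint U) * H"
    using H BU U by (simp add: V_def mat_adjoint_mult B_adj)
  have HH: "H * (H * X) = X" if "dim_row X = ?n" for X
  proof -
    have "H * (H * X) = (H * H) * X" using H that by (intro mat_mult_assoc[symmetric]) auto
    then show ?thesis using that H by (simp add: left_mult_one_mat')
  qed
  have "mat_adjoint V * V = B (mat_adjoint U) * B U"
    unfolding Va unfolding V_def using H BU by (simp add: mat_mult_assoc HH)
  also have "\<dots> = 1\<^sub>m ?n" using U by (simp add: B_mult B_1)
  finally have 1: "mat_adjoint V * V = 1\<^sub>m ?n" .
  have 2: "V * mat_adjoint V = 1\<^sub>m ?n"
    using mat_mult_left_right_inverse[of "mat_adjoint V" ?n V] V 1 by simp
  have M_block: "M = B U * D * B (mat_adjoint U)"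
  proof -
    have "D = four_block_mat (real_diag 1 (\<lambda>_. Re k)) (0\<^sub>m 1 n) (0\<^sub>m n 1) (real_diag n d)"
      by (rule eq_matI) (auto simp: D_def split: nat.split)
    then have "B U * D * B (mat_adjoint U)
      = four_block_mat (real_diag 1 (\<lambda>_. Re k)) (0\<^sub>m 1 n) (0\<^sub>m n 1) A'"
      unfolding B_def A'_eq using U
      by (simp add: mult_four_block_mat[of _ 1 1 _ n _ n _ _ 1 _ n])
    also have "\<dots> = M"
      using M col sym[of 0] k \<open>cnj k = k\<close> by (intro eq_matI) (auto simp: A'_def less_Suc_eq_0_disj)
    finally show ?thesis by simp
  qed
  have "A = H * M * H"
    unfolding M_def using A H by (simp add: mat_mult_assoc HH)
  also have "\<dots> = V * D * mat_adjoint V"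
    unfolding M_block Va unfolding V_def using H BU by (simp add: mat_mult_assoc D_def)
  finally show ?case using V 1 2 unfolding D_def by blast
qed

lemma diagonalized_mult:
  assumes "U \<in> carrier_mat n n" "mat_adjoint U * U = 1\<^sub>m n"
  shows "(U * real_diag n d * mat_adjoint U) * (U * real_diag n e * mat_adjoint U)
    = U * real_diag n (\<lambda>i. d i * e i) * mat_adjoint U"
proof -
  have "(U * real_diag n d * mat_adjoint U) * (U * real_diag n e * mat_adjoint U)
    = U * real_diag n d * (mat_adjoint U * U) * real_diag n e * mat_adjoint U"
    using assms(1) by (simp add: mat_mult_assoc)
  also have "\<dots> = U * (real_diag n d * real_diag n e) * mat_adjoint U"
    using assms by (simp add: mat_mult_assoc)
  finally show ?thesis by (simp add: real_diag_mult)
qed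

lemma diagonalized_hermitian:
  assumes "U \<in> carrier_mat n n"
  shows "mat_adjoint (U * real_diag n d * mat_adjoint U) = U * real_diag n d * mat_adjoint U"
  using assms by (simp add: mat_adjoint_mult mat_mult_assoc)

lemma diagonalized_entries:
  assumes "U \<in> carrier_mat n n" "mat_adjoint U * U = 1\<^sub>m n" "A = U * real_diag n d * mat_adjoint U"
  shows "mat_adjoint U * A * U = real_diag n d"
proof -
  have "mat_adjoint U * A * U = (mat_adjoint U * U) * real_diag n d * (mat_adjoint U * U)"
    using assms(1) by (simp add: assms(3) mat_mult_assoc)
  then show ?thesis by (simp add: assms(2))
qed

section \<open>Square roots and Moore-Penrose inverses\<close>

lemma psd_sqrt_exists:
  assumes "psd A" "A \<in> carrier_mat n n"
  shows "\<exists>B. psd B \<and> B \<in> carrier_mat n n \<and> B * B = A"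
proof -
  obtain U d where U: "U \<in> carrier_mat n n" "mat_adjoint U * U = 1\<^sub>m n"
    and A: "A = U * real_diag n d * mat_adjoint U"
    using hermitian_diagonalization[OF assms(2) psd_adjoint[OF assms(1)]] by blast
  have d: "0 \<le> d i" if "i < n" for i
    using psd_diag(2)[OF psd_conj[OF assms U(1)], of n i] U(1) that
    by (simp add: diagonalized_entries[OF U A])
  let ?f = "\<lambda>g. U * real_diag n g * mat_adjoint U"
  have "?f (\<lambda>i. sqrt (d i)) * ?f (\<lambda>i. sqrt (d i)) = A"
    unfolding diagonalized_mult[OF U] A using d
    by (intro arg_cong[of _ _ "\<lambda>x. U * x * mat_adjoint U"] eq_matI) auto
  \<comment> \<open>The fourth roots exhibit the candidate as the square of a Hermitian
    matrix.\<close>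
  moreover have "psd (?f (\<lambda>i. sqrt (d i)))"
  proof -
    have "?f (\<lambda>i. sqrt (d i)) = ?f (\<lambda>i. sqrt (sqrt (d i))) * ?f (\<lambda>i. sqrt (sqrt (d i)))"
      unfolding diagonalized_mult[OF U] using d
      by (intro arg_cong[of _ _ "\<lambda>x. U * x * mat_adjoint U"] eq_matI) auto
    then show ?thesis
      using psd_adjoint_mult_self[of "?f (\<lambda>i. sqrt (sqrt (d i)))" n n] U(1)
      by (simp add: diagonalized_hermitian)
  qed
  ultimately show ?thesis using U by (intro exI[of _ "?f (\<lambda>i. sqrt (d i))"]) auto
qed

text \<open>In an eigenbasis of \<open>B - C\<close>, equality of the squares gives
  \<open>d i\<close> times the sum of the diagonal entries of \<open>B\<close> and \<open>C\<close>
  equal to zero. Both entries are nonnegative with difference \<open>d i\<close>, so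
  \<open>d i\<close> vanishes.\<close>

lemma psd_sqrt_unique:
  assumes B: "psd B" "B \<in> carrier_mat n n" and C: "psd C" "C \<in> carrier_mat n n" and eq: "B * B = C * C"
  shows "B = C"
proof -
  define D where "D = B - C"
  have D: "D \<in> carrier_mat n n" "mat_adjoint D = D"
    using B C by (auto simp: D_def mat_adjoint_minus[of _ n n] psd_adjoint)
  obtain U d where U: "U \<in> carrier_mat n n" "mat_adjoint U * U = 1\<^sub>m n" "U * mat_adjoint U = 1\<^sub>m n"
    and D_eq: "D = U * real_diag n d * mat_adjoint U"
    using hermitian_diagonalization[OF D] by blast
  define B' where "B' = mat_adjoint U * B * U"
  define C' where "C' = mat_adjoint U * C * U"
  have car: "B' \<in> carrier_mat n n" "C' \<in> carrier_mat n n" using B C U by (auto simp: B'_def C'_def)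
  have diff: "B' - C' = real_diag n d"
    unfolding diagonalized_entries[OF U(1,2) D_eq, symmetric] B'_def C'_def D_def using B C U
    by (simp add: mult_minus_distrib_mat[of _ n n] minus_mult_distrib_mat[of _ n n _ _ n])
  have "B' * real_diag n d + real_diag n d * C' = B' * B' - C' * C'"
    unfolding diff[symmetric] using car
    by (simp add: mult_minus_distrib_mat[of _ n n] minus_mult_distrib_mat[of _ n n _ _ n])
      (auto intro!: eq_matI)
  also have "B' * B' = mat_adjoint U * (B * (U * mat_adjoint U) * B) * U"
    using B U(1) by (simp add: B'_def mat_mult_assoc)
  also have "\<dots> = mat_adjoint U * (C * (U * mat_adjoint U) * C) * U"
    using B C eq by (simp add: U(3))
  also have "\<dots> = C' * C'"
    using C U(1) by (simp add: C'_def mat_mult_assoc)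
  finally have z: "B' * real_diag n d + real_diag n d * C' = 0\<^sub>m n n" using car by simp
  have "d i = 0" if i: "i < n" for i
  proof -
    have "(B' * real_diag n d + real_diag n d * C') $$ (i, i) = 0" using i by (simp add: z)
    then have e: "d i * (B' $$ (i, i) + C' $$ (i, i)) = 0"
      using i car by (simp add: scalar_prod_def if_distrib[of "\<lambda>x. x * _"] if_distrib[of "\<lambda>x. _ * x"]
          sum.delta algebra_simps cong: if_cong)
    have p: "psd B'" "psd C'" unfolding B'_def C'_def using psd_conj[OF B U(1)] psd_conj[OF C U(1)] by auto
    have "(B' - C') $$ (i, i) = d i" using i by (simp add: diff)
    then have "Re (B' $$ (i, i)) - Re (C' $$ (i, i)) = d i"
      using i car by (metis Re_complex_of_real carrier_matD index_minus_mat(1) minus_complex.sel(1))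
    moreover have "d i = 0 \<or> Re (B' $$ (i, i)) + Re (C' $$ (i, i)) = 0"
      using e by (metis mult_eq_0_iff of_real_eq_0_iff plus_complex.sel(1) zero_complex.sel(1))
    ultimately show ?thesis
      using psd_diag(2)[OF p(1) car(1) i] psd_diag(2)[OF p(2) car(2) i] by auto
  qed
  then have "real_diag n d = 0\<^sub>m n n" by (intro eq_matI) auto
  then have "D = 0\<^sub>m n n" using U by (simp add: D_eq)
  then have "(B - C) $$ (i, j) = 0" if "i < n" "j < n" for i j
    using that by (simp add: D_def)
  then show ?thesis using B C by (intro eq_matI) auto
qed

lemma msqrt:
  assumes "psd A" "A \<in> carrier_mat n n"
  shows "psd (msqrt A)" "msqrt A \<in> carrier_mat n n" "msqrt A * msqrt A = A"
proof -
  obtain B where B: "psd B" "B \<in> carrier_mat n n" "B * B = A"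
    using psd_sqrt_exists[OF assms] by blast
  have "msqrt A = B" unfolding msqrt_def
    using assms(2) B psd_sqrt_unique by (intro the_equality) auto
  then show "psd (msqrt A)" "msqrt A \<in> carrier_mat n n" "msqrt A * msqrt A = A" using B by auto
qed

definition moore_penrose :: "complex mat \<Rightarrow> complex mat \<Rightarrow> bool" where
  "moore_penrose A X \<longleftrightarrow> X \<in> carrier_mat (dim_col A) (dim_row A) \<and>
      A * X * A = A \<and> X * A * X = X \<and> mat_adjoint (A * X) = A * X \<and> mat_adjoint (X * A) = X * A"

lemma moore_penrose_unique:
  assumes "A \<in> carrier_mat n n" "moore_penrose A X" "moore_penrose A Y"
  shows "X = Y"
proof -
  have X: "X \<in> carrier_mat n n" "A * X * A = A" "X * A * X = X" "mat_adjoint (A * X) = A * X" "mat_adjoint (X * A) = X * A"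
    and Y: "Y \<in> carrier_mat n n" "A * Y * A = A" "Y * A * Y = Y" "mat_adjoint (A * Y) = A * Y" "mat_adjoint (Y * A) = Y * A"
    using assms by (auto simp: moore_penrose_def)
  have d: "dim_row A = n" "dim_col A = n" "dim_row X = n" "dim_col X = n" "dim_row Y = n" "dim_col Y = n"
    using assms(1) X(1) Y(1) by auto
  have "A * X = A * Y * A * X" by (simp only: Y(2))
  also have "\<dots> = mat_adjoint (A * Y) * mat_adjoint (A * X)"
    unfolding X(4) Y(4) by (rule mat_mult_assoc) (simp_all add: d)
  also have "\<dots> = mat_adjoint (A * X * (A * Y))"
    by (rule mat_adjoint_mult[symmetric]) (simp add: d)
  also have "A * X * (A * Y) = A * X * A * Y"
    by (rule mat_mult_assoc[symmetric]) (simp_all add: d)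
  finally have 1: "A * X = A * Y" by (simp only: X(2) Y(4))
  have "X * A = X * (A * Y * A)" by (simp only: Y(2))
  also have "A * Y * A = A * (Y * A)" by (rule mat_mult_assoc) (simp_all add: d)
  also have "X * \<dots> = X * A * (Y * A)" by (rule mat_mult_assoc[symmetric]) (simp_all add: d)
  also have "\<dots> = mat_adjoint (X * A) * mat_adjoint (Y * A)" by (simp only: X(5) Y(5))
  also have "\<dots> = mat_adjoint (Y * A * (X * A))"
    by (rule mat_adjoint_mult[symmetric]) (simp add: d)
  also have "Y * A * (X * A) = Y * (A * (X * A))" by (rule mat_mult_assoc) (simp_all add: d)
  also have "A * (X * A) = A * X * A" by (rule mat_mult_assoc[symmetric]) (simp_all add: d)
  finally have 2: "X * A = Y * A" by (simp only: X(2) Y(5))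
  have "X = Y * A * X" using X(3) by (simp only: 2)
  also have "\<dots> = Y * (A * X)" by (rule mat_mult_assoc) (simp_all add: d)
  also have "\<dots> = Y * A * Y" unfolding 1 by (rule mat_mult_assoc[symmetric]) (simp_all add: d)
  finally show ?thesis by (simp only: Y(3))
qed

lemma mp_inv_hermitian:
  assumes A: "A \<in> carrier_mat n n" "mat_adjoint A = A"
  shows "mp_inv A \<in> carrier_mat n n" "A * mp_inv A * A = A" "mp_inv A * A * mp_inv A = mp_inv A"
    "mat_adjoint (A * mp_inv A) = A * mp_inv A" "mp_inv A * A = A * mp_inv A"
proof -
  obtain U d where U: "U \<in> carrier_mat n n" "mat_adjoint U * U = 1\<^sub>m n"
    and A_eq: "A = U * real_diag n d * mat_adjoint U"
    using hermitian_diagonalization[OF A] by blast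
  let ?f = "\<lambda>g. U * real_diag n g * mat_adjoint U"
  \<comment> \<open>Since \<open>inverse 0 = 0\<close>, zero eigenvalues are treated as the
    Moore-Penrose conditions demand.\<close>
  define X where "X = ?f (\<lambda>i. inverse (d i))"
  have X: "X \<in> carrier_mat n n" using U by (simp add: X_def)
  have e: "d i * inverse (d i) * d i = d i" "inverse (d i) * d i * inverse (d i) = inverse (d i)" for i
    by (cases "d i = 0"; simp)+
  have mp: "moore_penrose A X"
    unfolding moore_penrose_def using A X unfolding A_eq X_def diagonalized_mult[OF U]
    by (auto simp: diagonalized_hermitian U e)
  have "mp_inv A = X" unfolding mp_inv_def moore_penrose_def[symmetric]
    using mp moore_penrose_unique[OF A(1)] by (intro the_equality) auto
  moreover have "X * A = A * X"
    unfolding A_eq X_def diagonalized_mult[OF U] by (simp add: mult.commute)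
  ultimately show "mp_inv A \<in> carrier_mat n n" "A * mp_inv A * A = A" "mp_inv A * A * mp_inv A = mp_inv A"
    "mat_adjoint (A * mp_inv A) = A * mp_inv A" "mp_inv A * A = A * mp_inv A"
    using mp X by (auto simp: moore_penrose_def)
qed

lemma minv:
  assumes A: "A \<in> carrier_mat n n" and "det A \<noteq> 0"
  shows "minv A \<in> carrier_mat n n" "A * minv A = 1\<^sub>m n" "minv A * A = 1\<^sub>m n" "invertible_mat A"
proof -
  define B where "B = inverse (det A) \<cdot>\<^sub>m adj_mat A"
  have "inverse (det A) \<cdot>\<^sub>m (det A \<cdot>\<^sub>m 1\<^sub>m n) = 1\<^sub>m n"
    using assms(2) by (intro eq_matI) auto
  then have B: "B \<in> carrier_mat n n" "A * B = 1\<^sub>m n" "B * A = 1\<^sub>m n"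
    using adj_mat[OF A] A
    by (auto simp: B_def mult_smult_distrib[of _ n n _ n] mult_smult_assoc_mat[of _ n n _ n])
  have uniq: "X = B" if "X \<in> carrier_mat n n" "X * A = 1\<^sub>m n" for X
  proof -
    have "X = X * (A * B)" using that B by simp
    also have "\<dots> = B" using that B(1) A by (simp add: mat_mult_assoc[symmetric])
    finally show ?thesis .
  qed
  have "dim_row A = n" using A by simp
  then have "minv A = B" unfolding minv_def
    by (intro the_equality) (simp_all only: B uniq simp_thms)
  then show "minv A \<in> carrier_mat n n" "A * minv A = 1\<^sub>m n" "minv A * A = 1\<^sub>m n" using B by auto
  show "invertible_mat A" unfolding invertible_mat_def inverts_mat_def
    using A B by auto
qed

section \<open>The ring of matrix families\<close>

text \<open>Square matrices of a size that is not fixed by a type do not form a type-class ring. The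
  families with one matrix for each size do, and each size is recovered by a ring homomorphism.\<close>

typedef matfam = "{x :: nat \<Rightarrow> complex mat. \<forall>k. x k \<in> carrier_mat k k}"
  morphisms comp matfam
  by (rule exI[of _ "\<lambda>k. 1\<^sub>m k"]) simp

lemma comp_carrier [simp]: "comp x k \<in> carrier_mat k k"
  using comp[of x] by simp

lemma comp_dim [simp]: "dim_row (comp x k) = k" "dim_col (comp x k) = k"
  using comp_carrier[of x k] by (simp_all del: comp_carrier)

lemma comp_matfam: "(\<And>k. x k \<in> carrier_mat k k) \<Longrightarrow> comp (matfam x) = x"
  by (simp add: matfam_inverse)

lemma matfam_eqI: "(\<And>k. comp x k = comp y k) \<Longrightarrow> x = y"
  by (metis comp_inject ext)

instantiation matfam :: ring_1
begin

definition "0 = matfam (\<lambda>k. 0\<^sub>m k k)"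
definition "1 = matfam (\<lambda>k. 1\<^sub>m k)"
definition "x + y = matfam (\<lambda>k. comp x k + comp y k)"
definition "x - y = matfam (\<lambda>k. comp x k - comp y k)"
definition "- x = matfam (\<lambda>k. - comp x k)"
definition "x * y = matfam (\<lambda>k. comp x k * comp y k)"

lemma comp_ring [simp]:
  "comp 0 k = 0\<^sub>m k k" "comp 1 k = 1\<^sub>m k" "comp (x + y) k = comp x k + comp y k"
  "comp (x - y) k = comp x k - comp y k" "comp (- x) k = - comp x k" "comp (x * y) k = comp x k * comp y k"
  by (simp_all add: zero_matfam_def one_matfam_def plus_matfam_def minus_matfam_def
      uminus_matfam_def times_matfam_def comp_matfam minus_carrier_mat)

instance
proof
  fix x y z :: matfam
  show "x + y + z = x + (y + z)" by (rule matfam_eqI) (simp add: assoc_add_mat[OF comp_carrier comp_carrier comp_carrier])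
  show "x + y = y + x" by (rule matfam_eqI) (simp add: comm_add_mat[OF comp_carrier comp_carrier])
  show "0 + x = x" by (rule matfam_eqI) simp
  show "- x + x = 0" by (rule matfam_eqI) simp
  show "x - y = x + - y" by (rule matfam_eqI) (simp add: minus_add_uminus_mat[OF comp_carrier comp_carrier])
  show "x * y * z = x * (y * z)" by (rule matfam_eqI) (simp add: mat_mult_assoc)
  show "(x + y) * z = x * z + y * z"
    by (rule matfam_eqI) (simp add: add_mult_distrib_mat[OF comp_carrier comp_carrier comp_carrier])
  show "x * (y + z) = x * y + x * z"
    by (rule matfam_eqI) (simp add: mult_add_distrib_mat[OF comp_carrier comp_carrier comp_carrier])
  show "1 * x = x" by (rule matfam_eqI) simp
  show "x * 1 = x" by (rule matfam_eqI) simp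
  \<comment> \<open>In size 0 the zero and the unit matrix coincide, so size 1 must separate
    them.\<close>
  have "comp (0::matfam) (Suc 0) $$ (0, 0) \<noteq> comp (1::matfam) (Suc 0) $$ (0, 0)" by simp
  then show "(0::matfam) \<noteq> 1" by metis
qed

end

lemma comp_sum_index:
  "i < k \<Longrightarrow> j < k \<Longrightarrow> comp (sum g I) k $$ (i, j) = (\<Sum>x\<in>I. comp (g x) k $$ (i, j))"
  by (induction I rule: infinite_finite_induct) auto

definition mstar :: "matfam \<Rightarrow> matfam" where
  "mstar x = matfam (\<lambda>k. mat_adjoint (comp x k))"

definition mpos :: "matfam \<Rightarrow> bool" where
  "mpos x \<longleftrightarrow> (\<forall>k. psd (comp x k))"

lemma comp_mstar [simp]: "comp (mstar x) k = mat_adjoint (comp x k)"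
  by (simp add: mstar_def comp_matfam)

lemma mat_zero_if_square_nonpositive:
  assumes A: "A \<in> carrier_mat n n" and "psd (- (mat_adjoint A * A))"
  shows "A = 0\<^sub>m n n"
proof (rule eq_matI)
  fix i j assume ij: "i < dim_row (0\<^sub>m n n :: complex mat)" "j < dim_col (0\<^sub>m n n :: complex mat)"
  have "(mat_adjoint A * A) $$ (j, j) = (\<Sum>i<n. cnj (A $$ (i, j)) * A $$ (i, j))"
    using A ij by (simp add: scalar_prod_def atLeast0LessThan)
  also have "\<dots> = complex_of_real (\<Sum>i<n. (cmod (A $$ (i, j)))\<^sup>2)"
    by (simp add: mult.commute[of "cnj (A $$ _)"] complex_norm_square[symmetric] del: of_real_power)
  finally have "Re ((- (mat_adjoint A * A)) $$ (j, j)) = - (\<Sum>i<n. (cmod (A $$ (i, j)))\<^sup>2)"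
    using A ij by simp
  then have "(\<Sum>i<n. (cmod (A $$ (i, j)))\<^sup>2) \<le> 0"
    using psd_diag(2)[OF assms(2), of n j] A ij by simp
  then have "(\<Sum>i<n. (cmod (A $$ (i, j)))\<^sup>2) = 0"
    by (intro antisym sum_nonneg) auto
  then show "A $$ (i, j) = 0\<^sub>m n n $$ (i, j)" using ij by (simp add: sum_nonneg_eq_0_iff)
qed (use A in auto)

text \<open>The ring axiom only tests square matrices, not vectors. Repeating a kernel vector in all
  columns gives a square \<open>X\<close> with \<open>T * X\<close> zero.\<close>

lemma mat_inverse_if_injective:
  fixes T :: "complex mat"
  assumes T: "T \<in> carrier_mat n n"
    and inj: "\<And>X. X \<in> carrier_mat n n \<Longrightarrow> T * X = 0\<^sub>m n n \<Longrightarrow> X = 0\<^sub>m n n"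
  shows "\<exists>S. S \<in> carrier_mat n n \<and> S * T = 1\<^sub>m n \<and> T * S = 1\<^sub>m n"
proof -
  have "det T \<noteq> 0"
  proof
    assume "det T = 0"
    then obtain v where v: "v \<in> carrier_vec n" "v \<noteq> 0\<^sub>v n" "T *\<^sub>v v = 0\<^sub>v n"
      using det_0_iff_vec_prod_zero_field[OF T] by blast
    define X where "X = mat_of_cols n (replicate n v)"
    have X: "X \<in> carrier_mat n n" using mat_of_cols_carrier(1)[of n "replicate n v"] by (simp add: X_def)
    have colX: "j < n \<Longrightarrow> col X j = v" for j using v by (simp add: X_def)
    have "(T * X) $$ (i, j) = (T *\<^sub>v v) $ i" if "i < n" "j < n" for i j
      using that T X by (simp add: colX)
    then have "T * X = 0\<^sub>m n n" using T X v(3) by (intro eq_matI) auto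
    then have X0: "X = 0\<^sub>m n n" using inj X by blast
    obtain i where i: "i < n" "v $ i \<noteq> 0"
      using v by (metis carrier_vecD eq_vecI index_zero_vec)
    then have "v = 0\<^sub>v n" using colX[of i] X0 by (auto intro!: eq_vecI)
    then show False using v by simp
  qed
  then show ?thesis using minv[OF T] by blast
qed

interpretation matfam: star_ring mstar mpos
proof
  fix x y t :: matfam
  show "mstar (x + y) = mstar x + mstar y"
    by (rule matfam_eqI) (simp add: mat_adjoint_add[OF comp_carrier comp_carrier])
  show "mstar (x * y) = mstar y * mstar x"
    by (rule matfam_eqI) (simp add: mat_adjoint_mult)
  show "mstar (mstar x) = x" by (rule matfam_eqI) simp
  show "mpos x \<Longrightarrow> mpos y \<Longrightarrow> mpos (x + y)"
    by (auto simp: mpos_def intro: psd_add[OF _ _ comp_carrier comp_carrier])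
  show "mpos (mstar x * x)"
    using psd_adjoint_mult_self[OF comp_carrier] by (simp add: mpos_def)
  show "mpos (- (mstar x * x)) \<Longrightarrow> x = 0"
    by (rule matfam_eqI) (simp add: mpos_def mat_zero_if_square_nonpositive)
  assume inj: "\<And>a. t * a = 0 \<Longrightarrow> a = 0"
  have "\<exists>S. S \<in> carrier_mat k k \<and> S * comp t k = 1\<^sub>m k \<and> comp t k * S = 1\<^sub>m k" for k
  proof (rule mat_inverse_if_injective)
    fix X assume X: "X \<in> carrier_mat k k" "comp t k * X = 0\<^sub>m k k"
    \<comment> \<open>A family concentrated in one size transfers injectivity of \<open>t\<close> in
      the ring to injectivity of its component \<open>k\<close>.\<close>
    define a where "a = matfam (\<lambda>l. if l = k then X else 0\<^sub>m l l)"
    have a: "comp a l = (if l = k then X else 0\<^sub>m l l)" for l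
      using X by (simp add: a_def comp_matfam)
    have "t * a = 0" by (rule matfam_eqI) (auto simp: a X)
    then show "X = 0\<^sub>m k k" using inj[of a] a[of k] by simp
  qed simp
  then obtain S where S: "S k \<in> carrier_mat k k" "S k * comp t k = 1\<^sub>m k" "comp t k * S k = 1\<^sub>m k" for k
    by metis
  then have "matfam S * t = 1" "t * matfam S = 1"
    by (auto intro!: matfam_eqI simp: comp_matfam)
  then show "\<exists>s. s * t = 1 \<and> t * s = 1" by blast
qed

text \<open>The flag fixes the components of other sizes. Unit padding suits elements that must
  remain square roots, inverses or projections there; zero padding suits Taylor coefficients and
  blocks. The abstract hypotheses then hold trivially in the sizes other than
  \<open>m\<close>.\<close>

definition emb :: "nat \<Rightarrow> bool \<Rightarrow> complex mat \<Rightarrow> matfam" where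
  "emb m b A = matfam (\<lambda>k. if k = m then A else if b then 1\<^sub>m k else 0\<^sub>m k k)"

lemma comp_emb: "A \<in> carrier_mat m m \<Longrightarrow>
    comp (emb m b A) k = (if k = m then A else if b then 1\<^sub>m k else 0\<^sub>m k k)"
  unfolding emb_def by (subst comp_matfam) auto

section \<open>Power series expansions and contractivity\<close>

lemma holomorphic_imp_has_fps_expansion:
  assumes "f holomorphic_on ball 0 r" "r > 0"
  shows "f has_fps_expansion fps_expansion f 0"
  using assms by (intro has_fps_expansion_fps_expansion[of "ball 0 r"]) auto

text \<open>On the circle of radius \<open>r\<close> the conjugate of \<open>w ^ k\<close> is
  \<open>r ^ (2 * k)\<close> divided by \<open>w ^ k\<close>, so Cauchy's coefficient formula
  becomes an inner product with a monomial.\<close>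

lemma fps_coeff_integral:
  fixes r :: real
  assumes F: "F holomorphic_on ball 0 1" and r: "0 < r" "r < 1"
  shows "((\<lambda>t. F (r * cis t) * cnj (r * cis t) ^ k) has_integral
    2 * complex_of_real pi * fps_nth (fps_expansion F 0) k * r ^ (2 * k)) {0..2 * pi}"
proof -
  have "((\<lambda>u. F u / (u - 0) ^ Suc k) has_contour_integral (2 * complex_of_real pi * \<i>) / fact k * (deriv ^^ k) F 0)
      (circlepath 0 r)"
  proof -
    have "continuous_on (cball 0 r) F" "F holomorphic_on ball 0 r"
      using r by (auto intro!: holomorphic_on_imp_continuous_on holomorphic_on_subset[OF F])
    from Cauchy_has_contour_integral_higher_derivative_circlepath[OF this, of 0 k] r
    show ?thesis by simp
  qed
  then have "((\<lambda>t. F (r * cis t) / (r * cis t) ^ Suc k * r * \<i> * cis t) has_integral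
      (2 * complex_of_real pi * \<i>) / fact k * (deriv ^^ k) F 0) {0..2 * pi}"
    unfolding circlepath_def by (subst (asm) has_contour_integral_part_circlepath_iff) auto
  from has_integral_mult_right[OF this, of "complex_of_real (r ^ (2 * k)) / \<i>"]
  have I: "((\<lambda>t. complex_of_real (r ^ (2 * k)) / \<i> * (F (r * cis t) / (r * cis t) ^ Suc k * r * \<i> * cis t)) has_integral
      complex_of_real (r ^ (2 * k)) / \<i> * ((2 * complex_of_real pi * \<i>) / fact k * (deriv ^^ k) F 0)) {0..2 * pi}" .
  have 1: "complex_of_real (r ^ (2 * k)) / \<i> * (F (r * cis t) / (r * cis t) ^ Suc k * r * \<i> * cis t)
      = F (r * cis t) * cnj (r * cis t) ^ k" for t
  proof -
    have "(r * cis t) * cnj (r * cis t) = complex_of_real (r\<^sup>2)"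
      using complex_norm_square[of "r * cis t"] r by (simp add: norm_mult)
    then have "(r * cis t) ^ k * cnj (r * cis t) ^ k = complex_of_real (r ^ (2 * k))"
      by (metis of_real_power power_mult power_mult_distrib)
    moreover have "(r * cis t) ^ k \<noteq> 0" using r by simp
    ultimately show ?thesis using r by (simp add: field_simps)
  qed
  have 2: "complex_of_real (r ^ (2 * k)) / \<i> * ((2 * complex_of_real pi * \<i>) / fact k * (deriv ^^ k) F 0)
      = 2 * complex_of_real pi * fps_nth (fps_expansion F 0) k * r ^ (2 * k)"
    by (simp add: fps_nth_fps_expansion[OF holomorphic_imp_has_fps_expansion[OF F]] field_simps)
  show ?thesis using I unfolding 1 2 .
qed

lemma polynomial_inner_integral:
  fixes r :: real
  assumes F: "F holomorphic_on ball 0 1" and r: "0 < r" "r < 1"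
  shows "((\<lambda>t. F (r * cis t) * cnj (\<Sum>k\<le>N. c k * (r * cis t) ^ k)) has_integral
    2 * complex_of_real pi * (\<Sum>k\<le>N. fps_nth (fps_expansion F 0) k * cnj (c k) * r ^ (2 * k))) {0..2 * pi}"
proof -
  have "((\<lambda>t. \<Sum>k\<le>N. cnj (c k) * (F (r * cis t) * cnj (r * cis t) ^ k)) has_integral
      (\<Sum>k\<le>N. cnj (c k) * (2 * complex_of_real pi * fps_nth (fps_expansion F 0) k * r ^ (2 * k)))) {0..2 * pi}"
    by (intro has_integral_sum has_integral_mult_right fps_coeff_integral assms) auto
  moreover have "(\<lambda>t. \<Sum>k\<le>N. cnj (c k) * (F (r * cis t) * cnj (r * cis t) ^ k))
      = (\<lambda>t. F (r * cis t) * cnj (\<Sum>k\<le>N. c k * (r * cis t) ^ k))"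
    by (simp add: sum_distrib_left mult_ac)
  moreover have "(\<Sum>k\<le>N. cnj (c k) * (2 * complex_of_real pi * fps_nth (fps_expansion F 0) k * r ^ (2 * k)))
      = 2 * complex_of_real pi * (\<Sum>k\<le>N. fps_nth (fps_expansion F 0) k * cnj (c k) * r ^ (2 * k))"
    by (simp add: sum_distrib_left mult_ac)
  ultimately show ?thesis by (simp only:)
qed

lemma fps_expansion_polynomial:
  fixes c :: "nat \<Rightarrow> complex"
  shows "(\<lambda>w. \<Sum>k\<le>N. c k * w ^ k) has_fps_expansion Abs_fps (\<lambda>k. if k \<le> N then c k else 0)"
proof -
  have "(\<lambda>w. \<Sum>k\<le>N. c k * w ^ k) has_fps_expansion (\<Sum>k\<le>N. fps_const (c k) * fps_X ^ k)"
    by (intro fps_expansion_intros)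
  moreover have "(\<Sum>k\<le>N. fps_const (c k) * fps_X ^ k) = Abs_fps (\<lambda>k. if k \<le> N then c k else 0)"
    by (rule fps_ext) (simp add: fps_sum_nth if_distrib[of "\<lambda>x. _ * x"] cong: if_cong)
  ultimately show ?thesis by simp
qed

lemma polynomial_norm_integral:
  fixes r :: real
  assumes r: "0 < r" "r < 1"
  shows "((\<lambda>t. (cmod (\<Sum>k\<le>N. c k * (r * cis t) ^ k))\<^sup>2) has_integral
    2 * pi * (\<Sum>k\<le>N. (cmod (c k))\<^sup>2 * r ^ (2 * k))) {0..2 * pi}"
proof -
  let ?p = "\<lambda>w. \<Sum>k\<le>N. c k * w ^ k"
  have hol: "?p holomorphic_on ball 0 1" by (intro holomorphic_intros)
  have coeff: "fps_nth (fps_expansion ?p 0) k = (if k \<le> N then c k else 0)" for k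
    using fps_nth_fps_expansion[OF fps_expansion_polynomial[where N = N and c = c]]
      fps_nth_fps_expansion[OF holomorphic_imp_has_fps_expansion[OF hol]] by simp
  from has_integral_Re[OF polynomial_inner_integral[OF hol r, where N = N and c = c]]
  have "((\<lambda>t. Re (?p (r * cis t) * cnj (?p (r * cis t)))) has_integral
      Re (2 * complex_of_real pi * (\<Sum>k\<le>N. c k * cnj (c k) * r ^ (2 * k)))) {0..2 * pi}"
    by (simp add: coeff)
  moreover have "Re (z * cnj z) = (cmod z)\<^sup>2" for z
    by (metis Re_complex_of_real complex_norm_square)
  moreover have "Re (2 * complex_of_real pi * (\<Sum>k\<le>N. c k * cnj (c k) * r ^ (2 * k)))
      = 2 * pi * (\<Sum>k\<le>N. (cmod (c k))\<^sup>2 * r ^ (2 * k))"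
    by (simp add: complex_norm_square[symmetric] Re_sum del: of_real_power)
  ultimately show ?thesis by (simp only:)
qed

text \<open>Expanding the squared modulus of \<open>F i - s i\<close>, with \<open>s i\<close> the
  Taylor polynomial, bounds \<open>2 * Re (F i * cnj (s i))\<close> minus the square of
  \<open>cmod (s i)\<close> by the square of \<open>cmod (F i)\<close>. The left side integrates to
  the first \<open>N + 1\<close> coefficients by orthogonality, so no infinite Parseval sum is
  needed.\<close>

lemma bessel_circle:
  fixes F :: "nat \<Rightarrow> complex \<Rightarrow> complex" and c :: "nat \<Rightarrow> nat \<Rightarrow> complex" and r :: real
  assumes F: "\<And>i. i < m \<Longrightarrow> F i holomorphic_on ball 0 1" and r: "0 < r" "r < 1"
    and le: "\<And>w. w \<in> ball 0 1 \<Longrightarrow>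
      (\<Sum>i<m. (cmod (F i w))\<^sup>2) \<le> (\<Sum>i<m. (cmod (\<Sum>k\<le>N. c i k * w ^ k))\<^sup>2)"
  shows "(\<Sum>i<m. \<Sum>k\<le>N. (cmod (fps_nth (fps_expansion (F i) 0) k))\<^sup>2 * r ^ (2 * k))
    \<le> (\<Sum>i<m. \<Sum>k\<le>N. (cmod (c i k))\<^sup>2 * r ^ (2 * k))"
proof -
  define a where "a i k = fps_nth (fps_expansion (F i) 0) k" for i k
  define s where "s i w = (\<Sum>k\<le>N. a i k * w ^ k)" for i w
  define I where "I b = (\<Sum>k\<le>N. (cmod (b k))\<^sup>2 * r ^ (2 * k))" for b :: "nat \<Rightarrow> complex"
  have 1: "((\<lambda>t. Re (F i (r * cis t) * cnj (s i (r * cis t)))) has_integral 2 * pi * I (a i)) {0..2 * pi}"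
    if "i < m" for i
  proof -
    have "Re (2 * complex_of_real pi * (\<Sum>k\<le>N. a i k * cnj (a i k) * r ^ (2 * k))) = 2 * pi * I (a i)"
      by (simp add: I_def complex_norm_square[symmetric] Re_sum del: of_real_power)
    then show ?thesis
      using has_integral_Re[OF polynomial_inner_integral[OF F[OF that] r, where N = N and c = "a i"]]
      by (simp add: s_def a_def)
  qed
  have A: "((\<lambda>t. \<Sum>i<m. 2 * Re (F i (r * cis t) * cnj (s i (r * cis t))) - (cmod (s i (r * cis t)))\<^sup>2)
      has_integral (\<Sum>i<m. 2 * (2 * pi * I (a i)) - 2 * pi * I (a i))) {0..2 * pi}"
    unfolding s_def I_def
    by (intro has_integral_sum has_integral_diff has_integral_mult_right polynomial_norm_integral r
        1[unfolded s_def I_def]) auto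
  have B: "((\<lambda>t. \<Sum>i<m. (cmod (\<Sum>k\<le>N. c i k * (r * cis t) ^ k))\<^sup>2)
      has_integral (\<Sum>i<m. 2 * pi * I (c i))) {0..2 * pi}"
    unfolding I_def by (intro has_integral_sum polynomial_norm_integral r) auto
  have C: "(\<Sum>i<m. 2 * Re (F i (r * cis t) * cnj (s i (r * cis t))) - (cmod (s i (r * cis t)))\<^sup>2)
      \<le> (\<Sum>i<m. (cmod (\<Sum>k\<le>N. c i k * (r * cis t) ^ k))\<^sup>2)" for t
  proof -
    have "2 * Re (z * cnj y) - (cmod y)\<^sup>2 \<le> (cmod z)\<^sup>2" for z y
    proof -
      have "0 \<le> (cmod (z - y))\<^sup>2" by simp
      also have "(cmod (z - y))\<^sup>2 = (cmod z)\<^sup>2 - 2 * Re (z * cnj y) + (cmod y)\<^sup>2"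
        unfolding cmod_power2 by (simp add: power2_eq_square algebra_simps)
      finally show ?thesis by simp
    qed
    then have "(\<Sum>i<m. 2 * Re (F i (r * cis t) * cnj (s i (r * cis t))) - (cmod (s i (r * cis t)))\<^sup>2)
        \<le> (\<Sum>i<m. (cmod (F i (r * cis t)))\<^sup>2)"
      by (intro sum_mono)
    also have "\<dots> \<le> (\<Sum>i<m. (cmod (\<Sum>k\<le>N. c i k * (r * cis t) ^ k))\<^sup>2)"
      using r by (intro le) (simp add: norm_mult)
    finally show ?thesis .
  qed
  have "(\<Sum>i<m. 2 * (2 * pi * I (a i)) - 2 * pi * I (a i)) \<le> (\<Sum>i<m. 2 * pi * I (c i))"
    by (rule has_integral_le[OF A B]) (rule C)
  then have "2 * pi * (\<Sum>i<m. I (a i)) \<le> 2 * pi * (\<Sum>i<m. I (c i))"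
    by (simp add: sum_distrib_left mult.assoc)
  then have "(\<Sum>i<m. I (a i)) \<le> (\<Sum>i<m. I (c i))"
    by (rule mult_left_le_imp_le) simp
  then show ?thesis by (simp only: I_def a_def)
qed

text \<open>Both sides are polynomials in the radius, so the inequality survives the limit at 1 even
  though \<open>F\<close> need not extend to the unit circle.\<close>

lemma bessel_disc:
  fixes F :: "nat \<Rightarrow> complex \<Rightarrow> complex" and c :: "nat \<Rightarrow> nat \<Rightarrow> complex"
  assumes "\<And>i. i < m \<Longrightarrow> F i holomorphic_on ball 0 1"
    and "\<And>w. w \<in> ball 0 1 \<Longrightarrow>
      (\<Sum>i<m. (cmod (F i w))\<^sup>2) \<le> (\<Sum>i<m. (cmod (\<Sum>k\<le>N. c i k * w ^ k))\<^sup>2)"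
  shows "(\<Sum>i<m. \<Sum>k\<le>N. (cmod (fps_nth (fps_expansion (F i) 0) k))\<^sup>2) \<le> (\<Sum>i<m. \<Sum>k\<le>N. (cmod (c i k))\<^sup>2)"
proof -
  let ?g = "\<lambda>b r. \<Sum>i<m. \<Sum>k\<le>N. (cmod (b i k))\<^sup>2 * r ^ (2 * k)"
  let ?a = "\<lambda>i k. fps_nth (fps_expansion (F i) 0) k"
  have lim: "((\<lambda>r. ?g b r) \<longlongrightarrow> ?g b 1) (at_left 1)" for b :: "nat \<Rightarrow> nat \<Rightarrow> complex"
    by (intro tendsto_intros)
  have "eventually (\<lambda>r. r \<in> {0<..<1}) (at_left (1::real))"
    by (rule eventually_at_left_real) simp
  then have "eventually (\<lambda>r. ?g ?a r \<le> ?g c r) (at_left 1)"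
    by (rule eventually_mono) (use bessel_circle[OF assms(1) _ _ assms(2)] in auto)
  then have "?g ?a 1 \<le> ?g c 1"
    by (intro tendsto_le[OF _ lim lim]) auto
  then show ?thesis by simp
qed

lemma holomorphic_extend_bounded_sparse:
  assumes S: "open S" "K sparse_in S" and h: "h holomorphic_on S - K"
    and bdd: "\<And>z. z \<in> S - K \<Longrightarrow> cmod (h z) \<le> B"
  obtains g where "g holomorphic_on S" "\<And>z. z \<in> S - K \<Longrightarrow> g z = h z"
proof -
  have op: "open (S - K)" using S by (rule open_diff_sparse_pts)
  \<comment> \<open>Taking the limit at the exceptional points fixes the value there canonically, so
    the local removable-singularity extensions agree with one global function.\<close>
  define g where "g z = (if z \<in> S - K then h z else Lim (at z) h)" for z
  have "g analytic_on {z}" if "z \<in> S" for z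
  proof (cases "z \<in> K")
    case False
    have "g holomorphic_on S - K" using h by (rule holomorphic_transform) (simp add: g_def)
    then show ?thesis using op that False by (intro analytic_at[THEN iffD2]) blast
  next
    case True
    obtain U where U: "open U" "z \<in> U" "\<forall>y\<in>U. y \<noteq> z \<longrightarrow> y \<notin> K"
      using sparse_in_not_in[OF S(2) \<open>z \<in> S\<close>] by metis
    obtain e where e: "e > 0" "ball z e \<subseteq> S \<inter> U"
      using openE[of "S \<inter> U" z] S U \<open>z \<in> S\<close> by blast
    have sub: "ball z e - {z} \<subseteq> S - K" using e U by auto
    have "eventually (\<lambda>w. w \<in> ball z e - {z}) (at z)"
      using e by (intro eventually_at_in_open) auto
    then have "eventually (\<lambda>w. cmod (h w) \<le> B) (at z)"
      by (rule eventually_mono) (use bdd sub in auto)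
    then obtain q where q: "q holomorphic_on ball z e" "\<And>w. w \<in> ball z e - {z} \<Longrightarrow> q w = h w"
      using holomorphic_on_extend_bounded[OF holomorphic_on_subset[OF h sub]] e by auto
    have "isCont q z"
      using q(1) e by (metis centre_in_ball continuous_on_eq_continuous_at holomorphic_on_imp_continuous_on open_ball)
    then have "(q \<longlongrightarrow> q z) (at z)" by (simp add: isCont_def)
    then have "(h \<longlongrightarrow> q z) (at z)"
      by (rule Lim_transform_eventually)
        (use \<open>eventually (\<lambda>w. w \<in> ball z e - {z}) (at z)\<close> q(2) in \<open>auto elim: eventually_mono\<close>)
    then have "Lim (at z) h = q z" by (intro tendsto_Lim) auto
    then have "g w = q w" if "w \<in> ball z e" for w
      using True sub q(2)[of w] that by (cases "w = z") (auto simp: g_def)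
    then have "g holomorphic_on ball z e" using q(1) by (metis holomorphic_transform)
    then show ?thesis using e(1) analytic_at[of g z] by (metis centre_in_ball open_ball)
  qed
  then have "g analytic_on S" using analytic_on_analytic_at by blast
  then have "g holomorphic_on S" by (rule analytic_imp_holomorphic)
  then show ?thesis by (rule that) (simp add: g_def)
qed

section \<open>From positivity in the ring to inequalities for vectors\<close>

definition sqnorm :: "complex vec \<Rightarrow> real" where
  "sqnorm v = (\<Sum>i<dim_vec v. (cmod (v $ i))\<^sup>2)"

lemma sqnorm_nonneg: "0 \<le> sqnorm v"
  by (simp add: sqnorm_def sum_nonneg)

lemma vnorm_le_iff: "vnorm v \<le> vnorm w \<longleftrightarrow> sqnorm v \<le> sqnorm w"
  by (simp add: vnorm_def sqnorm_def)

lemma comp_mult_vec_carrier [simp]: "comp x k *\<^sub>v v \<in> carrier_vec k"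
  unfolding carrier_vec_def by simp

definition quad :: "matfam \<Rightarrow> nat \<Rightarrow> complex vec \<Rightarrow> real" where
  "quad x k v = Re ((comp x k *\<^sub>v v) \<bullet>c v)"

lemma quad_add: "v \<in> carrier_vec k \<Longrightarrow> quad (x + y) k v = quad x k v + quad y k v"
  by (simp add: quad_def add_mult_distrib_mat_vec[OF comp_carrier comp_carrier] add_scalar_prod_distrib[of _ k])

lemma quad_zero: "v \<in> carrier_vec k \<Longrightarrow> quad 0 k v = 0"
  using quad_add[of v k 0 0] by simp

lemma quad_minus: "v \<in> carrier_vec k \<Longrightarrow> quad (- x) k v = - quad x k v"
  using quad_add[of v k x "- x"] by (simp add: quad_zero)

lemma quad_sum: "v \<in> carrier_vec k \<Longrightarrow> quad (sum g I) k v = (\<Sum>i\<in>I. quad (g i) k v)"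
  by (induction I rule: infinite_finite_induct) (simp_all add: quad_add quad_zero)

lemma quad_square:
  assumes "v \<in> carrier_vec k"
  shows "quad (mstar x * x) k v = sqnorm (comp x k *\<^sub>v v)"
proof -
  have "(comp (mstar x * x) k *\<^sub>v v) = mat_adjoint (comp x k) *\<^sub>v (comp x k *\<^sub>v v)"
    using assms assoc_mult_mat_vec[of "mat_adjoint (comp x k)" k k "comp x k" k v] by simp
  moreover have "(mat_adjoint (comp x k) *\<^sub>v (comp x k *\<^sub>v v)) \<bullet>c v = (comp x k *\<^sub>v v) \<bullet>c (comp x k *\<^sub>v v)"
    using assms cscalar_prod_adjoint[of "mat_adjoint (comp x k)" k k "comp x k *\<^sub>v v" v] by simp
  ultimately show ?thesis by (simp add: quad_def cscalar_prod_self sqnorm_def)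
qed

text \<open>The difference of sums of squares is automatically selfadjoint, so only the norm
  inequality for each vector remains.\<close>

lemma psd_sum_squares_diff_iff:
  "psd (comp (\<Sum>i\<in>I. mstar (x i) * x i - mstar (y i) * y i) k) \<longleftrightarrow>
    (\<forall>v \<in> carrier_vec k. (\<Sum>i\<in>I. sqnorm (comp (y i) k *\<^sub>v v)) \<le> (\<Sum>i\<in>I. sqnorm (comp (x i) k *\<^sub>v v)))"
proof -
  let ?s = "\<Sum>i\<in>I. mstar (x i) * x i - mstar (y i) * y i"
  have "mstar ?s = ?s" by (simp add: matfam.star_sum)
  then have adj: "mat_adjoint (comp ?s k) = comp ?s k" by (metis comp_mstar)
  have "quad ?s k v = (\<Sum>i\<in>I. sqnorm (comp (x i) k *\<^sub>v v)) - (\<Sum>i\<in>I. sqnorm (comp (y i) k *\<^sub>v v))"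
    if "v \<in> carrier_vec k" for v
    unfolding quad_sum[OF that] diff_conv_add_uminus quad_add[OF that] quad_minus[OF that] quad_square[OF that]
    by (simp add: sum_subtractf)
  then show ?thesis unfolding psd_def quad_def[symmetric] using adj by auto
qed

section \<open>Entrywise Taylor expansions of matrix functions\<close>

definition ent :: "nat \<Rightarrow> matfam fps \<Rightarrow> nat \<Rightarrow> nat \<Rightarrow> complex fps" where
  "ent m B i j = Abs_fps (\<lambda>k. comp (fps_nth B k) m $$ (i, j))"

lemma ent_nth [simp]: "fps_nth (ent m B i j) k = comp (fps_nth B k) m $$ (i, j)"
  by (simp add: ent_def)

lemma ent_add: "i < m \<Longrightarrow> j < m \<Longrightarrow> ent m (B + C) i j = ent m B i j + ent m C i j"
  by (rule fps_ext) simp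

lemma ent_const: "i < m \<Longrightarrow> j < m \<Longrightarrow> ent m (fps_const c) i j = fps_const (comp c m $$ (i, j))"
  by (rule fps_ext) simp

lemma ent_X_mult: "i < m \<Longrightarrow> j < m \<Longrightarrow> ent m (fps_X * B) i j = fps_X * ent m B i j"
  by (rule fps_ext) simp

lemma ent_mult: "i < m \<Longrightarrow> j < m \<Longrightarrow> ent m (B * C) i j = (\<Sum>l<m. ent m B i l * ent m C l j)"
proof (rule fps_ext)
  fix k assume ij: "i < m" "j < m"
  have "fps_nth (ent m (B * C) i j) k
      = (\<Sum>a=0..k. \<Sum>l<m. comp (fps_nth B a) m $$ (i, l) * comp (fps_nth C (k - a)) m $$ (l, j))"
    using ij by (simp add: fps_mult_nth comp_sum_index scalar_prod_def atLeast0LessThan)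
  also have "\<dots> = (\<Sum>l<m. \<Sum>a=0..k. comp (fps_nth B a) m $$ (i, l) * comp (fps_nth C (k - a)) m $$ (l, j))"
    by (rule sum.swap)
  also have "\<dots> = fps_nth (\<Sum>l<m. ent m B i l * ent m C l j) k"
    by (simp add: fps_sum_nth fps_mult_nth)
  finally show "fps_nth (ent m (B * C) i j) k = fps_nth (\<Sum>l<m. ent m B i l * ent m C l j) k" .
qed

text \<open>The carrier condition covers the whole disc, while the expansion concerns only the germ
  at 0; \<open>b\<close> may thus be a function with singularities away from 0.\<close>

definition mexp :: "nat \<Rightarrow> (complex \<Rightarrow> complex mat) \<Rightarrow> matfam fps \<Rightarrow> bool" where
  "mexp m b B \<longleftrightarrow> (\<forall>w \<in> unit_disc. b w \<in> carrier_mat m m) \<and>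
    (\<forall>i<m. \<forall>j<m. (\<lambda>w. b w $$ (i, j)) has_fps_expansion ent m B i j)"

lemma mexpI:
  assumes "\<And>w. w \<in> unit_disc \<Longrightarrow> b w \<in> carrier_mat m m"
    and "\<And>i j. i < m \<Longrightarrow> j < m \<Longrightarrow> (\<lambda>w. b w $$ (i, j)) has_fps_expansion ent m B i j"
  shows "mexp m b B"
  using assms by (simp add: mexp_def)

lemma mexpD:
  assumes "mexp m b B"
  shows "w \<in> unit_disc \<Longrightarrow> b w \<in> carrier_mat m m"
    and "i < m \<Longrightarrow> j < m \<Longrightarrow> (\<lambda>w. b w $$ (i, j)) has_fps_expansion ent m B i j"
  using assms by (auto simp: mexp_def)

lemma has_fps_expansion_cong_disc:
  fixes f g :: "complex \<Rightarrow> complex"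
  assumes "f has_fps_expansion F" "\<And>w. w \<in> unit_disc \<Longrightarrow> g w = f w"
  shows "g has_fps_expansion F"
proof -
  have "eventually (\<lambda>w. w \<in> unit_disc) (nhds (0::complex))"
    by (intro eventually_nhds_in_open) auto
  then have "eventually (\<lambda>w. f w = g w) (nhds 0)"
    by (rule eventually_mono) (simp add: assms(2))
  then show ?thesis using assms(1) has_fps_expansion_cong by blast
qed

lemma mexp_add:
  assumes "mexp m b B" "mexp m c C"
  shows "mexp m (\<lambda>w. b w + c w) (B + C)"
proof (rule mexpI)
  fix i j assume ij: "i < m" "j < m"
  show "(\<lambda>w. (b w + c w) $$ (i, j)) has_fps_expansion ent m (B + C) i j"
    unfolding ent_add[OF ij]
    by (rule has_fps_expansion_cong_disc[OF has_fps_expansion_add[OF mexpD(2)[OF assms(1) ij] mexpD(2)[OF assms(2) ij]]])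
      (metis mexpD(1)[OF assms(2)] ij carrier_matD index_add_mat(1))
qed (use mexpD(1)[OF assms(1)] mexpD(1)[OF assms(2)] in auto)

lemma mexp_mult:
  assumes "mexp m b B" "mexp m c C"
  shows "mexp m (\<lambda>w. b w * c w) (B * C)"
proof (rule mexpI)
  fix i j assume ij: "i < m" "j < m"
  have "(\<lambda>w. \<Sum>l<m. b w $$ (i, l) * c w $$ (l, j)) has_fps_expansion (\<Sum>l<m. ent m B i l * ent m C l j)"
    by (intro has_fps_expansion_sum has_fps_expansion_mult mexpD(2)[OF assms(1)] mexpD(2)[OF assms(2)] ij) auto
  then show "(\<lambda>w. (b w * c w) $$ (i, j)) has_fps_expansion ent m (B * C) i j"
    unfolding ent_mult[OF ij]
    by (rule has_fps_expansion_cong_disc)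
      (use mexpD(1)[OF assms(1)] mexpD(1)[OF assms(2)] ij in \<open>fastforce simp: scalar_prod_def atLeast0LessThan\<close>)
next
  fix w :: complex assume "w \<in> unit_disc"
  then show "b w * c w \<in> carrier_mat m m"
    using mexpD(1)[OF assms(1)] mexpD(1)[OF assms(2)] by (intro mult_carrier_mat) blast+
qed

lemma mexp_const:
  assumes "comp c m = A"
  shows "mexp m (\<lambda>_. A) (fps_const c)"
  using assms by (intro mexpI) (auto simp: ent_const)

lemma mexp_smult:
  assumes "mexp m b B"
  shows "mexp m (\<lambda>w. w \<cdot>\<^sub>m b w) (fps_X * B)"
proof (rule mexpI)
  fix i j assume ij: "i < m" "j < m"
  show "(\<lambda>w. (w \<cdot>\<^sub>m b w) $$ (i, j)) has_fps_expansion ent m (fps_X * B) i j"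
    unfolding ent_X_mult[OF ij]
    by (rule has_fps_expansion_cong_disc[OF has_fps_expansion_mult[OF has_fps_expansion_fps_X mexpD(2)[OF assms ij]]])
      (use mexpD(1)[OF assms] ij in fastforce)
qed (use mexpD(1)[OF assms] in auto)

text \<open>The expansion determines the component \<open>m\<close> only.\<close>

lemma mexp_unique:
  assumes "mexp m b B" "mexp m b C"
  shows "comp (fps_nth B k) m = comp (fps_nth C k) m"
proof (rule eq_matI)
  fix i j assume "i < dim_row (comp (fps_nth C k) m)" "j < dim_col (comp (fps_nth C k) m)"
  then have ij: "i < m" "j < m" by auto
  show "comp (fps_nth B k) m $$ (i, j) = comp (fps_nth C k) m $$ (i, j)"
    using fps_nth_fps_expansion[OF mexpD(2)[OF assms(1) ij], of k]
      fps_nth_fps_expansion[OF mexpD(2)[OF assms(2) ij], of k] by simp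
qed auto

lemma mexp_cong:
  assumes "mexp m b B" "\<And>w. w \<in> unit_disc \<Longrightarrow> c w \<in> carrier_mat m m"
    and "eventually (\<lambda>w. b w = c w) (nhds 0)"
  shows "mexp m c B"
proof (rule mexpI)
  fix i j assume ij: "i < m" "j < m"
  have e: "eventually (\<lambda>w. b w $$ (i, j) = c w $$ (i, j)) (nhds 0)"
    using assms(3) by (rule eventually_mono) simp
  show "(\<lambda>w. c w $$ (i, j)) has_fps_expansion ent m B i j"
    using mexpD(2)[OF assms(1) ij] has_fps_expansion_cong[OF e refl] by blast
qed (rule assms(2))

lemma det_holomorphic_on:
  fixes D :: "complex \<Rightarrow> complex mat"
  assumes "\<And>w. w \<in> U \<Longrightarrow> D w \<in> carrier_mat n n"
    and "\<And>i j. i < n \<Longrightarrow> j < n \<Longrightarrow> (\<lambda>w. D w $$ (i, j)) holomorphic_on U"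
  shows "(\<lambda>w. det (D w)) holomorphic_on U"
proof (rule holomorphic_transform)
  show "(\<lambda>w. \<Sum>p\<in>{p. p permutes {0..<n}}. signof p * (\<Prod>i=0..<n. D w $$ (i, p i))) holomorphic_on U"
    by (intro holomorphic_intros assms(2)) (auto simp: permutes_in_image)
qed (simp add: det_def'[OF assms(1)])

lemma adj_mat_holomorphic_on:
  fixes D :: "complex \<Rightarrow> complex mat"
  assumes D: "\<And>w. w \<in> U \<Longrightarrow> D w \<in> carrier_mat n n"
    and hol: "\<And>i j. i < n \<Longrightarrow> j < n \<Longrightarrow> (\<lambda>w. D w $$ (i, j)) holomorphic_on U"
    and ij: "i < n" "j < n"
  shows "(\<lambda>w. adj_mat (D w) $$ (i, j)) holomorphic_on U"
proof (rule holomorphic_transform)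
  have dim: "dim_row (D w) = n" "dim_col (D w) = n" if "w \<in> U" for w
    using D[OF that] by auto
  show "(\<lambda>w. (- 1) ^ (j + i) * det (mat_delete (D w) j i)) holomorphic_on U"
  proof (intro holomorphic_intros det_holomorphic_on)
    fix a b assume ab: "a < n - 1" "b < n - 1"
    show "(\<lambda>w. mat_delete (D w) j i $$ (a, b)) holomorphic_on U"
    proof (rule holomorphic_transform)
      show "(\<lambda>w. D w $$ (if a < j then a else Suc a, if b < i then b else Suc b)) holomorphic_on U"
        using ab by (intro hol) auto
    qed (use dim ab in \<open>auto simp: mat_delete_def\<close>)
  next
    fix w assume "w \<in> U"
    then show "mat_delete (D w) j i \<in> carrier_mat (n - 1) (n - 1)"
      using dim[of w] unfolding mat_delete_def by simp
  qed
  show "(- 1) ^ (j + i) * det (mat_delete (D w) j i) = adj_mat (D w) $$ (i, j)" if "w \<in> U" for w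
    using dim[OF that] ij by (simp add: adj_mat_def cofactor_def)
qed

section \<open>The Krein structure of a signature matrix\<close>

definition half_plus :: "nat \<Rightarrow> complex mat \<Rightarrow> complex mat" where
  "half_plus m J = (1 / 2) \<cdot>\<^sub>m (1\<^sub>m m + J)"

definition half_minus :: "nat \<Rightarrow> complex mat \<Rightarrow> complex mat" where
  "half_minus m J = 1\<^sub>m m - half_plus m J"

locale signature =
  fixes m :: nat and Jm :: "complex mat"
  assumes sig: "signature_mat m Jm"
begin

lemma J_mat: "Jm \<in> carrier_mat m m" "mat_adjoint Jm = Jm" "Jm * Jm = 1\<^sub>m m"
  using sig by (auto simp: signature_mat_def)

abbreviation Pm where "Pm \<equiv> half_plus m Jm"
abbreviation Qm where "Qm \<equiv> half_minus m Jm"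

lemma Pm: "Pm \<in> carrier_mat m m" "mat_adjoint Pm = Pm" "Pm * Pm = Pm"
proof -
  show c: "Pm \<in> carrier_mat m m" using J_mat by (simp add: half_plus_def)
  have "cnj (Jm $$ (j, i)) = Jm $$ (i, j)" if "i < m" "j < m" for i j
    using that J_mat(1) arg_cong[OF J_mat(2), of "\<lambda>M. M $$ (i, j)"] by simp
  then show "mat_adjoint Pm = Pm"
    using J_mat(1) by (intro eq_matI) (auto simp: half_plus_def)
  have "Pm * Pm = (1 / 4) \<cdot>\<^sub>m ((1\<^sub>m m + Jm) * (1\<^sub>m m + Jm))"
    using J_mat(1) unfolding half_plus_def
    by (subst mult_smult_distrib[of _ m m _ m], simp, simp, subst mult_smult_assoc_mat[of _ m m _ m])
      (auto intro!: eq_matI)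
  also have "(1\<^sub>m m + Jm) * (1\<^sub>m m + Jm) = 1\<^sub>m m + Jm + (Jm + 1\<^sub>m m)"
    using J_mat by (subst add_mult_distrib_mat[of _ m m _ _ m], auto, subst mult_add_distrib_mat[of _ m m _ m])
      auto
  also have "(1 / 4) \<cdot>\<^sub>m \<dots> = Pm"
    using J_mat(1) unfolding half_plus_def by (intro eq_matI) auto
  finally show "Pm * Pm = Pm" .
qed

lemma Qm: "Qm \<in> carrier_mat m m"
  unfolding half_minus_def by (simp add: Pm minus_carrier_mat)

text \<open>With unit padding \<open>Q\<close> vanishes and \<open>J\<close> is the identity in all
  sizes other than \<open>m\<close>. There a zero-padded element has the form
  \<open>mstar a * a\<close> on its graph, which is positive.\<close>

definition PP where "PP = emb m True Pm"

lemma comp_PP: "comp PP k = (if k = m then Pm else 1\<^sub>m k)"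
  unfolding PP_def using Pm(1) by (simp add: comp_emb)

sublocale krein mstar mpos PP
proof
  show "mstar PP = PP" by (rule matfam_eqI) (simp add: comp_PP Pm)
  show "PP * PP = PP" by (rule matfam_eqI) (simp add: comp_PP Pm)
qed

lemma comp_Q: "comp Q k = (if k = m then Qm else 0\<^sub>m k k)"
  by (simp add: Q_def comp_PP half_minus_def minus_r_inv_mat[of _ k k])

lemma comp_J: "comp J k = (if k = m then Jm else 1\<^sub>m k)"
proof (cases "k = m")
  case True
  have "Pm - Qm = Jm"
    using J_mat(1) unfolding half_minus_def half_plus_def by (intro eq_matI) (auto simp: field_simps)
  with True show ?thesis by (simp add: J_def comp_PP comp_Q)
qed (auto simp: J_def comp_PP comp_Q intro!: eq_matI)

lemma comp_form_emb:
  assumes "A \<in> carrier_mat m m"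
  shows "comp (form a (emb m False A * a)) k
    = mat_adjoint (comp a k) * (if k = m then Jm - mat_adjoint A * Jm * A else 1\<^sub>m k) * comp a k"
proof -
  let ?A = "emb m False A"
  have "form a (?A * a) = mstar a * (J - mstar ?A * J * ?A) * a"
    by (simp add: form_def algebra_simps)
  moreover have "comp (J - mstar ?A * J * ?A) k = (if k = m then Jm - mat_adjoint A * Jm * A else 1\<^sub>m k)"
    using assms by (auto simp: comp_J comp_emb minus_r_inv_mat intro!: eq_matI)
  ultimately show ?thesis by simp
qed

lemma mpos_form_emb:
  assumes "A \<in> carrier_mat m m" "J_contractive Jm A"
  shows "mpos (form a (emb m False A * a))"
  unfolding mpos_def
proof
  fix k
  show "psd (comp (form a (emb m False A * a)) k)"
  proof (cases "k = m")
    case True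
    have "Jm - mat_adjoint A * Jm * A \<in> carrier_mat m m"
      using assms(1) by (intro minus_carrier_mat) simp
    then show ?thesis unfolding comp_form_emb[OF assms(1)] using assms True
      by (auto simp: J_contractive_def intro!: psd_conj[where n = m and k = m])
  next
    case False
    then show ?thesis unfolding comp_form_emb[OF assms(1)]
      using psd_adjoint_mult_self[OF comp_carrier[of a k]] by simp
  qed
qed

text \<open>The abstract Ginzburg argument read in component \<open>m\<close>; the norm inequality
  is \<open>form_eq\<close> for the graph point with input 1. Together they make
  \<open>Pm * A + Qm\<close> times the inverse of \<open>Pm + Qm * A\<close> a contraction.\<close>

lemma ginzburg_pointwise:
  assumes A: "A \<in> carrier_mat m m" "J_contractive Jm A"
  shows "det (Pm + Qm * A) \<noteq> 0"
    and "v \<in> carrier_vec m \<Longrightarrow> sqnorm ((Pm * A + Qm) *\<^sub>v v) \<le> sqnorm ((Pm + Qm * A) *\<^sub>v v)"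
proof -
  let ?A = "emb m False A"
  have c: "comp (PP + Q * ?A) m = Pm + Qm * A" "comp (PP * ?A + Q) m = Pm * A + Qm"
    using A(1) by (simp_all add: comp_PP comp_Q comp_emb)
  obtain s where "s * (PP + Q * ?A) = 1"
    using ginzburg_invertible mpos_form_emb[OF A] by blast
  then have "comp s m * (Pm + Qm * A) = 1\<^sub>m m"
    by (metis c(1) comp_ring(2,6))
  then have "det (comp s m) * det (Pm + Qm * A) = 1"
    using det_mult[of "comp s m" m "Pm + Qm * A"] A(1) Qm Pm(1) by simp
  then show "det (Pm + Qm * A) \<noteq> 0" by auto
  have "psd (comp (\<Sum>i\<in>{()}. mstar (PP + Q * ?A) * (PP + Q * ?A) - mstar (PP * ?A + Q) * (PP * ?A + Q)) m)"
    using mpos_form_emb[OF A, of 1] by (simp add: form_eq mpos_def)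
  then show "v \<in> carrier_vec m \<Longrightarrow> sqnorm ((Pm * A + Qm) *\<^sub>v v) \<le> sqnorm ((Pm + Qm * A) *\<^sub>v v)"
    unfolding psd_sum_squares_diff_iff c by simp
qed

end

section \<open>Taylor series of functions in the Potapov class\<close>

lemma open_hol_pts: "open (hol_pts m f)"
proof (rule openI)
  fix z assume "z \<in> hol_pts m f"
  then obtain r where r: "r > 0" "mat_holomorphic_on m f (ball z r)" and z: "z \<in> unit_disc"
    by (auto simp: hol_pts_def)
  obtain e where e: "e > 0" "ball z e \<subseteq> unit_disc \<inter> ball z r"
    using openE[of "unit_disc \<inter> ball z r" z] z r(1) by (metis IntI centre_in_ball open_Int open_ball)
  have "y \<in> hol_pts m f" if y: "y \<in> ball z e" for y
  proof -
    obtain d where d: "d > 0" "ball y d \<subseteq> ball z e"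
      using openE[of "ball z e" y] y by blast
    then have "mat_holomorphic_on m f (ball y d)"
      using r(2) e(2) unfolding mat_holomorphic_on_def by (blast intro: holomorphic_on_subset)
    then show ?thesis using y e d(1) by (auto simp: hol_pts_def)
  qed
  then show "\<exists>e>0. ball z e \<subseteq> hol_pts m f" using e(1) by blast
qed

lemma hol_pts_holomorphic:
  assumes "i < m" "j < m"
  shows "(\<lambda>w. f w $$ (i, j)) holomorphic_on hol_pts m f"
proof -
  have "(\<lambda>w. f w $$ (i, j)) analytic_on {z}" if z: "z \<in> hol_pts m f" for z
  proof -
    obtain r where "r > 0" "mat_holomorphic_on m f (ball z r)"
      using z by (auto simp: hol_pts_def)
    then show ?thesis using assms analytic_at[of "\<lambda>w. f w $$ (i, j)" z]
      unfolding mat_holomorphic_on_def by (metis centre_in_ball open_ball)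
  qed
  then show ?thesis using analytic_imp_holomorphic analytic_on_analytic_at by blast
qed

lemma hol_pts_subset: "hol_pts m f \<subseteq> unit_disc"
  by (auto simp: hol_pts_def)

text \<open>A sparse set does not accumulate at \<open>z\<close>, so \<open>z\<close> is a limit of
  points where the inequality is known.\<close>

lemma continuous_le_off_sparse:
  fixes u v :: "complex \<Rightarrow> real"
  assumes "continuous_on S u" "continuous_on S v" "open S" "K sparse_in S" "z \<in> S"
    and le: "\<And>w. w \<in> S - K \<Longrightarrow> u w \<le> v w"
  shows "u z \<le> v z"
proof -
  have "isCont u z" "isCont v z"
    using assms by (auto simp: continuous_on_eq_continuous_at)
  then have "(u \<longlongrightarrow> u z) (at z)" "(v \<longlongrightarrow> v z) (at z)"
    by (simp_all add: isCont_def)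
  moreover have "eventually (\<lambda>w. u w \<le> v w) (at z)"
  proof -
    have "\<not> z islimpt K" using assms by (simp add: sparse_in_open)
    then have "eventually (\<lambda>w. w \<notin> K) (at z)" by (simp add: islimpt_iff_eventually)
    moreover have "eventually (\<lambda>w. w \<in> S) (at z)"
      using assms(3,5) by (rule eventually_at_in_open')
    ultimately show ?thesis by eventually_elim (use le in auto)
  qed
  ultimately show ?thesis by (intro tendsto_le[of "at z" v "v z" u "u z"]) auto
qed

definition taylor_fps :: "nat \<Rightarrow> (complex \<Rightarrow> complex mat) \<Rightarrow> matfam fps" where
  "taylor_fps m f = Abs_fps (\<lambda>k. emb m False (taylor_coeff m f k))"

lemma taylor_coeff_carrier [simp]: "taylor_coeff m f k \<in> carrier_mat m m"
  by (simp add: taylor_coeff_def)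

lemma mexp_taylor_fps:
  assumes "\<And>w. w \<in> unit_disc \<Longrightarrow> f w \<in> carrier_mat m m"
    and "\<And>i j. i < m \<Longrightarrow> j < m \<Longrightarrow> (\<lambda>w. f w $$ (i, j)) holomorphic_on U" "open U" "0 \<in> U"
  shows "mexp m f (taylor_fps m f)"
proof (rule mexpI)
  fix i j assume ij: "i < m" "j < m"
  have e: "(\<lambda>w. f w $$ (i, j)) has_fps_expansion fps_expansion (\<lambda>w. f w $$ (i, j)) 0"
    using assms(3,4) assms(2)[OF ij] by (rule has_fps_expansion_fps_expansion)
  moreover have "fps_expansion (\<lambda>w. f w $$ (i, j)) 0 = ent m (taylor_fps m f) i j"
    using ij by (intro fps_ext) (simp add: taylor_fps_def comp_emb fps_nth_fps_expansion[OF e], simp add: taylor_coeff_def)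
  ultimately show "(\<lambda>w. f w $$ (i, j)) has_fps_expansion ent m (taylor_fps m f) i j" by simp
qed (rule assms(1))

lemma comp_sum_mult_vec:
  assumes "v \<in> carrier_vec k" "i < k"
  shows "(comp (sum g I) k *\<^sub>v v) $ i = (\<Sum>a\<in>I. (comp (g a) k *\<^sub>v v) $ i)"
proof (induction I rule: infinite_finite_induct)
  case (insert x F)
  then show ?case using assms
    by (simp add: add_mult_distrib_mat_vec[OF comp_carrier comp_carrier])
qed (use assms in auto)

text \<open>A contractive holomorphic matrix function acts contractively on truncated power series.\<close>

lemma toeplitz_contractive:
  fixes g :: "nat \<Rightarrow> nat \<Rightarrow> complex \<Rightarrow> complex" and m :: nat
  defines "Gs \<equiv> Abs_fps (\<lambda>k. emb m False (mat m m (\<lambda>(i, j). fps_nth (fps_expansion (g i j) 0) k)))"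
  assumes hol: "\<And>i j. i < m \<Longrightarrow> j < m \<Longrightarrow> g i j holomorphic_on unit_disc"
    and contr: "\<And>w v. w \<in> unit_disc \<Longrightarrow> (\<Sum>i<m. (cmod (\<Sum>j<m. g i j w * v j))\<^sup>2) \<le> (\<Sum>j<m. (cmod (v j))\<^sup>2)"
  shows "mpos (\<Sum>k\<le>N. mstar (fps_nth c k) * fps_nth c k - mstar (fps_nth (Gs * c) k) * fps_nth (Gs * c) k)"
  unfolding mpos_def psd_sum_squares_diff_iff
proof (intro allI ballI)
  fix l and v :: "complex vec" assume v: "v \<in> carrier_vec l"
  have Gs: "comp (fps_nth Gs k) l = (if l = m then mat m m (\<lambda>(i, j). fps_nth (fps_expansion (g i j) 0) k) else 0\<^sub>m l l)" for k
    by (simp add: Gs_def comp_emb)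
  have mv: "comp (x * y) l *\<^sub>v v = comp x l *\<^sub>v (comp y l *\<^sub>v v)" for x y
    using v assoc_mult_mat_vec[of "comp x l" l l "comp y l" l v] by simp
  have nth: "(comp (fps_nth (Gs * c) k) l *\<^sub>v v) $ i
      = (\<Sum>a=0..k. (comp (fps_nth Gs a) l *\<^sub>v (comp (fps_nth c (k - a)) l *\<^sub>v v)) $ i)" if "i < l" for i k
    unfolding fps_mult_nth comp_sum_mult_vec[OF v that] mv ..
  show "(\<Sum>k\<le>N. sqnorm (comp (fps_nth (Gs * c) k) l *\<^sub>v v)) \<le> (\<Sum>k\<le>N. sqnorm (comp (fps_nth c k) l *\<^sub>v v))"
  proof (cases "l = m")
    case False
    have "(comp (fps_nth (Gs * c) k) l *\<^sub>v v) $ i = 0" if "i < l" for i k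
      unfolding nth[OF that] Gs using False that by (intro sum.neutral) auto
    then have "sqnorm (comp (fps_nth (Gs * c) k) l *\<^sub>v v) = 0" for k
      by (simp add: sqnorm_def)
    then show ?thesis by (simp add: sum_nonneg sqnorm_nonneg)
  next
    case True
    \<comment> \<open>The coefficients of \<open>c\<close> applied to \<open>v\<close> become those
      of a vector polynomial \<open>p\<close>. The Taylor coefficients of \<open>F\<close>, the
      matrix function applied to \<open>p\<close>, are then the Toeplitz outputs, and Bessel's
      inequality bounds them.\<close>
    define u where "u i k = (comp (fps_nth c k) m *\<^sub>v v) $ i" for i k
    define p where "p j w = (\<Sum>k\<le>N. u j k * w ^ k)" for j w
    define F where "F i w = (\<Sum>j<m. g i j w * p j w)" for i w
    have F: "fps_nth (fps_expansion (F i) 0) k = (comp (fps_nth (Gs * c) k) m *\<^sub>v v) $ i"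
      if "i < m" "k \<le> N" for i k
    proof -
      have A: "F i has_fps_expansion (\<Sum>j<m. fps_expansion (g i j) 0 * Abs_fps (\<lambda>k. if k \<le> N then u j k else 0))"
        unfolding F_def p_def using \<open>i < m\<close>
        by (intro has_fps_expansion_sum has_fps_expansion_mult fps_expansion_polynomial
            holomorphic_imp_has_fps_expansion[of _ 1] hol) auto
      have "F i holomorphic_on ball 0 1"
        unfolding F_def p_def using \<open>i < m\<close> by (intro holomorphic_intros hol) auto
      then have B: "F i has_fps_expansion fps_expansion (F i) 0"
        by (rule holomorphic_imp_has_fps_expansion) simp
      have "fps_nth (fps_expansion (F i) 0) k
          = fps_nth (\<Sum>j<m. fps_expansion (g i j) 0 * Abs_fps (\<lambda>k. if k \<le> N then u j k else 0)) k"
        using fps_nth_fps_expansion[OF A, of k] fps_nth_fps_expansion[OF B, of k] by (simp only:)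
      also have "\<dots> = (\<Sum>j<m. \<Sum>a=0..k. fps_nth (fps_expansion (g i j) 0) a * u j (k - a))"
        unfolding fps_sum_nth fps_mult_nth using \<open>k \<le> N\<close> by (intro sum.cong) auto
      also have "\<dots> = (\<Sum>a=0..k. \<Sum>j<m. fps_nth (fps_expansion (g i j) 0) a * u j (k - a))"
        by (rule sum.swap)
      also have "\<dots> = (comp (fps_nth (Gs * c) k) m *\<^sub>v v) $ i"
      proof -
        have "(comp (fps_nth Gs a) m *\<^sub>v x) $ i = (\<Sum>j<m. fps_nth (fps_expansion (g i j) 0) a * x $ j)"
          if "x \<in> carrier_vec m" for a x
          using Gs[of a] True that \<open>i < m\<close> by (simp add: scalar_prod_def atLeast0LessThan)
        then show ?thesis
          using nth[of i k] \<open>i < m\<close> True by (simp add: u_def)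
      qed
      finally show ?thesis .
    qed
    have "(\<Sum>i<m. \<Sum>k\<le>N. (cmod (fps_nth (fps_expansion (F i) 0) k))\<^sup>2) \<le> (\<Sum>i<m. \<Sum>k\<le>N. (cmod (u i k))\<^sup>2)"
    proof (rule bessel_disc)
      show "F i holomorphic_on ball 0 1" if "i < m" for i
        unfolding F_def p_def using that by (intro holomorphic_intros hol) auto
      show "(\<Sum>i<m. (cmod (F i w))\<^sup>2) \<le> (\<Sum>i<m. (cmod (\<Sum>k\<le>N. u i k * w ^ k))\<^sup>2)" if "w \<in> ball 0 1" for w
        unfolding F_def p_def[symmetric] using contr[OF that] .
    qed
    then have "(\<Sum>i<m. \<Sum>k\<le>N. (cmod ((comp (fps_nth (Gs * c) k) m *\<^sub>v v) $ i))\<^sup>2) \<le> (\<Sum>i<m. \<Sum>k\<le>N. (cmod (u i k))\<^sup>2)"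
      by (simp add: F)
    then have "(\<Sum>k\<le>N. \<Sum>i<m. (cmod ((comp (fps_nth (Gs * c) k) m *\<^sub>v v) $ i))\<^sup>2)
        \<le> (\<Sum>k\<le>N. \<Sum>i<m. (cmod (u i k))\<^sup>2)"
      unfolding sum.swap[where A = "{..N}" and B = "{..<m}"] .
    then show ?thesis by (simp add: True sqnorm_def u_def)
  qed
qed

context signature
begin

text \<open>At holomorphy points the Ginzburg transform \<open>G\<close> of \<open>f\<close> is a
  contraction, so its singularities are removable. The extension acts contractively on truncated
  series, and undoing the transform coefficientwise turns this into positivity of the form on the
  graph of the Taylor series of \<open>f\<close>.\<close>

lemma potapov_taylor_fps:
  assumes f: "f \<in> P_J0 m Jm"
  shows "potapov (taylor_fps m f)" and "mexp m f (taylor_fps m f)"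
proof -
  let ?U = "hol_pts m f" and ?K = "unit_disc - hol_pts m f" and ?f = "taylor_fps m f"
  have f_car: "f w \<in> carrier_mat m m" if "w \<in> unit_disc" for w
    using f that by (auto simp: P_J0_def meromorphic_disc_def)
  have K: "?K sparse_in unit_disc"
    using f by (simp add: P_J0_def meromorphic_disc_def sparse_in_open)
  have U0: "0 \<in> ?U" and contr: "\<And>w. w \<in> ?U \<Longrightarrow> J_contractive Jm (f w)"
    using f by (auto simp: P_J0_def)
  have U: "unit_disc - ?K = ?U" using hol_pts_subset by blast
  have f_carU: "f w \<in> carrier_mat m m" if "w \<in> ?U" for w
    using that f_car hol_pts_subset by blast
  have f_dim: "dim_row (f w) = m" "dim_col (f w) = m" if "w \<in> ?U" for w
    using f_car[of w] that hol_pts_subset by (metis carrier_matD subsetD)+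
  show mexp_f: "mexp m f ?f"
    using f_car hol_pts_holomorphic open_hol_pts U0 by (rule mexp_taylor_fps)
  define D where "D w = Pm + Qm * f w" for w
  define Nm where "Nm w = Pm * f w + Qm" for w
  define G where "G w = Nm w * (inverse (det (D w)) \<cdot>\<^sub>m adj_mat (D w))" for w
  have car: "D w \<in> carrier_mat m m" "Nm w \<in> carrier_mat m m" "adj_mat (D w) \<in> carrier_mat m m" if "w \<in> ?U" for w
  proof -
    show D: "D w \<in> carrier_mat m m" "Nm w \<in> carrier_mat m m"
      using Pm(1) Qm f_dim[OF that] by (auto simp: D_def Nm_def)
    show "adj_mat (D w) \<in> carrier_mat m m" using adj_mat(1)[OF D(1)] .
  qed
  have det: "det (D w) \<noteq> 0" if "w \<in> ?U" for w
    unfolding D_def using ginzburg_pointwise(1) f_car contr that hol_pts_subset by blast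
  have G_car: "G w \<in> carrier_mat m m" if "w \<in> ?U" for w
    using car[OF that] by (simp add: G_def)
  define Di where "Di w = inverse (det (D w)) \<cdot>\<^sub>m adj_mat (D w)" for w
  have Di: "Di w \<in> carrier_mat m m" "Di w * D w = 1\<^sub>m m" "D w * Di w = 1\<^sub>m m" if "w \<in> ?U" for w
  proof -
    have "inverse (det (D w)) \<cdot>\<^sub>m (det (D w) \<cdot>\<^sub>m 1\<^sub>m m) = 1\<^sub>m m"
      using det[OF that] by (intro eq_matI) auto
    then show "Di w \<in> carrier_mat m m" "Di w * D w = 1\<^sub>m m" "D w * Di w = 1\<^sub>m m"
      using adj_mat[OF car(1)[OF that]] car[OF that]
      by (auto simp: Di_def mult_smult_distrib[of _ m m _ m] mult_smult_assoc_mat[of _ m m _ m])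
  qed
  have GD: "G w * D w = Nm w" if "w \<in> ?U" for w
  proof -
    have "G w * D w = Nm w * (Di w * D w)"
      unfolding G_def Di_def[symmetric] using car[OF that] Di(1)[OF that] by (intro mat_mult_assoc) auto
    then show ?thesis using Di(2)[OF that] car(2)[OF that] by simp
  qed
  have G_contr: "sqnorm (G w *\<^sub>v v) \<le> sqnorm v" if w: "w \<in> ?U" and v: "v \<in> carrier_vec m" for w v
  proof -
    have u: "Di w *\<^sub>v v \<in> carrier_vec m" using Di(1)[OF w] v by simp
    have "G w *\<^sub>v v = Nm w *\<^sub>v (Di w *\<^sub>v v)"
      unfolding G_def Di_def[symmetric] using car[OF w] Di(1)[OF w] v by (intro assoc_mult_mat_vec) auto
    moreover have "D w *\<^sub>v (Di w *\<^sub>v v) = v"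
      using Di[OF w] car[OF w] v by (subst assoc_mult_mat_vec[symmetric, of _ m m _ m]) auto
    moreover have "sqnorm (Nm w *\<^sub>v (Di w *\<^sub>v v)) \<le> sqnorm (D w *\<^sub>v (Di w *\<^sub>v v))"
      unfolding Nm_def D_def using ginzburg_pointwise(2)[OF _ contr[OF w] u] f_car w hol_pts_subset by blast
    ultimately show ?thesis by simp
  qed
  have f_hol: "(\<lambda>w. f w $$ (i, j)) holomorphic_on ?U" if "i < m" "j < m" for i j
    using that by (rule hol_pts_holomorphic)
  have mult_hol: "(\<lambda>w. (A w * B w) $$ (i, j)) holomorphic_on ?U"
    if ij: "i < m" "j < m" and A: "\<And>w. w \<in> ?U \<Longrightarrow> A w \<in> carrier_mat m m" and B: "\<And>w. w \<in> ?U \<Longrightarrow> B w \<in> carrier_mat m m"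
      and hol: "\<And>i j. i < m \<Longrightarrow> j < m \<Longrightarrow> (\<lambda>w. A w $$ (i, j)) holomorphic_on ?U"
        "\<And>i j. i < m \<Longrightarrow> j < m \<Longrightarrow> (\<lambda>w. B w $$ (i, j)) holomorphic_on ?U"
    for A B :: "complex \<Rightarrow> complex mat" and i j
  proof (rule holomorphic_transform)
    show "(\<lambda>w. \<Sum>l<m. A w $$ (i, l) * B w $$ (l, j)) holomorphic_on ?U"
      using ij by (intro holomorphic_intros hol) auto
    fix w assume w: "w \<in> ?U"
    show "(\<Sum>l<m. A w $$ (i, l) * B w $$ (l, j)) = (A w * B w) $$ (i, j)"
      using A[OF w] B[OF w] ij by (simp add: scalar_prod_def atLeast0LessThan)
  qed
  have D_hol: "(\<lambda>w. D w $$ (i, j)) holomorphic_on ?U" if ij: "i < m" "j < m" for i j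
  proof (rule holomorphic_transform)
    show "(\<lambda>w. Pm $$ (i, j) + (Qm * f w) $$ (i, j)) holomorphic_on ?U"
      using ij Qm f_carU by (intro holomorphic_intros mult_hol f_hol) auto
  qed (use ij Qm f_dim in \<open>auto simp: D_def\<close>)
  have N_hol: "(\<lambda>w. Nm w $$ (i, j)) holomorphic_on ?U" if ij: "i < m" "j < m" for i j
  proof (rule holomorphic_transform)
    show "(\<lambda>w. (Pm * f w) $$ (i, j) + Qm $$ (i, j)) holomorphic_on ?U"
      using ij Pm f_carU by (intro holomorphic_intros mult_hol f_hol) auto
  qed (use ij Qm Pm f_dim in \<open>auto simp: Nm_def\<close>)
  have G_hol: "(\<lambda>w. G w $$ (i, j)) holomorphic_on ?U" if ij: "i < m" "j < m" for i j
    unfolding G_def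
  proof (rule mult_hol[OF ij])
    fix a b assume ab: "a < m" "b < m"
    show "(\<lambda>w. Nm w $$ (a, b)) holomorphic_on ?U" using ab by (rule N_hol)
    show "(\<lambda>w. (inverse (det (D w)) \<cdot>\<^sub>m adj_mat (D w)) $$ (a, b)) holomorphic_on ?U"
    proof (rule holomorphic_transform)
      show "(\<lambda>w. inverse (det (D w)) * adj_mat (D w) $$ (a, b)) holomorphic_on ?U"
        by (intro holomorphic_on_mult holomorphic_on_inverse det_holomorphic_on[where n = m]
            adj_mat_holomorphic_on[where n = m]) (use car(1) D_hol ab det in auto)
    next
      fix w assume "w \<in> ?U"
      then show "inverse (det (D w)) * adj_mat (D w) $$ (a, b) = (inverse (det (D w)) \<cdot>\<^sub>m adj_mat (D w)) $$ (a, b)"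
        using car(3) ab by (metis carrier_matD index_smult_mat(1))
    qed
  qed (use car in auto)
  \<comment> \<open>A contraction has entries of modulus at most 1, so each entry of
    \<open>G\<close> extends over the points where \<open>f\<close> is not holomorphic.\<close>
  have "\<exists>g. g holomorphic_on unit_disc \<and> (\<forall>w \<in> ?U. g w = G w $$ (i, j))" if ij: "i < m" "j < m" for i j
  proof -
    have "cmod (G w $$ (i, j)) \<le> 1" if w: "w \<in> ?U" for w
    proof -
      have "(cmod (G w $$ (i, j)))\<^sup>2 \<le> sqnorm (G w *\<^sub>v unit_vec m j)"
        unfolding sqnorm_def using G_car[OF w] ij
          member_le_sum[of i "{..<m}" "\<lambda>a. (cmod (G w $$ (a, j)))\<^sup>2"] by simp
      also have "\<dots> \<le> sqnorm (unit_vec m j)" using G_contr[OF w] by simp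
      also have "\<dots> = (\<Sum>a<m. if a = j then 1 else 0)"
        unfolding sqnorm_def by (intro sum.cong) (auto simp: unit_vec_def)
      also have "\<dots> = 1" using ij by simp
      finally show ?thesis by (simp add: power_le_one_iff)
    qed
    then have bd: "\<And>z. z \<in> unit_disc - ?K \<Longrightarrow> cmod (G z $$ (i, j)) \<le> 1" unfolding U .
    have hol: "(\<lambda>w. G w $$ (i, j)) holomorphic_on unit_disc - ?K"
      unfolding U by (rule G_hol[OF ij])
    obtain g where "g holomorphic_on unit_disc" "\<And>w. w \<in> unit_disc - ?K \<Longrightarrow> g w = G w $$ (i, j)"
      using holomorphic_extend_bounded_sparse[OF open_ball K hol bd] by blast
    then show ?thesis unfolding U by blast
  qed
  then obtain g where g_hol: "\<And>i j. i < m \<Longrightarrow> j < m \<Longrightarrow> g i j holomorphic_on unit_disc"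
    and g_eq: "\<And>i j w. i < m \<Longrightarrow> j < m \<Longrightarrow> w \<in> ?U \<Longrightarrow> g i j w = G w $$ (i, j)"
    by metis
  \<comment> \<open>At the points where \<open>f\<close> is not holomorphic the contraction property
    follows by continuity.\<close>
  have g_contr: "(\<Sum>i<m. (cmod (\<Sum>j<m. g i j w * v j))\<^sup>2) \<le> (\<Sum>j<m. (cmod (v j))\<^sup>2)" if "w \<in> unit_disc" for w v
  proof (rule continuous_le_off_sparse[OF _ _ open_ball K that])
    show "continuous_on unit_disc (\<lambda>w. \<Sum>i<m. (cmod (\<Sum>j<m. g i j w * v j))\<^sup>2)"
      by (intro continuous_intros holomorphic_on_imp_continuous_on g_hol) auto
    show "continuous_on unit_disc (\<lambda>w. \<Sum>j<m. (cmod (v j))\<^sup>2)" by (intro continuous_intros)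
    fix w assume "w \<in> unit_disc - ?K"
    then have w: "w \<in> ?U" by (simp add: U)
    have "(G w *\<^sub>v vec m v) $ i = (\<Sum>j<m. g i j w * v j)" if "i < m" for i
      using that G_car[OF w] by (simp add: g_eq[OF _ _ w] scalar_prod_def atLeast0LessThan)
    moreover have "dim_row (G w) = m" using G_car[OF w] by simp
    ultimately show "(\<Sum>i<m. (cmod (\<Sum>j<m. g i j w * v j))\<^sup>2) \<le> (\<Sum>j<m. (cmod (v j))\<^sup>2)"
      using G_contr[OF w, of "vec m v"] by (simp add: sqnorm_def)
  qed
  define Gs where "Gs = Abs_fps (\<lambda>k. emb m False (mat m m (\<lambda>(i, j). fps_nth (fps_expansion (g i j) 0) k)))"
  let ?g = "\<lambda>w. mat m m (\<lambda>(i, j). g i j w)"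
  have "mexp m ?g Gs"
  proof (rule mexpI)
    fix i j assume ij: "i < m" "j < m"
    then have "ent m Gs i j = fps_expansion (g i j) 0"
      by (intro fps_ext) (simp add: Gs_def comp_emb)
    then show "(\<lambda>w. ?g w $$ (i, j)) has_fps_expansion ent m Gs i j"
      using ij holomorphic_imp_has_fps_expansion[OF g_hol[OF ij]] by simp
  qed simp
  moreover have D_exp: "mexp m D (fps_const PP + fps_const Q * ?f)"
    unfolding D_def by (intro mexp_add mexp_mult mexp_const mexp_f) (simp_all add: comp_PP comp_Q)
  ultimately have 1: "mexp m (\<lambda>w. ?g w * D w) (Gs * (fps_const PP + fps_const Q * ?f))"
    by (rule mexp_mult)
  have 2: "mexp m Nm (fps_const PP * ?f + fps_const Q)"
    unfolding Nm_def by (intro mexp_add mexp_mult mexp_const mexp_f) (simp_all add: comp_PP comp_Q)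
  have "mexp m Nm (Gs * (fps_const PP + fps_const Q * ?f))"
  proof (rule mexp_cong[OF 1])
    show "eventually (\<lambda>w. ?g w * D w = Nm w) (nhds 0)"
    proof (rule eventually_mono[OF eventually_nhds_in_open[OF open_hol_pts U0]])
      fix w assume w: "w \<in> ?U"
      have "?g w = G w" using G_car[OF w] w by (intro eq_matI) (auto simp: g_eq)
      then show "?g w * D w = Nm w" using GD[OF w] by simp
    qed
  qed (rule mexpD(1)[OF 2])
  note * = mexp_unique[OF this 2]
  \<comment> \<open>The comparison of expansions settles size \<open>m\<close>; in the other sizes
    \<open>Gs\<close>, the series of \<open>f\<close> and \<open>Q\<close> are all zero.\<close>
  have Gs_eq: "Gs * (fps_const PP + fps_const Q * ?f) = fps_const PP * ?f + fps_const Q"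
  proof (intro fps_ext matfam_eqI)
    fix k l
    show "comp (fps_nth (Gs * (fps_const PP + fps_const Q * ?f)) k) l = comp (fps_nth (fps_const PP * ?f + fps_const Q) k) l"
    proof (cases "l = m")
      case False
      have z: "comp (fps_nth Gs k) l = 0\<^sub>m l l" "comp (fps_nth ?f k) l = 0\<^sub>m l l" "comp Q l = 0\<^sub>m l l" for k
        using False by (simp_all add: Gs_def taylor_fps_def comp_emb comp_Q)
      have "comp (fps_nth (Gs * X) k) l = 0\<^sub>m l l" for X
        by (rule eq_matI) (simp_all add: fps_mult_nth comp_sum_index z)
      then show ?thesis using z by (simp add: if_distrib[of "\<lambda>x. comp x l"])
    qed (use * in simp)
  qed
  show "potapov ?f"
    unfolding potapov_def
  proof (intro allI)
    fix b N
    \<comment> \<open>This is the positive component of the graph point of \<open>b\<close>, and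
      \<open>Gs\<close> maps it to the negative component, so \<open>form_eq\<close> gives the form
      of the pair.\<close>
    define c where "c = (fps_const PP + fps_const Q * ?f) * b"
    have "Gs * c = (fps_const PP * ?f + fps_const Q) * b"
      unfolding c_def by (simp only: Gs_eq mult.assoc[symmetric])
    then have "fps_nth (Gs * c) k = PP * fps_nth (?f * b) k + Q * fps_nth b k" for k
      by (simp add: distrib_right mult.assoc)
    moreover have "fps_nth c k = PP * fps_nth b k + Q * fps_nth (?f * b) k" for k
      by (simp add: c_def distrib_right mult.assoc)
    ultimately have "(\<Sum>k\<le>N. form (fps_nth b k) (fps_nth (?f * b) k))
      = (\<Sum>k\<le>N. mstar (fps_nth c k) * fps_nth c k - mstar (fps_nth (Gs * c) k) * fps_nth (Gs * c) k)"
      unfolding form_eq by simp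
    then show "mpos (\<Sum>k\<le>N. form (fps_nth b k) (fps_nth (?f * b) k))"
      using toeplitz_contractive[where m = m and g = g and N = N and c = c] g_hol g_contr unfolding Gs_def by simp
  qed
qed

end

section \<open>Schur functions from contractive Taylor coefficients\<close>

text \<open>The weighted sums satisfy \<open>T (Suc N) = q * T N + d (Suc N)\<close>. Since
  \<open>T N\<close> is nonpositive and \<open>q\<close> is at most 1, a positive limit of
  \<open>d\<close> would make \<open>T\<close> grow by at least \<open>D / 2\<close> at every late
  step and become positive.\<close>

lemma weighted_sum_limit_nonpos:
  fixes d :: "nat \<Rightarrow> real"
  assumes le: "\<And>N. (\<Sum>k\<le>N. q ^ (N - k) * d k) \<le> 0" and q: "0 \<le> q" "q \<le> 1" and d: "d \<longlonglongrightarrow> D"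
  shows "D \<le> 0"
proof (rule ccontr)
  assume "\<not> D \<le> 0"
  define T where "T N = (\<Sum>k\<le>N. q ^ (N - k) * d k)" for N
  have T: "T (Suc N) = q * T N + d (Suc N)" for N
    by (simp add: T_def Suc_diff_le sum_distrib_left mult.assoc)
  have "D / 2 < D" using \<open>\<not> D \<le> 0\<close> by simp
  with d have "eventually (\<lambda>k. D / 2 < d k) sequentially" by (rule order_tendstoD)
  then obtain K where K: "\<And>k. k \<ge> K \<Longrightarrow> D / 2 < d k" by (auto simp: eventually_sequentially)
  have "T K + real n * (D / 2) \<le> T (K + n)" for n
  proof (induction n)
    case (Suc n)
    have "(1 - q) * T (K + n) \<le> 0"
      using le[of "K + n"] q by (intro mult_nonneg_nonpos) (auto simp: T_def)
    then have "T (K + n) \<le> q * T (K + n)" by (simp add: algebra_simps)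
    then have "T (K + n) + D / 2 \<le> T (K + Suc n)" using K[of "K + Suc n"] by (simp add: T)
    moreover have "real (Suc n) * (D / 2) = real n * (D / 2) + D / 2" by (simp add: field_simps)
    ultimately show ?case using Suc.IH by linarith
  qed simp
  moreover have "T N \<le> 0" for N using le by (simp add: T_def)
  ultimately have *: "T K + real n * (D / 2) \<le> 0" for n by (meson order_trans)
  obtain n where "- T K / (D / 2) < real n" using reals_Archimedean2 by blast
  then have "- T K < real n * (D / 2)" using \<open>\<not> D \<le> 0\<close> by (subst (asm) pos_divide_less_eq) auto
  with *[of n] show False by linarith
qed

text \<open>Unit impulses bound the coefficients by 1, so the series converges in the disc. For the
  pointwise bound at \<open>w\<close>, geometric inputs make the partial sums of the value at
  \<open>w\<close> visible in the Toeplitz outputs, and the weighted limit lemma passes to the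
  limit.\<close>

lemma schur_from_coeffs:
  fixes S :: "matfam fps"
  assumes contr: "\<And>N q. mpos (\<Sum>k\<le>N. mstar (fps_nth q k) * fps_nth q k
      - mstar (fps_nth (S * q) k) * fps_nth (S * q) k)" and m: "m \<ge> 1"
  shows "\<exists>Sf \<in> schur_class m. mexp m Sf S"
proof -
  define s where "s a i j = comp (fps_nth S a) m $$ (i, j)" for a i j
  have T: "(\<Sum>k\<le>N. \<Sum>i<m. (cmod (\<Sum>a\<le>k. \<Sum>j<m. s a i j * x (k - a) j))\<^sup>2) \<le> (\<Sum>k\<le>N. \<Sum>j<m. (cmod (x k j))\<^sup>2)"
    for N and x :: "nat \<Rightarrow> nat \<Rightarrow> complex"
  proof -
    \<comment> \<open>Vectors enter the ring as the first column of a square matrix; column 0 exists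
      because \<open>m\<close> is positive.\<close>
    define q where "q = Abs_fps (\<lambda>k. emb m False (mat m m (\<lambda>(i, j). if j = 0 then x k i else 0)))"
    have q: "comp (fps_nth q k) m = mat m m (\<lambda>(i, j). if j = 0 then x k i else 0)" for k
      by (simp add: q_def comp_emb)
    have e: "(comp y m *\<^sub>v unit_vec m 0) $ i = comp y m $$ (i, 0)" if "i < m" for y i
      using that m by simp
    have 1: "sqnorm (comp (fps_nth q k) m *\<^sub>v unit_vec m 0) = (\<Sum>j<m. (cmod (x k j))\<^sup>2)" for k
      unfolding sqnorm_def using m by (intro sum.cong) (auto simp: e q)
    have 2: "sqnorm (comp (fps_nth (S * q) k) m *\<^sub>v unit_vec m 0)
        = (\<Sum>i<m. (cmod (\<Sum>a\<le>k. \<Sum>j<m. s a i j * x (k - a) j))\<^sup>2)" for k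
      unfolding sqnorm_def
    proof (intro sum.cong)
      fix i assume i: "i \<in> {..<m}"
      have "comp (fps_nth (S * q) k) m $$ (i, 0) = (\<Sum>a\<le>k. \<Sum>j<m. s a i j * x (k - a) j)"
        using i m by (simp add: fps_mult_nth comp_sum_index scalar_prod_def q s_def atLeast0LessThan atLeast0AtMost)
      then show "(cmod ((comp (fps_nth (S * q) k) m *\<^sub>v unit_vec m 0) $ i))\<^sup>2
          = (cmod (\<Sum>a\<le>k. \<Sum>j<m. s a i j * x (k - a) j))\<^sup>2"
        using e i by simp
    qed simp
    have "unit_vec m 0 \<in> carrier_vec m" by simp
    then show ?thesis
      using contr[of q N] unfolding mpos_def psd_sum_squares_diff_iff 1[symmetric] 2[symmetric] by blast
  qed
  have bound: "cmod (s k i j) \<le> 1" if ij: "i < m" "j < m" for k i j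
  proof -
    \<comment> \<open>A unit impulse in direction \<open>j\<close> at time 0 returns column
      \<open>j\<close> of every coefficient.\<close>
    let ?x = "\<lambda>l b. if l = 0 \<and> b = j then 1 else (0 :: complex)"
    have x: "(\<Sum>a\<le>l. \<Sum>b<m. s a c b * ?x (l - a) b) = s l c j" for l c
    proof -
      have "(\<Sum>a\<le>l. \<Sum>b<m. s a c b * ?x (l - a) b) = (\<Sum>a\<le>l. if a = l then s a c j else 0)"
      proof (rule sum.cong[OF refl])
        fix a assume "a \<in> {..l}"
        then have "(\<Sum>b<m. s a c b * ?x (l - a) b) = (\<Sum>b<m. if b = j then (if a = l then s a c j else 0) else 0)"
          by (intro sum.cong) auto
        also have "\<dots> = (if a = l then s a c j else 0)" using ij by simp
        finally show "(\<Sum>b<m. s a c b * ?x (l - a) b) = (if a = l then s a c j else 0)" .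
      qed
      then show ?thesis by simp
    qed
    have "(\<Sum>l\<le>k. \<Sum>b<m. (cmod (?x l b))\<^sup>2) = (\<Sum>l\<le>k. if l = 0 then 1 else 0)"
    proof (rule sum.cong[OF refl])
      fix l
      have "(\<Sum>b<m. (cmod (?x l b))\<^sup>2) = (\<Sum>b<m. if b = j then (if l = 0 then 1 else 0) else 0)"
        by (intro sum.cong) auto
      then show "(\<Sum>b<m. (cmod (?x l b))\<^sup>2) = (if l = 0 then 1 else 0)" using ij by simp
    qed
    then have "(\<Sum>l\<le>k. \<Sum>c<m. (cmod (s l c j))\<^sup>2) \<le> 1"
      using T[where N = k and x = ?x] unfolding x by simp
    moreover have "(cmod (s k i j))\<^sup>2 \<le> (\<Sum>c<m. (cmod (s k c j))\<^sup>2)"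
      using ij by (intro member_le_sum[of i "{..<m}" "\<lambda>c. (cmod (s k c j))\<^sup>2"]) auto
    moreover have "(\<Sum>c<m. (cmod (s k c j))\<^sup>2) \<le> (\<Sum>l\<le>k. \<Sum>c<m. (cmod (s l c j))\<^sup>2)"
      by (intro member_le_sum[of k "{..k}" "\<lambda>l. \<Sum>c<m. (cmod (s l c j))\<^sup>2"]) (auto intro: sum_nonneg)
    ultimately have "(cmod (s k i j))\<^sup>2 \<le> 1" by linarith
    then show ?thesis by (simp add: power_le_one_iff)
  qed
  have rad: "1 \<le> fps_conv_radius (ent m S i j)" if ij: "i < m" "j < m" for i j
    unfolding fps_conv_radius_def
  proof (rule conv_radius_geI_ex')
    fix r :: real assume r: "0 < r" "ereal r < 1"
    show "summable (\<lambda>n. fps_nth (ent m S i j) n * of_real r ^ n)"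
    proof (rule summable_comparison_test')
      show "summable (\<lambda>n. r ^ n)" using r by (intro summable_geometric) auto
      show "norm (fps_nth (ent m S i j) n * of_real r ^ n) \<le> r ^ n" if "n \<ge> 0" for n
        using bound[OF ij, of n] r by (simp add: s_def norm_mult norm_power mult_left_le_one_le)
    qed
  qed
  define Sf where "Sf w = mat m m (\<lambda>(i, j). eval_fps (ent m S i j) w)" for w
  have Sf_carrier: "Sf w \<in> carrier_mat m m" for w unfolding Sf_def by (rule mat_carrier)
  have sums: "(\<lambda>a. s a i j * w ^ a) sums (Sf w $$ (i, j))" if "i < m" "j < m" "w \<in> unit_disc" for i j w
  proof -
    have "ereal (norm w) < 1" using that(3) by simp
    then have "ereal (norm w) < fps_conv_radius (ent m S i j)"
      using rad[OF that(1,2)] by (rule less_le_trans)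
    from sums_eval_fps[OF this] show ?thesis using that by (simp add: Sf_def s_def)
  qed
  have n1: "norm_le_one (Sf w)" if w: "w \<in> unit_disc" for w
    unfolding norm_le_one_def
  proof
    fix v :: "complex vec" assume "v \<in> carrier_vec (dim_col (Sf w))"
    then have v: "v \<in> carrier_vec m" by (simp add: Sf_def)
    define q where "q = (cmod w)\<^sup>2"
    have q: "0 \<le> q" "q \<le> 1" using w by (auto simp: q_def power_le_one)
    define t where "t k i = (\<Sum>a\<le>k. w ^ a * (\<Sum>j<m. s a i j * v $ j))" for k i
    define d where "d k = (\<Sum>i<m. (cmod (t k i))\<^sup>2) - sqnorm v" for k
    have "(\<lambda>k. t k i) \<longlonglongrightarrow> (Sf w *\<^sub>v v) $ i" if i: "i < m" for i
    proof -
      have "(\<lambda>a. \<Sum>j<m. s a i j * w ^ a * v $ j) sums (\<Sum>j<m. Sf w $$ (i, j) * v $ j)"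
        using i w by (intro sums_sum sums_mult2 sums) auto
      then have "(\<lambda>k. \<Sum>a\<le>k. \<Sum>j<m. s a i j * w ^ a * v $ j) \<longlonglongrightarrow> (\<Sum>j<m. Sf w $$ (i, j) * v $ j)"
        by (simp add: sums_def_le)
      moreover have "(\<Sum>j<m. Sf w $$ (i, j) * v $ j) = (Sf w *\<^sub>v v) $ i"
        using i v by (simp add: scalar_prod_def Sf_def atLeast0LessThan)
      moreover have "(\<lambda>k. \<Sum>a\<le>k. \<Sum>j<m. s a i j * w ^ a * v $ j) = (\<lambda>k. t k i)"
        by (simp add: t_def sum_distrib_left mult_ac)
      ultimately show ?thesis by simp
    qed
    then have lim: "d \<longlonglongrightarrow> (\<Sum>i<m. (cmod ((Sf w *\<^sub>v v) $ i))\<^sup>2) - sqnorm v"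
      unfolding d_def by (intro tendsto_intros) auto
    have nonpos: "(\<Sum>k\<le>N. q ^ (N - k) * d k) \<le> 0" for N
    proof -
      \<comment> \<open>Powers of \<open>w\<close> descending with \<open>l\<close> make output
        \<open>k\<close> equal to \<open>w ^ (N - k)\<close> times the partial sum
        \<open>t k\<close>; the common weight in the inequality is thus
        \<open>q ^ (N - k)\<close>.\<close>
      let ?x = "\<lambda>l j. w ^ (N - l) * v $ j"
      have "(cmod (\<Sum>a\<le>k. \<Sum>j<m. s a i j * ?x (k - a) j))\<^sup>2 = q ^ (N - k) * (cmod (t k i))\<^sup>2" if "k \<le> N" for k i
      proof -
        have "(\<Sum>a\<le>k. \<Sum>j<m. s a i j * ?x (k - a) j) = w ^ (N - k) * t k i"
          unfolding t_def sum_distrib_left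
        proof (intro sum.cong refl)
          fix a j assume "a \<in> {..k}"
          then have "N - (k - a) = (N - k) + a" using that by auto
          then show "s a i j * (w ^ (N - (k - a)) * v $ j) = w ^ (N - k) * (w ^ a * (s a i j * v $ j))"
            by (simp add: power_add mult_ac)
        qed
        then show ?thesis by (simp add: norm_mult norm_power power_mult_distrib q_def power_mult[symmetric] mult.commute)
      qed
      moreover have "(\<Sum>j<m. (cmod (?x k j))\<^sup>2) = q ^ (N - k) * sqnorm v" for k
        using v by (simp add: sqnorm_def norm_mult norm_power power_mult_distrib q_def power_mult[symmetric] mult.commute sum_distrib_left)
      ultimately have "(\<Sum>k\<le>N. \<Sum>i<m. q ^ (N - k) * (cmod (t k i))\<^sup>2) \<le> (\<Sum>k\<le>N. q ^ (N - k) * sqnorm v)"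
        using T[where N = N and x = ?x] by simp
      then show ?thesis
        by (simp add: d_def right_diff_distrib sum_subtractf sum_distrib_left)
    qed
    have "(\<Sum>i<m. (cmod ((Sf w *\<^sub>v v) $ i))\<^sup>2) - sqnorm v \<le> 0"
      by (rule weighted_sum_limit_nonpos[OF nonpos q lim])
    then show "vnorm (Sf w *\<^sub>v v) \<le> vnorm v"
      by (simp add: vnorm_le_iff) (simp add: sqnorm_def Sf_def)
  qed
  have holo: "mat_holomorphic_on m Sf unit_disc"
    unfolding mat_holomorphic_on_def
  proof (intro allI impI)
    fix i j assume ij: "i < m" "j < m"
    have "unit_disc \<subseteq> eball 0 (fps_conv_radius (ent m S i j))"
      using rad[OF ij] by (intro ball_eball_mono) (simp add: one_ereal_def)
    then have "eval_fps (ent m S i j) holomorphic_on unit_disc" by (rule holomorphic_on_eval_fps)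
    then show "(\<lambda>w. Sf w $$ (i, j)) holomorphic_on unit_disc" using ij by (simp add: Sf_def)
  qed
  have "Sf \<in> schur_class m"
    unfolding schur_class_def mem_Collect_eq
  proof (intro conjI ballI)
    fix w :: complex assume "w \<in> unit_disc"
    then show "norm_le_one (Sf w)" by (rule n1)
    show "Sf w \<in> carrier_mat m m" by (rule Sf_carrier)
  next
    show "mat_holomorphic_on m Sf unit_disc" by (rule holo)
  qed
  moreover have "mexp m Sf S"
  proof (rule mexpI)
    fix i j assume ij: "i < m" "j < m"
    have "0 < fps_conv_radius (ent m S i j)" using rad[OF ij] by (rule less_le_trans[rotated]) simp
    then have "eval_fps (ent m S i j) has_fps_expansion ent m S i j" by (rule eval_fps_has_fps_expansion)
    then show "(\<lambda>w. Sf w $$ (i, j)) has_fps_expansion ent m S i j" using ij by (simp add: Sf_def)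
  qed (rule Sf_carrier)
  ultimately show ?thesis by (intro bexI[of _ Sf])
qed

section \<open>Block matrices\<close>

text \<open>Blocks are taken as ring elements so that block Toeplitz products can be compared with
  convolutions of series coefficients. Single block columns and rows have the second or first index
  0.\<close>

definition block :: "nat \<Rightarrow> complex mat \<Rightarrow> nat \<Rightarrow> nat \<Rightarrow> matfam" where
  "block m M i j = emb m False (mat m m (\<lambda>(a, b). M $$ (i * m + a, j * m + b)))"

lemma comp_block: "comp (block m M i j) k
    = (if k = m then mat m m (\<lambda>(a, b). M $$ (i * m + a, j * m + b)) else 0\<^sub>m k k)"
  by (simp add: block_def comp_emb)

lemma block_index_less: "i < K \<Longrightarrow> a < m \<Longrightarrow> i * m + a < K * (m::nat)"
proof -
  assume "i < K" "a < m"
  then have "i * m + a < Suc i * m" by simp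
  also have "\<dots> \<le> K * m" using \<open>i < K\<close> by (intro mult_le_mono1) simp
  finally show ?thesis .
qed

lemma sum_blocks: "(\<Sum>c<K * m. g c) = (\<Sum>l<K. \<Sum>b<m. g (l * m + b))"
  for g :: "nat \<Rightarrow> complex"
proof -
  have "(\<Sum>c<K * m. g c) = (\<Sum>l<K. sum g {l * m..<l * m + m})"
    by (rule sum.nat_group[symmetric])
  also have "\<dots> = (\<Sum>l<K. \<Sum>b<m. g (l * m + b))"
  proof (rule sum.cong[OF refl])
    fix l
    show "sum g {l * m..<l * m + m} = (\<Sum>b<m. g (l * m + b))"
      by (rule sum.reindex_bij_witness[of _ "\<lambda>b. l * m + b" "\<lambda>c. c - l * m"]) auto
  qed
  finally show ?thesis .
qed

lemma emb_False_eqI: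
  assumes "\<And>k. k \<noteq> m \<Longrightarrow> comp y k = 0\<^sub>m k k" "A \<in> carrier_mat m m"
    and "\<And>a b. a < m \<Longrightarrow> b < m \<Longrightarrow> A $$ (a, b) = comp y m $$ (a, b)"
  shows "emb m False A = y"
proof (rule matfam_eqI)
  fix k show "comp (emb m False A) k = comp y k"
    using assms by (cases "k = m") (auto simp: comp_emb intro!: eq_matI)
qed

lemma comp_sum_zero: "(\<And>i. i \<in> I \<Longrightarrow> comp (g i) k = 0\<^sub>m k k) \<Longrightarrow> comp (sum g I) k = 0\<^sub>m k k"
  by (induction I rule: infinite_finite_induct) auto

lemma block_mult:
  assumes "M \<in> carrier_mat (K * m) (L * m)" "N \<in> carrier_mat (L * m) (H * m)" "i < K" "j < H"
  shows "block m (M * N) i j = (\<Sum>l<L. block m M i l * block m N l j)"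
  unfolding block_def[of m "M * N"]
proof (rule emb_False_eqI)
  fix a b assume ab: "a < m" "b < m"
  have "(M * N) $$ (i * m + a, j * m + b) = (\<Sum>c<L * m. M $$ (i * m + a, c) * N $$ (c, j * m + b))"
    using assms ab block_index_less by (auto simp: scalar_prod_def atLeast0LessThan)
  also have "\<dots> = (\<Sum>l<L. \<Sum>c<m. M $$ (i * m + a, l * m + c) * N $$ (l * m + c, j * m + b))"
    by (rule sum_blocks)
  also have "\<dots> = comp (\<Sum>l<L. block m M i l * block m N l j) m $$ (a, b)"
    using ab by (simp add: comp_sum_index comp_block scalar_prod_def atLeast0LessThan)
  finally show "mat m m (\<lambda>(a, b). (M * N) $$ (i * m + a, j * m + b)) $$ (a, b)
      = comp (\<Sum>l<L. block m M i l * block m N l j) m $$ (a, b)"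
    using ab by simp
qed (auto intro!: comp_sum_zero simp: comp_block)

lemma block_add:
  assumes "M \<in> carrier_mat (K * m) (L * m)" "N \<in> carrier_mat (K * m) (L * m)" "i < K" "j < L"
  shows "block m (M + N) i j = block m M i j + block m N i j"
  unfolding block_def[of m "M + N"] using assms block_index_less
  by (intro emb_False_eqI) (auto simp: comp_block)

lemma block_adjoint:
  assumes "M \<in> carrier_mat (K * m) (L * m)" "i < L" "j < K"
  shows "block m (mat_adjoint M) i j = mstar (block m M j i)"
  unfolding block_def[of m "mat_adjoint M"] using assms block_index_less
  by (intro emb_False_eqI) (auto simp: comp_block)

lemma block_single: "A \<in> carrier_mat m m \<Longrightarrow> block m A 0 0 = emb m False A"
  unfolding block_def by (intro emb_False_eqI) (auto simp: comp_emb)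

lemma block_Toeplitz:
  assumes "\<And>l. l \<le> k \<Longrightarrow> A l \<in> carrier_mat m m" "i < Suc k" "j < Suc k"
  shows "block m (S_mat m A k) i j = (if j \<le> i then emb m False (A (i - j)) else 0)"
  unfolding block_def S_mat_def using assms block_index_less[of i "Suc k" _ m] block_index_less[of j "Suc k" _ m]
  by (intro emb_False_eqI) (auto simp: comp_emb)

lemma block_Jblk:
  assumes "J \<in> carrier_mat m m" "i < Suc k" "j < Suc k"
  shows "block m (Jblk m J k) i j = (if i = j then emb m False J else 0)"
  unfolding block_def Jblk_def using assms block_index_less[of i "Suc k" _ m] block_index_less[of j "Suc k" _ m]
  by (intro emb_False_eqI) (auto simp: comp_emb)

lemma block_y_vec:
  assumes "A (Suc i) \<in> carrier_mat m m" "i < k"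
  shows "block m (y_vec m A k) i 0 = emb m False (A (Suc i))"
  unfolding block_def y_vec_def using assms block_index_less[of i k _ m]
  by (intro emb_False_eqI) (auto simp: comp_emb)

lemma block_z_vec:
  assumes "A (k - j) \<in> carrier_mat m m" "j < k"
  shows "block m (z_vec m A k) 0 j = emb m False (A (k - j))"
  unfolding block_def z_vec_def using assms block_index_less[of j k _ m]
  by (intro emb_False_eqI) (auto simp: comp_emb)

text \<open>With U = y + S V the condition Q V = S* J y becomes J V = S* J U, and y = P J U. Hence no
  generalised inverse is left in the Schur complement.\<close>

lemma range_reduction:
  fixes S Jb y V :: "complex mat"
  assumes S: "S \<in> carrier_mat N N" and Jb: "Jb \<in> carrier_mat N N" "mat_adjoint Jb = Jb" "Jb * Jb = 1\<^sub>m N"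
    and y: "y \<in> carrier_mat N k" and V: "V \<in> carrier_mat N k"
    and eq: "(Jb - mat_adjoint S * Jb * S) * V = mat_adjoint S * Jb * y"
  defines "U \<equiv> y + S * V" and "P \<equiv> Jb - S * Jb * mat_adjoint S"
  shows "Jb * V = mat_adjoint S * Jb * U"
    and "mat_adjoint y * mp_inv P * y = mat_adjoint y * Jb * U"
    and "mat_adjoint (mat_adjoint y * mp_inv P * y) = mat_adjoint y * mp_inv P * y"
proof -
  let ?S' = "mat_adjoint S"
  have d: "dim_row S = N" "dim_col S = N" "dim_row Jb = N" "dim_col Jb = N" "dim_row y = N" "dim_col y = k"
    "dim_row V = N" "dim_col V = k" using S Jb y V by auto
  have U: "U \<in> carrier_mat N k" using y V S unfolding U_def by (intro add_carrier_mat) simp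
  have c: "?S' * Jb * S \<in> carrier_mat N N" "S * Jb * ?S' \<in> carrier_mat N N" by (simp_all add: d)
  have "Jb * V - ?S' * Jb * S * V = ?S' * Jb * y"
    using eq minus_mult_distrib_mat[OF Jb(1) c(1) V] by simp
  then have "Jb * V - ?S' * Jb * S * V + ?S' * Jb * S * V = ?S' * Jb * y + ?S' * Jb * S * V"
    by simp
  moreover have "Jb * V - ?S' * Jb * S * V + ?S' * Jb * S * V = Jb * V"
    by (rule eq_matI) (simp_all add: d del: index_mult_mat(1))
  moreover have "?S' * Jb * U = ?S' * Jb * y + ?S' * Jb * (S * V)"
    unfolding U_def using S Jb y V by (intro mult_add_distrib_mat[of _ N N _ k]) (auto simp: d)
  moreover have "?S' * Jb * (S * V) = ?S' * Jb * S * V" by (simp add: mat_mult_assoc d)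
  ultimately show 1: "Jb * V = ?S' * Jb * U" by simp
  have P: "P \<in> carrier_mat N N" unfolding P_def using c(2) by (rule minus_carrier_mat)
  have P_adj: "mat_adjoint P = P"
    unfolding P_def mat_adjoint_minus[OF Jb(1) c(2)] Jb(2) by (simp add: mat_adjoint_mult d Jb(2) mat_mult_assoc)
  have JU: "Jb * U \<in> carrier_mat N k" using U by (simp add: d)
  have "P * (Jb * U) = Jb * (Jb * U) - S * Jb * ?S' * (Jb * U)"
    unfolding P_def by (rule minus_mult_distrib_mat[OF Jb(1) c(2) JU])
  also have "Jb * (Jb * U) = U"
    using U Jb by (simp add: mat_mult_assoc[symmetric] d)
  also have "S * Jb * ?S' * (Jb * U) = S * Jb * (?S' * Jb * U)"
    using U by (simp add: mat_mult_assoc d)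
  also have "\<dots> = S * (Jb * (Jb * V))" by (simp add: 1[symmetric] mat_mult_assoc d)
  also have "Jb * (Jb * V) = V" using V Jb by (simp add: mat_mult_assoc[symmetric] d)
  also have "U - S * V = y" unfolding U_def
    by (rule eq_matI) (simp_all add: d del: index_mult_mat(1))
  finally have yP: "P * (Jb * U) = y" .
  then have y': "mat_adjoint y = mat_adjoint (Jb * U) * P"
    using P U by (metis P_adj mat_adjoint_mult carrier_matD JU)
  note mp = mp_inv_hermitian[OF P P_adj]
  have dd: "dim_row P = N" "dim_col P = N" "dim_row (mp_inv P) = N" "dim_col (mp_inv P) = N"
    "dim_row (Jb * U) = N" "dim_col (Jb * U) = k"
    using P mp(1) JU by auto
  have "mat_adjoint y * mp_inv P * y = mat_adjoint (Jb * U) * P * mp_inv P * (P * (Jb * U))"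
    by (simp only: y' yP)
  also have "\<dots> = mat_adjoint (Jb * U) * (P * mp_inv P * P) * (Jb * U)"
    using U by (simp add: mat_mult_assoc dd d)
  also have "\<dots> = mat_adjoint (Jb * U) * P * (Jb * U)" by (simp only: mp(2))
  finally have 2: "mat_adjoint y * mp_inv P * y = mat_adjoint (Jb * U) * P * (Jb * U)" .
  also have "\<dots> = mat_adjoint y * Jb * U"
    unfolding y'[symmetric] using U by (simp add: mat_mult_assoc d)
  finally show "mat_adjoint y * mp_inv P * y = mat_adjoint y * Jb * U" .
  have "mat_adjoint (mat_adjoint (Jb * U) * P * (Jb * U))
      = mat_adjoint (Jb * U) * (mat_adjoint P * mat_adjoint (mat_adjoint (Jb * U)))"
    using dd by (subst mat_adjoint_mult, simp, subst mat_adjoint_mult) simp_all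
  also have "\<dots> = mat_adjoint (Jb * U) * P * (Jb * U)"
    unfolding P_adj mat_adjoint_adjoint using dd by (intro mat_mult_assoc[symmetric]) simp_all
  finally show "mat_adjoint (mat_adjoint y * mp_inv P * y) = mat_adjoint y * mp_inv P * y"
    unfolding 2 .
qed

section \<open>The associated polynomials\<close>

lemma S_mat_carrier: "S_mat m A k \<in> carrier_mat (Suc k * m) (Suc k * m)"
  unfolding S_mat_def by (rule mat_carrier)

lemma Jblk_carrier: "Jblk m J k \<in> carrier_mat (Suc k * m) (Suc k * m)"
  unfolding Jblk_def by (rule mat_carrier)

lemma y_vec_carrier [simp]: "y_vec m A k \<in> carrier_mat (k * m) m"
  unfolding y_vec_def by (rule mat_carrier)

lemma z_vec_carrier [simp]: "z_vec m A k \<in> carrier_mat m (k * m)"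
  unfolding z_vec_def by (rule mat_carrier)

declare S_mat_carrier [simplified, simp] Jblk_carrier [simplified, simp]

lemma vec_dim [simp]:
  "dim_row (y_vec m A k) = k * m" "dim_col (y_vec m A k) = m"
  "dim_row (z_vec m A k) = m" "dim_col (z_vec m A k) = k * m"
  by (simp_all add: y_vec_def z_vec_def)

lemma vec_carrier_Suc [simp]:
  "y_vec m A (Suc k) \<in> carrier_mat (m + k * m) m" "z_vec m A (Suc k) \<in> carrier_mat m (m + k * m)"
  using y_vec_carrier[of m A "Suc k"] z_vec_carrier[of m A "Suc k"] unfolding mult_Suc .

lemma mod_div_less: "i < K * m \<Longrightarrow> i div m < K \<and> i mod m < (m::nat)"
  by (metis less_mult_imp_div_less mod_less_divisor mult_0_right not_less_zero neq0_conv)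

lemma Jblk_adjoint:
  assumes "J \<in> carrier_mat m m" "mat_adjoint J = J"
  shows "mat_adjoint (Jblk m J k) = Jblk m J k"
proof -
  have "cnj (J $$ (j, i)) = J $$ (i, j)" if "i < m" "j < m" for i j
    using that assms(1) arg_cong[OF assms(2), of "\<lambda>M. M $$ (i, j)"] by simp
  moreover have "i mod m < m" if "i < Suc k * m" for i
    using mod_div_less[OF that] by simp
  ultimately show ?thesis
    by (intro eq_matI) (auto simp: Jblk_def)
qed

lemma Jblk_square:
  assumes "J \<in> carrier_mat m m" "J * J = 1\<^sub>m m"
  shows "Jblk m J k * Jblk m J k = 1\<^sub>m (Suc k * m)"
proof (rule eq_matI)
  fix i j assume "i < dim_row (1\<^sub>m (Suc k * m) :: complex mat)" "j < dim_col (1\<^sub>m (Suc k * m) :: complex mat)"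
  then have ij: "i < Suc k * m" "j < Suc k * m" by auto
  note ij' = mod_div_less[OF ij(1)] mod_div_less[OF ij(2)]
  have "(Jblk m J k * Jblk m J k) $$ (i, j) = (\<Sum>c<Suc k * m. Jblk m J k $$ (i, c) * Jblk m J k $$ (c, j))"
    using ij by (simp add: scalar_prod_def atLeast0LessThan Jblk_def)
  also have "\<dots> = (\<Sum>l<Suc k. \<Sum>b<m. Jblk m J k $$ (i, l * m + b) * Jblk m J k $$ (l * m + b, j))"
    by (rule sum_blocks)
  also have "\<dots> = (\<Sum>l<Suc k. if l = i div m then
      (if i div m = j div m then \<Sum>b<m. J $$ (i mod m, b) * J $$ (b, j mod m) else 0) else 0)"
  proof (rule sum.cong[OF refl])
    fix l assume "l \<in> {..<Suc k}"
    then show "(\<Sum>b<m. Jblk m J k $$ (i, l * m + b) * Jblk m J k $$ (l * m + b, j))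
      = (if l = i div m then (if i div m = j div m then \<Sum>b<m. J $$ (i mod m, b) * J $$ (b, j mod m) else 0) else 0)"
      using ij block_index_less[of l "Suc k" _ m] by (auto simp: Jblk_def intro!: sum.neutral)
  qed
  also have "\<dots> = (if i div m = j div m then \<Sum>b<m. J $$ (i mod m, b) * J $$ (b, j mod m) else 0)"
    using ij' by simp
  also have "(\<Sum>b<m. J $$ (i mod m, b) * J $$ (b, j mod m)) = (J * J) $$ (i mod m, j mod m)"
    using assms(1) ij' by (simp add: scalar_prod_def atLeast0LessThan)
  also have "(if i div m = j div m then (J * J) $$ (i mod m, j mod m) else 0) = 1\<^sub>m (Suc k * m) $$ (i, j)"
    unfolding assms(2) using ij ij' by (auto simp: div_mod_decomp) (metis div_mult_mod_eq)
  finally show "(Jblk m J k * Jblk m J k) $$ (i, j) = 1\<^sub>m (Suc k * m) $$ (i, j)" .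
qed (simp_all add: Jblk_def)

text \<open>Unlike \<open>mexp\<close> this is an identity at every point together with a degree
  bound, so it yields the expansion, holomorphy everywhere and the reversed polynomial.\<close>

definition mpoly :: "nat \<Rightarrow> nat \<Rightarrow> (complex \<Rightarrow> complex mat) \<Rightarrow> matfam fps \<Rightarrow> bool" where
  "mpoly m n b B \<longleftrightarrow> fps_deg_le n B \<and> (\<forall>w. b w \<in> carrier_mat m m \<and>
    (\<forall>i<m. \<forall>j<m. b w $$ (i, j) = (\<Sum>k\<le>n. comp (fps_nth B k) m $$ (i, j) * w ^ k)))"

lemma mpolyD:
  assumes "mpoly m n b B"
  shows "fps_deg_le n B" "b w \<in> carrier_mat m m"
    "i < m \<Longrightarrow> j < m \<Longrightarrow> b w $$ (i, j) = (\<Sum>k\<le>n. comp (fps_nth B k) m $$ (i, j) * w ^ k)"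
  using assms by (auto simp: mpoly_def)

lemma mpoly_mexp:
  assumes b: "mpoly m n b B"
  shows "mexp m b B"
proof (rule mexpI)
  fix i j assume ij: "i < m" "j < m"
  have "ent m B i j = Abs_fps (\<lambda>k. if k \<le> n then comp (fps_nth B k) m $$ (i, j) else 0)"
    using ij fps_deg_leD[OF mpolyD(1)[OF b]] by (intro fps_ext) auto
  then show "(\<lambda>w. b w $$ (i, j)) has_fps_expansion ent m B i j"
    using fps_expansion_polynomial[where N = n and c = "\<lambda>k. comp (fps_nth B k) m $$ (i, j)"]
      mpolyD(3)[OF b ij] by (simp cong: if_cong)
qed (rule mpolyD(2)[OF b])

lemma mpoly_holomorphic:
  assumes b: "mpoly m n b B" and ij: "i < m" "j < m"
  shows "(\<lambda>w. b w $$ (i, j)) holomorphic_on U"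
  unfolding mpolyD(3)[OF b ij] by (intro holomorphic_intros)

lemma mpoly_taylor:
  assumes b: "mpoly m n b B"
  shows "taylor_coeff m b k = comp (fps_nth B k) m"
  using fps_nth_fps_expansion[OF mexpD(2)[OF mpoly_mexp[OF b]], of _ _ k]
  by (intro eq_matI) (auto simp: taylor_coeff_def)

text \<open>\<open>tilde\<close> is defined through Taylor coefficients at 0; for a polynomial these
  are its coefficients, so \<open>rev\<close> on series computes it.\<close>

lemma mpoly_tilde:
  assumes b: "mpoly m n b B"
  shows "mpoly m n (tilde m n b) (matfam.rev n B)"
  unfolding mpoly_def
proof (intro conjI allI impI)
  fix w i j assume ij: "i < m" "j < m"
  have "tilde m n b w $$ (i, j) = (\<Sum>k\<le>n. w ^ (n - k) * cnj (comp (fps_nth B k) m $$ (j, i)))"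
    using ij by (simp add: tilde_def mpoly_taylor[OF b])
  also have "\<dots> = (\<Sum>k\<le>n. comp (fps_nth (matfam.rev n B) k) m $$ (i, j) * w ^ k)"
    by (rule sum.reindex_bij_witness[of _ "\<lambda>k. n - k" "\<lambda>k. n - k"]) (use ij in auto)
  finally show "tilde m n b w $$ (i, j) = (\<Sum>k\<le>n. comp (fps_nth (matfam.rev n B) k) m $$ (i, j) * w ^ k)" .
qed (simp_all add: tilde_def matfam.rev_deg_le)

text \<open>The polynomial with constant coefficient c and higher coefficients g 0, ..., g (n - 1).\<close>

definition coeff_fps :: "nat \<Rightarrow> 'a::zero \<Rightarrow> (nat \<Rightarrow> 'a) \<Rightarrow> 'a fps" where
  "coeff_fps n c g = Abs_fps (\<lambda>i. case i of 0 \<Rightarrow> c | Suc l \<Rightarrow> if l < n then g l else 0)"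

lemma coeff_fps_nth: "fps_nth (coeff_fps n c g) i = (case i of 0 \<Rightarrow> c | Suc l \<Rightarrow> if l < n then g l else 0)"
  by (simp add: coeff_fps_def)

lemma coeff_fps_deg_le: "fps_deg_le n (coeff_fps n c g)"
  by (auto simp: fps_deg_le_def coeff_fps_nth split: nat.split)

lemma mpoly_coeff_fps:
  assumes "\<And>w. b w \<in> carrier_mat m m"
    and "\<And>w i j. i < m \<Longrightarrow> j < m \<Longrightarrow>
      b w $$ (i, j) = comp c m $$ (i, j) + w * (\<Sum>l<n. comp (g l) m $$ (i, j) * w ^ l)"
  shows "mpoly m n b (coeff_fps n c g)"
  unfolding mpoly_def
proof (intro conjI allI impI)
  fix w i j assume ij: "i < m" "j < m"
  have "(\<Sum>k\<le>n. comp (fps_nth (coeff_fps n c g) k) m $$ (i, j) * w ^ k)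
      = comp c m $$ (i, j) + (\<Sum>l<n. comp (g l) m $$ (i, j) * w ^ Suc l)"
    unfolding sum.atMost_shift by (auto simp: coeff_fps_nth intro!: sum.cong)
  also have "\<dots> = b w $$ (i, j)"
    using ij by (simp add: assms(2) sum_distrib_left mult_ac)
  finally show "b w $$ (i, j) = (\<Sum>k\<le>n. comp (fps_nth (coeff_fps n c g) k) m $$ (i, j) * w ^ k)" ..
qed (simp_all add: assms(1) coeff_fps_deg_le)

lemma e_row_mult_index:
  assumes V: "V \<in> carrier_mat (Suc k * m) m" and ij: "i < m" "j < m"
  shows "(e_row m k w * V) $$ (i, j) = (\<Sum>l<Suc k. comp (block m V l 0) m $$ (i, j) * w ^ l)"
proof -
  have "(e_row m k w * V) $$ (i, j) = (\<Sum>c<Suc k * m. e_row m k w $$ (i, c) * V $$ (c, j))"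
    using V ij by (simp add: scalar_prod_def atLeast0LessThan e_row_def)
  also have "\<dots> = (\<Sum>l<Suc k. \<Sum>b<m. e_row m k w $$ (i, l * m + b) * V $$ (l * m + b, j))"
    by (rule sum_blocks)
  also have "\<dots> = (\<Sum>l<Suc k. comp (block m V l 0) m $$ (i, j) * w ^ l)"
  proof (rule sum.cong[OF refl])
    fix l assume "l \<in> {..<Suc k}"
    then have "(\<Sum>b<m. e_row m k w $$ (i, l * m + b) * V $$ (l * m + b, j))
        = (\<Sum>b<m. if b = i then w ^ l * V $$ (l * m + i, j) else 0)"
      using ij block_index_less[of l "Suc k" _ m] by (intro sum.cong) (auto simp: e_row_def)
    then show "(\<Sum>b<m. e_row m k w $$ (i, l * m + b) * V $$ (l * m + b, j)) = comp (block m V l 0) m $$ (i, j) * w ^ l"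
      using ij by (simp add: comp_block)
  qed
  finally show ?thesis .
qed

text \<open>\<open>eps_col\<close> lists the powers in descending order, so the coefficient of index
  \<open>l\<close> comes from block \<open>k - l\<close>.\<close>

lemma mult_eps_col_index:
  assumes W: "W \<in> carrier_mat m (Suc k * m)" and ij: "i < m" "j < m"
  shows "(W * (w \<cdot>\<^sub>m eps_col m k w)) $$ (i, j) = w * (\<Sum>l<Suc k. comp (block m W 0 (k - l)) m $$ (i, j) * w ^ l)"
proof -
  have "(W * (w \<cdot>\<^sub>m eps_col m k w)) $$ (i, j) = (\<Sum>c<Suc k * m. W $$ (i, c) * (w * eps_col m k w $$ (c, j)))"
    using W ij by (simp add: scalar_prod_def atLeast0LessThan eps_col_def)
  also have "\<dots> = (\<Sum>l<Suc k. \<Sum>b<m. W $$ (i, l * m + b) * (w * eps_col m k w $$ (l * m + b, j)))"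
    by (rule sum_blocks)
  also have "\<dots> = (\<Sum>l<Suc k. w * (comp (block m W 0 l) m $$ (i, j) * w ^ (k - l)))"
  proof (rule sum.cong[OF refl])
    fix l assume "l \<in> {..<Suc k}"
    then have "(\<Sum>b<m. W $$ (i, l * m + b) * (w * eps_col m k w $$ (l * m + b, j)))
        = (\<Sum>b<m. if b = j then W $$ (i, l * m + j) * (w * w ^ (k - l)) else 0)"
      using ij block_index_less[of l "Suc k" _ m] by (intro sum.cong) (auto simp: eps_col_def)
    then show "(\<Sum>b<m. W $$ (i, l * m + b) * (w * eps_col m k w $$ (l * m + b, j)))
        = w * (comp (block m W 0 l) m $$ (i, j) * w ^ (k - l))"
      using ij by (simp add: comp_block)
  qed
  also have "\<dots> = w * (\<Sum>l<Suc k. comp (block m W 0 (k - l)) m $$ (i, j) * w ^ l)"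
    unfolding sum_distrib_left
    by (rule sum.reindex_bij_witness[of _ "\<lambda>l. k - l" "\<lambda>l. k - l"]) auto
  finally show ?thesis .
qed

lemma sum_if_le: "i < n \<Longrightarrow> (\<Sum>l<n. if l \<le> i then g l else 0) = (\<Sum>l=0..i. g l)"
  for i n :: nat and g :: "nat \<Rightarrow> 'a::comm_monoid_add"
  by (rule sum.mono_neutral_cong_right) auto

lemma sum_if_ge: "(\<Sum>l<n. if i \<le> l then g l else 0) = (\<Sum>l=i..<n. g l)"
  for i n :: nat and g :: "nat \<Rightarrow> 'a::comm_monoid_add"
  by (rule sum.mono_neutral_cong_right) auto

section \<open>Toeplitz conditions as conditions on series coefficients\<close>

context signature
begin

lemma J_block: "J * block m M i j = emb m False Jm * block m M i j"
  by (rule matfam_eqI) (auto simp: comp_J comp_block comp_emb J_mat)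

text \<open>In sizes other than \<open>m\<close> both sides are 1, which is why the left side is
  padded by the unit and \<open>A0\<close> and \<open>Z\<close> by zero.\<close>

lemma emb_schur_complement:
  assumes "A0 \<in> carrier_mat m m" "Z \<in> carrier_mat m m"
  shows "emb m True (Jm - mat_adjoint A0 * Jm * A0 - Z)
    = J - mstar (emb m False A0) * J * emb m False A0 - emb m False Z"
proof -
  have "Jm - mat_adjoint A0 * Jm * A0 - Z \<in> carrier_mat m m"
    using assms by (intro minus_carrier_mat)
  then show ?thesis
    using assms by (intro matfam_eqI) (auto simp: comp_J comp_emb intro!: eq_matI)
qed

text \<open>The block form of the condition defining \<open>Y_set\<close>; applied to adjoints it also covers
  \<open>Z_set\<close>, with the transposed Toeplitz matrix.\<close>

lemma block_conditions:
  fixes S y V :: "complex mat" and s yb :: "nat \<Rightarrow> nat \<Rightarrow> matfam"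
  assumes S: "S \<in> carrier_mat (Suc k * m) (Suc k * m)"
    and y: "y \<in> carrier_mat (Suc k * m) m" and V: "V \<in> carrier_mat (Suc k * m) m"
    and eq: "(Jblk m Jm k - mat_adjoint S * Jblk m Jm k * S) * V = mat_adjoint S * Jblk m Jm k * y"
  defines "U \<equiv> y + S * V"
  shows "i < Suc k \<Longrightarrow> J * block m V i 0 = (\<Sum>l<Suc k. mstar (block m S l i) * (J * block m U l 0))"
    and "i < Suc k \<Longrightarrow> block m U i 0 = block m y i 0 + (\<Sum>l<Suc k. block m S i l * block m V l 0)"
    and "emb m False (mat_adjoint y * mp_inv (Jblk m Jm k - S * Jblk m Jm k * mat_adjoint S) * y)
      = (\<Sum>l<Suc k. mstar (block m y l 0) * (J * block m U l 0))"
    and "mat_adjoint y * mp_inv (Jblk m Jm k - S * Jblk m Jm k * mat_adjoint S) * y \<in> carrier_mat m m"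
    and "mat_adjoint (mat_adjoint y * mp_inv (Jblk m Jm k - S * Jblk m Jm k * mat_adjoint S) * y)
      = mat_adjoint y * mp_inv (Jblk m Jm k - S * Jblk m Jm k * mat_adjoint S) * y"
proof -
  let ?N = "Suc k * m" and ?J = "Jblk m Jm k"
  note red = range_reduction[OF S Jblk_carrier Jblk_adjoint[OF J_mat(1,2)] Jblk_square[OF J_mat(1,3)] y V eq]
  have d: "dim_row S = ?N" "dim_col S = ?N" "dim_row ?J = ?N" "dim_col ?J = ?N" "dim_row y = ?N" "dim_col y = m"
    "dim_row V = ?N" "dim_col V = m" using S y V carrier_matD[OF Jblk_carrier[of m Jm k]] by auto
  have U: "U \<in> carrier_mat ?N m" using y V S unfolding U_def by (intro add_carrier_mat) (simp add: d)
  have dU: "dim_row U = ?N" "dim_col U = m" using U by auto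
  have JM: "block m (?J * M) l 0 = J * block m M l 0" if "M \<in> carrier_mat ?N m" "l < Suc k" for M l
  proof -
    have "block m (?J * M) l 0 = (\<Sum>c<Suc k. block m ?J l c * block m M c 0)"
      using that by (intro block_mult[where K = "Suc k" and H = 1]) auto
    also have "\<dots> = (\<Sum>c<Suc k. if c = l then emb m False Jm * block m M l 0 else 0)"
      using that by (intro sum.cong) (auto simp: block_Jblk[OF J_mat(1)])
    also have "\<dots> = J * block m M l 0" using that by (simp add: J_block)
    finally show ?thesis .
  qed
  show "J * block m V i 0 = (\<Sum>l<Suc k. mstar (block m S l i) * (J * block m U l 0))" if i: "i < Suc k"
  proof -
    have "J * block m V i 0 = block m (mat_adjoint S * (?J * U)) i 0"
      using JM[OF V i] red(1) by (simp add: U_def mat_mult_assoc d)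
    also have "\<dots> = (\<Sum>l<Suc k. block m (mat_adjoint S) i l * block m (?J * U) l 0)"
      using i S by (intro block_mult[where K = "Suc k" and H = 1]) (auto simp: d dU)
    also have "\<dots> = (\<Sum>l<Suc k. mstar (block m S l i) * (J * block m U l 0))"
      using i by (intro sum.cong refl) (auto simp: JM[OF U] block_adjoint[OF S])
    finally show ?thesis .
  qed
  show "block m U i 0 = block m y i 0 + (\<Sum>l<Suc k. block m S i l * block m V l 0)" if i: "i < Suc k"
  proof -
    have "block m U i 0 = block m y i 0 + block m (S * V) i 0"
      unfolding U_def using i y by (intro block_add[where K = "Suc k" and L = 1]) (auto simp: d)
    also have "block m (S * V) i 0 = (\<Sum>l<Suc k. block m S i l * block m V l 0)"
      using i S V by (intro block_mult[where K = "Suc k" and H = 1]) auto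
    finally show ?thesis .
  qed
  have e: "mat_adjoint y * mp_inv (?J - S * ?J * mat_adjoint S) * y = mat_adjoint y * (?J * U)"
    using red(2) by (simp add: U_def mat_mult_assoc d)
  show "mat_adjoint y * mp_inv (?J - S * ?J * mat_adjoint S) * y \<in> carrier_mat m m"
    unfolding e by (simp add: d dU)
  show "mat_adjoint (mat_adjoint y * mp_inv (?J - S * ?J * mat_adjoint S) * y)
      = mat_adjoint y * mp_inv (?J - S * ?J * mat_adjoint S) * y"
    using red(3) by (simp add: U_def)
  have "emb m False (mat_adjoint y * (?J * U)) = block m (mat_adjoint y * (?J * U)) 0 0"
    by (intro block_single[symmetric]) (simp add: d dU)
  also have "\<dots> = (\<Sum>l<Suc k. block m (mat_adjoint y) 0 l * block m (?J * U) l 0)"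
    using y by (intro block_mult[where K = 1 and H = 1]) (auto simp: d dU)
  also have "\<dots> = (\<Sum>l<Suc k. mstar (block m y l 0) * (J * block m U l 0))"
    using y by (intro sum.cong refl) (auto simp: JM[OF U] block_adjoint[where K = "Suc k" and L = 1])
  finally show "emb m False (mat_adjoint y * mp_inv (?J - S * ?J * mat_adjoint S) * y)
      = (\<Sum>l<Suc k. mstar (block m y l 0) * (J * block m U l 0))"
    unfolding e .
qed

text \<open>Read by block rows, \<open>U = y + S V\<close> is the interpolation condition
  \<open>f * rho = pi\<close> up to degree \<open>n\<close>, and the adjoint of
  \<open>J V = S* J U\<close> is the dual relation below degree \<open>n\<close>. The Schur
  complement in \<open>Rnext\<close> supplies the missing coefficient \<open>n\<close>. The left
  relations follow by applying the same block lemma to adjoints, with the order of blocks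
  reversed.\<close>

lemma interpolation:
  fixes V W :: "complex mat" and A :: "nat \<Rightarrow> complex mat"
  defines "a \<equiv> \<lambda>l. emb m False (A l)"
    and "U \<equiv> \<lambda>n. y_vec m A n + S_mat m A (n - 1) * V"
    and "U' \<equiv> \<lambda>n. W * S_mat m A (n - 1) + z_vec m A n"
  assumes f: "f \<in> P_J0_int m Jm n A"
    and V: "n \<ge> 1 \<Longrightarrow> V \<in> Y_set m Jm A n" and W: "n \<ge> 1 \<Longrightarrow> W \<in> Z_set m Jm A n"
  shows "potapov_interpolation mstar mpos PP (taylor_fps m f)
      (coeff_fps n 1 (\<lambda>l. block m V l 0)) (coeff_fps n (a 0) (\<lambda>l. block m (U n) l 0))
      (coeff_fps n (a 0) (\<lambda>l. block m (U' n) 0 (n - 1 - l))) (coeff_fps n 1 (\<lambda>l. block m W 0 (n - 1 - l)))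
      n (emb m True (Lnext m Jm A n)) (emb m True (Rnext m Jm A n))"
proof -
  have taylor: "taylor_coeff m f j = A j" if "j \<le> n" for j
    using f that by (simp add: P_J0_int_def)
  have A: "A j \<in> carrier_mat m m" if "j \<le> n" for j
    using taylor_coeff_carrier[of m f j] taylor[OF that] by simp
  let ?f = "taylor_fps m f"
  have fa: "fps_nth ?f j = a j" if "j \<le> n" for j
    by (simp add: taylor_fps_def a_def taylor[OF that])
  define rho where "rho = coeff_fps n 1 (\<lambda>l. block m V l 0)"
  define pi where "pi = coeff_fps n (a 0) (\<lambda>l. block m (U n) l 0)"
  define tau where "tau = coeff_fps n 1 (\<lambda>l. block m W 0 (n - 1 - l))"
  define sig where "sig = coeff_fps n (a 0) (\<lambda>l. block m (U' n) 0 (n - 1 - l))"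
  define R where "R = emb m True (Rnext m Jm A n)"
  define L where "L = emb m True (Lnext m Jm A n)"
  have A0: "A 0 \<in> carrier_mat m m" using A by simp
  have emb_adj: "emb m False (mat_adjoint X) = mstar (emb m False X)" if "X \<in> carrier_mat m m" for X
    using that by (intro matfam_eqI) (simp add: comp_emb)
  have blk: "block m (U n) i 0 = a (Suc i) + (\<Sum>l=0..i. a (i - l) * block m V l 0)
      \<and> J * block m V i 0 = (\<Sum>l=i..<n. mstar (a (l - i)) * (J * block m (U n) l 0))"
    if k: "n = Suc k" and i: "i < n" for k i
  proof -
    have S: "block m (S_mat m A k) i l = (if l \<le> i then a (i - l) else 0)" if "i < n" "l < n" for i l
      using that k block_Toeplitz[of k A m i l] A by (simp add: a_def)
    have V': "V \<in> carrier_mat (Suc k * m) m"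
      "(Jblk m Jm k - mat_adjoint (S_mat m A k) * Jblk m Jm k * S_mat m A k) * V
        = mat_adjoint (S_mat m A k) * Jblk m Jm k * y_vec m A (Suc k)"
      using V k by (auto simp: Y_set_def Q_mat_def)
    have Un: "U n = y_vec m A (Suc k) + S_mat m A k * V" by (simp add: U_def k)
    note bc = block_conditions(1,2)[OF S_mat_carrier y_vec_carrier V', folded Un k, OF i]
    have "block m (y_vec m A n) i 0 = a (Suc i)"
      using i A[of "Suc i"] by (simp add: block_y_vec a_def)
    moreover have "(\<Sum>l<n. block m (S_mat m A k) i l * block m V l 0)
        = (\<Sum>l<n. if l \<le> i then a (i - l) * block m V l 0 else 0)"
      using i by (intro sum.cong) (auto simp: S)
    moreover have "(\<Sum>l<n. mstar (block m (S_mat m A k) l i) * (J * block m (U n) l 0))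
        = (\<Sum>l<n. if i \<le> l then mstar (a (l - i)) * (J * block m (U n) l 0) else 0)"
      using i by (intro sum.cong) (auto simp: S)
    ultimately show ?thesis
      unfolding bc(1) bc(2) by (simp only: sum_if_le[OF i] sum_if_ge)
  qed
  have RB: "fps_nth pi s = (\<Sum>c=0..s. a c * fps_nth rho (s - c))" if "s \<le> n" for s
  proof (cases s)
    case 0
    then show ?thesis by (simp add: pi_def rho_def coeff_fps_nth)
  next
    case (Suc i)
    then have i: "i < n" using \<open>s \<le> n\<close> by simp
    then obtain k where k: "n = Suc k" by (metis less_imp_Suc_add)
    have "(\<Sum>l=0..i. a (i - l) * block m V l 0) = (\<Sum>c=0..i. a c * fps_nth rho (s - c))"
      using Suc \<open>s \<le> n\<close>
      by (intro sum.reindex_bij_witness[of _ "\<lambda>c. i - c" "\<lambda>c. i - c"]) (auto simp: rho_def coeff_fps_nth Suc_diff_le)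
    moreover have "(\<Sum>c=0..s. a c * fps_nth rho (s - c)) = (\<Sum>c=0..i. a c * fps_nth rho (s - c)) + a s"
      by (simp add: Suc rho_def coeff_fps_nth)
    ultimately show ?thesis
      using blk[OF k i] Suc i by (simp add: pi_def coeff_fps_nth add.commute)
  qed
  \<comment> \<open>Index 0 is excluded because there the two sides differ by \<open>R\<close>, as
    stated next.\<close>
  have RA: "J * fps_nth rho s = (\<Sum>t=s..n. mstar (a (t - s)) * (J * fps_nth pi t))" if "s \<le> n" "1 \<le> s" for s
  proof -
    obtain i where i: "s = Suc i" using \<open>1 \<le> s\<close> by (cases s) auto
    then have "i < n" using \<open>s \<le> n\<close> by simp
    then obtain k where k: "n = Suc k" by (metis less_imp_Suc_add)
    have "(\<Sum>l=i..<n. mstar (a (l - i)) * (J * block m (U n) l 0))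
        = (\<Sum>t=s..n. mstar (a (t - s)) * (J * fps_nth pi t))"
      unfolding i by (rule sum.reindex_bij_witness[of _ "\<lambda>t. t - 1" Suc])
        (auto simp: pi_def coeff_fps_nth split: nat.split)
    then show ?thesis using blk[OF k \<open>i < n\<close>] \<open>i < n\<close> by (simp add: i rho_def coeff_fps_nth)
  qed
  \<comment> \<open>Selfadjointness is recorded since the coefficient in the dual relation appears
    as the adjoint of the expression for \<open>R\<close>.\<close>
  have RC: "R = J - (\<Sum>t=0..n. mstar (a t) * (J * fps_nth pi t))" and RD: "mstar R = R"
  proof -
    \<comment> \<open>The value 0 for \<open>n = 0\<close> merges the two clauses of
      \<open>Rnext\<close> into one formula.\<close>
    define Z where "Z = (if n = 0 then 0\<^sub>m m m else
      mat_adjoint (y_vec m A n) * mp_inv (P_mat m Jm A (n - 1)) * y_vec m A n)"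
    have Z: "Z \<in> carrier_mat m m \<and> mat_adjoint Z = Z
      \<and> emb m False Z = (\<Sum>l<n. mstar (a (Suc l)) * (J * fps_nth pi (Suc l)))"
    proof (cases n)
      case 0
      then have "emb m False Z = 0" by (intro matfam_eqI) (simp add: Z_def comp_emb)
      with 0 show ?thesis by (simp add: Z_def)
    next
      case (Suc k)
      have "V \<in> carrier_mat (Suc k * m) m"
        "(Jblk m Jm k - mat_adjoint (S_mat m A k) * Jblk m Jm k * S_mat m A k) * V
          = mat_adjoint (S_mat m A k) * Jblk m Jm k * y_vec m A (Suc k)"
        using V Suc by (auto simp: Y_set_def Q_mat_def)
      note bc = block_conditions[OF S_mat_carrier y_vec_carrier this]
      show ?thesis
        using bc(3-5) Suc A by (simp add: Z_def P_mat_def pi_def coeff_fps_nth U_def block_y_vec a_def)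
    qed
    have Rn: "Rnext m Jm A n = Jm - mat_adjoint (A 0) * Jm * A 0 - Z"
      using J_mat A0 minus_carrier_mat[of "mat_adjoint (A 0) * Jm * A 0" m m Jm]
      by (auto simp: Rnext_def Z_def intro!: eq_matI)
    have "R = J - mstar (a 0) * J * a 0 - emb m False Z"
      unfolding R_def Rn a_def using A0 Z by (intro emb_schur_complement) auto
    moreover have "(\<Sum>t=0..n. mstar (a t) * (J * fps_nth pi t))
        = mstar (a 0) * J * a 0 + (\<Sum>l<n. mstar (a (Suc l)) * (J * fps_nth pi (Suc l)))"
      unfolding atLeast0AtMost sum.atMost_shift by (simp add: pi_def coeff_fps_nth mult.assoc)
    ultimately show "R = J - (\<Sum>t=0..n. mstar (a t) * (J * fps_nth pi t))"
      using Z by simp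
    have "mstar (emb m False Z) = emb m False Z"
      using Z emb_adj[of Z] by simp
    then show "mstar R = R"
      using \<open>R = J - mstar (a 0) * J * a 0 - emb m False Z\<close> by (simp add: mult.assoc)
  qed
  let ?t = "\<lambda>s. mstar (fps_nth tau s)" and ?s = "\<lambda>s. mstar (fps_nth sig s)"
  \<comment> \<open>The left relations are stated for the adjoint coefficients: in this form they
    have the shape of the right ones, with \<open>a\<close> and its adjoint exchanged.\<close>
  have left: "(\<forall>s\<le>n. ?s s = (\<Sum>c=0..s. mstar (a c) * ?t (s - c))
      \<and> (1 \<le> s \<longrightarrow> J * ?t s = (\<Sum>t=s..n. a (t - s) * (J * ?s t))))
      \<and> L = J - (\<Sum>t=0..n. a t * (J * ?s t))"
  proof (cases n)
    case 0
    have "Lnext m Jm A n = Jm - mat_adjoint (mat_adjoint (A 0)) * Jm * mat_adjoint (A 0) - 0\<^sub>m m m"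
      using 0 J_mat A0 by (auto simp: Lnext_def intro!: eq_matI)
    then have "L = J - a 0 * J * mstar (a 0) - emb m False (0\<^sub>m m m)"
      unfolding L_def a_def using A0 emb_schur_complement[of "mat_adjoint (A 0)" "0\<^sub>m m m"] by (simp add: emb_adj)
    moreover have "emb m False (0\<^sub>m m m) = 0" by (intro matfam_eqI) (simp add: comp_emb)
    ultimately show ?thesis using 0 by (simp add: sig_def tau_def coeff_fps_nth mult.assoc)
  next
    case (Suc k)
    let ?S = "S_mat m A k" and ?J = "Jblk m Jm k" and ?z = "z_vec m A n"
    have Wc: "W \<in> carrier_mat m (n * m)" and Weq: "W * (?J - ?S * ?J * mat_adjoint ?S) = ?z * ?J * mat_adjoint ?S"
      using W Suc by (auto simp: Z_set_def P_mat_def)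
    have d: "dim_row W = m" "dim_col W = Suc k * m" "dim_row ?S = Suc k * m" "dim_col ?S = Suc k * m"
      "dim_row ?J = Suc k * m" "dim_col ?J = Suc k * m" "dim_row ?z = m" "dim_col ?z = Suc k * m"
      using Wc Suc carrier_matD[OF Jblk_carrier[of m Jm k]] carrier_matD[OF S_mat_carrier[of m A k]]
        carrier_matD[OF z_vec_carrier[of m A n]] by auto
    have c: "?S * ?J * mat_adjoint ?S \<in> carrier_mat (Suc k * m) (Suc k * m)" by (simp add: d)
    have "mat_adjoint (W * (?J - ?S * ?J * mat_adjoint ?S)) = mat_adjoint (?J - ?S * ?J * mat_adjoint ?S) * mat_adjoint W"
      by (rule mat_adjoint_mult) (simp add: d)
    also have "mat_adjoint (?J - ?S * ?J * mat_adjoint ?S) = ?J - ?S * ?J * mat_adjoint ?S"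
      unfolding mat_adjoint_minus[OF Jblk_carrier c]
      by (simp add: mat_adjoint_mult d Suc Jblk_adjoint[OF J_mat(1,2)] mat_mult_assoc)
    finally have "(?J - ?S * ?J * mat_adjoint ?S) * mat_adjoint W = mat_adjoint (?z * ?J * mat_adjoint ?S)"
      by (simp only: Weq)
    also have "\<dots> = ?S * ?J * mat_adjoint ?z"
      by (simp add: mat_adjoint_mult d Suc Jblk_adjoint[OF J_mat(1,2)] mat_mult_assoc)
    finally have eq: "(?J - mat_adjoint (mat_adjoint ?S) * ?J * mat_adjoint ?S) * mat_adjoint W
        = mat_adjoint (mat_adjoint ?S) * ?J * mat_adjoint ?z"
      by simp
    have car: "mat_adjoint ?S \<in> carrier_mat (Suc k * m) (Suc k * m)"
      "mat_adjoint ?z \<in> carrier_mat (Suc k * m) m" "mat_adjoint W \<in> carrier_mat (Suc k * m) m"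
      unfolding mat_adjoint_carrier using S_mat_carrier z_vec_carrier[of m A n] Wc Suc by simp_all
    note bc = block_conditions[OF car eq]
    have Y: "mat_adjoint ?z + mat_adjoint ?S * mat_adjoint W = mat_adjoint (U' n)"
    proof -
      have "mat_adjoint (U' n) = mat_adjoint (W * ?S) + mat_adjoint ?z"
        unfolding U'_def using Suc by (simp, intro mat_adjoint_add[of _ m "Suc k * m"]) (auto simp: d Suc)
      also have "\<dots> = mat_adjoint ?z + mat_adjoint (W * ?S)"
        by (rule comm_add_mat[of _ "Suc k * m" m]) (auto simp: d Suc)
      finally show ?thesis by (simp add: mat_adjoint_mult d Suc)
    qed
    note bc12 = bc(1,2)[unfolded Y, folded Suc]
    have U'c: "U' n \<in> carrier_mat (1 * m) (Suc k * m)"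
      unfolding U'_def using Suc by (intro carrier_matI) (simp_all add: d Suc)
    have bU: "block m (mat_adjoint (U' n)) j 0 = mstar (block m (U' n) 0 j)" if "j < n" for j
      using that Suc U'c by (intro block_adjoint[where K = 1 and L = "Suc k"]) auto
    have bW: "block m (mat_adjoint W) j 0 = mstar (block m W 0 j)" if "j < n" for j
      using that Suc Wc by (intro block_adjoint[where K = 1 and L = "Suc k"]) auto
    have bz: "block m (mat_adjoint ?z) j 0 = mstar (a (n - j))" if "j < n" for j
    proof -
      have "block m (mat_adjoint ?z) j 0 = mstar (block m ?z 0 j)"
        using that Suc z_vec_carrier[of m A n] by (intro block_adjoint[where K = 1 and L = "Suc k"]) auto
      then show ?thesis using that A[of "n - j"] by (simp add: block_z_vec a_def)
    qed
    have bS: "block m (mat_adjoint ?S) i l = mstar (if i \<le> l then a (l - i) else 0)" if "i < n" "l < n" for i l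
    proof -
      have "block m (mat_adjoint ?S) i l = mstar (block m ?S l i)"
        using that Suc by (intro block_adjoint[OF S_mat_carrier]) auto
      then show ?thesis using that Suc A block_Toeplitz[of k A m l i] by (simp add: a_def)
    qed
    have s_nth: "?s t = block m (mat_adjoint (U' n)) (n - t) 0" if "1 \<le> t" "t \<le> n" for t
      using that bU[of "n - t"] by (cases t) (auto simp: sig_def coeff_fps_nth)
    have t_nth: "?t t = block m (mat_adjoint W) (n - t) 0" if "1 \<le> t" "t \<le> n" for t
      using that bW[of "n - t"] by (cases t) (auto simp: tau_def coeff_fps_nth)
    have "?s s = (\<Sum>c=0..s. mstar (a c) * ?t (s - c))" if "s \<le> n" for s
    proof (cases "s = 0")
      case True
      then show ?thesis by (simp add: sig_def tau_def coeff_fps_nth)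
    next
      case False
      \<comment> \<open>The rows \<open>W\<close> and \<open>z_vec\<close> list coefficients in
        descending order, so block \<open>j\<close> belongs to coefficient
        \<open>n - j\<close>.\<close>
      define j where "j = n - s"
      have j: "j < n" "n - j = s" using False \<open>s \<le> n\<close> by (auto simp: j_def)
      have "?s s = block m (mat_adjoint (U' n)) j 0"
        using s_nth[of s] False \<open>s \<le> n\<close> unfolding j_def by simp
      also have "\<dots> = mstar (a s) + (\<Sum>l<n. block m (mat_adjoint ?S) j l * block m (mat_adjoint W) l 0)"
        using bc12(2)[OF j(1)] bz[OF j(1)] unfolding j(2) by simp
      also have "(\<Sum>l<n. block m (mat_adjoint ?S) j l * block m (mat_adjoint W) l 0)
          = (\<Sum>l<n. if j \<le> l then mstar (a (l - j)) * block m (mat_adjoint W) l 0 else 0)"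
        using j by (intro sum.cong) (auto simp: bS)
      also have "\<dots> = (\<Sum>l=j..<n. mstar (a (l - j)) * block m (mat_adjoint W) l 0)" by (rule sum_if_ge)
      also have "\<dots> = (\<Sum>c=0..<s. mstar (a c) * ?t (s - c))"
        using j by (intro sum.reindex_bij_witness[of _ "\<lambda>c. j + c" "\<lambda>l. l - j"]) (auto simp: t_nth)
      finally show ?thesis
        by (simp add: atLeastLessThanSuc_atLeastAtMost[symmetric] tau_def coeff_fps_nth add.commute)
    qed
    moreover have "J * ?t s = (\<Sum>t=s..n. a (t - s) * (J * ?s t))" if "s \<le> n" "1 \<le> s" for s
    proof -
      define j where "j = n - s"
      have j: "j < n" "n - j = s" using that by (auto simp: j_def)
      have "?t s = block m (mat_adjoint W) j 0"
        using t_nth[of s] that unfolding j_def by simp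
      then have "J * ?t s = (\<Sum>l<n. mstar (block m (mat_adjoint ?S) l j) * (J * block m (mat_adjoint (U' n)) l 0))"
        using bc12(1)[OF j(1)] by (simp only:)
      also have "\<dots> = (\<Sum>l<n. if l \<le> j then a (j - l) * (J * block m (mat_adjoint (U' n)) l 0) else 0)"
        using j by (intro sum.cong) (auto simp: bS)
      also have "\<dots> = (\<Sum>l=0..j. a (j - l) * (J * block m (mat_adjoint (U' n)) l 0))"
        using j(1) by (rule sum_if_le)
      also have "\<dots> = (\<Sum>t=s..n. a (t - s) * (J * ?s t))"
        using j by (intro sum.reindex_bij_witness[of _ "\<lambda>t. n - t" "\<lambda>t. n - t"]) (auto simp: s_nth)
      finally show ?thesis .
    qed
    moreover have "L = J - (\<Sum>t=0..n. a t * (J * ?s t))"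
    proof -
      define Z where "Z = ?z * mp_inv (Q_mat m Jm A k) * mat_adjoint ?z"
      have Z: "Z \<in> carrier_mat m m" "emb m False Z = (\<Sum>l<n. a (n - l) * (J * block m (mat_adjoint (U' n)) l 0))"
        using bc(3,4) Suc unfolding Y Z_def Q_mat_def by (simp_all add: bz[unfolded Suc])
      have "L = emb m True (Jm - mat_adjoint (mat_adjoint (A 0)) * Jm * mat_adjoint (A 0) - Z)"
        unfolding L_def Lnext_def Z_def using Suc by simp
      also have "\<dots> = J - a 0 * J * mstar (a 0) - emb m False Z"
        using A0 Z(1) by (subst emb_schur_complement) (auto simp: emb_adj a_def)
      also have "emb m False Z = (\<Sum>t=1..n. a t * (J * ?s t))"
        unfolding Z(2) by (rule sum.reindex_bij_witness[of _ "\<lambda>t. n - t" "\<lambda>t. n - t"]) (auto simp: s_nth)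
      finally show ?thesis
        by (simp add: sum.atLeast_Suc_atMost[of 0 n] sig_def coeff_fps_nth mult.assoc)
    qed
    ultimately show ?thesis by blast
  qed
  have "potapov_interpolation mstar mpos PP ?f rho pi sig tau n L R"
  proof (intro potapov_interpolation.intro krein_axioms potapov_interpolation_axioms.intro)
    show "potapov ?f" using f by (intro potapov_taylor_fps) (simp add: P_J0_int_def)
    show "fps_deg_le n rho" "fps_deg_le n pi" "fps_deg_le n sig" "fps_deg_le n tau"
      unfolding rho_def pi_def sig_def tau_def by (rule coeff_fps_deg_le)+
    show "fps_nth rho 0 = 1" "fps_nth tau 0 = 1" by (simp_all add: rho_def tau_def coeff_fps_nth)
    fix i assume i: "i \<le> n"
    show "fps_nth (?f * rho) i = fps_nth pi i"
      unfolding RB[OF i] fps_mult_nth using i by (intro sum.cong) (auto simp: fa)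
    have "mstar (fps_nth (tau * ?f) i) = (\<Sum>c=0..i. mstar (a (i - c)) * ?t c)"
      unfolding fps_mult_nth using i by (simp add: matfam.star_sum fa)
    also have "\<dots> = (\<Sum>c=0..i. mstar (a c) * ?t (i - c))"
      by (rule sum.reindex_bij_witness[of _ "\<lambda>c. i - c" "\<lambda>c. i - c"]) auto
    also have "\<dots> = ?s i" using left i by simp
    finally show "fps_nth (tau * ?f) i = fps_nth sig i" by (metis matfam.star_star)
    \<comment> \<open>Reversal sends the coefficient of degree \<open>i\<close> to that of index
      \<open>s\<close>, so the exceptional top degree \<open>n\<close> corresponds to
      \<open>s = 0\<close>.\<close>
    define s where "s = n - i"
    have si: "i = n - s" "s \<le> n" using i by (auto simp: s_def)
    have "fps_nth (rev n pi * fps_const J * ?f) i = (\<Sum>c=0..i. mstar (fps_nth pi (n - c)) * J * fps_nth ?f (i - c))"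
      unfolding fps_mult_nth[of "rev n pi * fps_const J"] using i by (intro sum.cong) auto
    also have "\<dots> = (\<Sum>t=s..n. mstar (fps_nth pi t) * J * a (t - s))"
      using si by (intro sum.reindex_bij_witness[of _ "\<lambda>t. n - t" "\<lambda>t. n - t"]) (auto simp: fa add.commute[of s])
    also have "\<dots> = mstar (\<Sum>t=s..n. mstar (a (t - s)) * (J * fps_nth pi t))"
      by (simp add: matfam.star_sum mult.assoc)
    finally have pf: "fps_nth (rev n pi * fps_const J * ?f) i = mstar (\<Sum>t=s..n. mstar (a (t - s)) * (J * fps_nth pi t))" .
    have "fps_nth (rev n rho * fps_const J) i = mstar (J * fps_nth rho s)"
      using i by (simp add: s_def)
    then have "fps_nth (rev n rho * fps_const J - rev n pi * fps_const J * ?f) i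
      = mstar (J * fps_nth rho s - (\<Sum>t=s..n. mstar (a (t - s)) * (J * fps_nth pi t)))"
      unfolding fps_sub_nth pf by simp
    also have "J * fps_nth rho s - (\<Sum>t=s..n. mstar (a (t - s)) * (J * fps_nth pi t)) = (if i = n then R else 0)"
    proof (cases "s = 0")
      case True
      then have "i = n" using si by simp
      have "fps_nth rho 0 = 1" by (simp add: rho_def coeff_fps_nth)
      then show ?thesis unfolding True \<open>i = n\<close> RC by (simp only: mult_1_right diff_zero refl if_True)
    next
      case False
      then have "i \<noteq> n" unfolding s_def by simp
      then have "(if i = n then R else 0) = 0" by (rule if_not_P)
      moreover have "J * fps_nth rho s = (\<Sum>t=s..n. mstar (a (t - s)) * (J * fps_nth pi t))"
        using False by (intro RA si(2)) simp
      ultimately show ?thesis by (simp only: diff_self)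
    qed
    finally show "fps_nth (rev n rho * fps_const J - rev n pi * fps_const J * ?f) i = (if i = n then R else 0)"
      using RD by auto
    have "fps_nth (?f * fps_const J * rev n sig) i = (\<Sum>c=0..i. fps_nth ?f c * (J * ?s (n - (i - c))))"
      unfolding mult.assoc fps_mult_nth[of ?f] using i by (intro sum.cong) auto
    also have "\<dots> = (\<Sum>t=s..n. a (t - s) * (J * ?s t))"
      using si by (intro sum.reindex_bij_witness[of _ "\<lambda>t. t - s" "\<lambda>c. c + s"]) (auto simp: fa add.commute[of s])
    finally have fs: "fps_nth (?f * fps_const J * rev n sig) i = (\<Sum>t=s..n. a (t - s) * (J * ?s t))" .
    have "fps_nth (fps_const J * rev n tau) i = J * ?t s" using i by (simp add: s_def)
    then have "fps_nth (fps_const J * rev n tau - ?f * fps_const J * rev n sig) i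
        = J * ?t s - (\<Sum>t=s..n. a (t - s) * (J * ?s t))"
      unfolding fps_sub_nth fs by simp
    also have "\<dots> = (if i = n then L else 0)"
    proof (cases "s = 0")
      case True
      then have "i = n" using si by simp
      have t0: "?t 0 = 1" by (simp add: tau_def coeff_fps_nth)
      have "L = J - (\<Sum>t=0..n. a t * (J * ?s t))" using left by (rule conjunct2)
      then show ?thesis unfolding True \<open>i = n\<close> t0 by (simp only: mult_1_right diff_zero refl if_True)
    next
      case False
      then have "i \<noteq> n" unfolding s_def by simp
      then have "(if i = n then L else 0) = 0" by (rule if_not_P)
      moreover have "J * ?t s = (\<Sum>t=s..n. a (t - s) * (J * ?s t))"
        using conjunct1[OF left, rule_format, OF si(2)] False by (metis One_nat_def Suc_leI neq0_conv)
      ultimately show ?thesis by (simp only: diff_self)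
    qed
    finally show "fps_nth (fps_const J * rev n tau - ?f * fps_const J * rev n sig) i = (if i = n then L else 0)" .
  qed
  then show ?thesis unfolding rho_def pi_def sig_def tau_def L_def R_def .
qed

end

section \<open>The representation\<close>

definition mhol :: "nat \<Rightarrow> (complex \<Rightarrow> complex mat) \<Rightarrow> complex set \<Rightarrow> bool" where
  "mhol m b U \<longleftrightarrow> (\<forall>w\<in>U. b w \<in> carrier_mat m m) \<and> mat_holomorphic_on m b U"

lemma mholD:
  assumes "mhol m b U"
  shows "w \<in> U \<Longrightarrow> b w \<in> carrier_mat m m"
    and "i < m \<Longrightarrow> j < m \<Longrightarrow> (\<lambda>w. b w $$ (i, j)) holomorphic_on U"
  using assms by (auto simp: mhol_def mat_holomorphic_on_def)

lemma mholI:
  assumes "\<And>w. w \<in> U \<Longrightarrow> b w \<in> carrier_mat m m"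
    and "\<And>i j. i < m \<Longrightarrow> j < m \<Longrightarrow> (\<lambda>w. b w $$ (i, j)) holomorphic_on U"
  shows "mhol m b U"
  using assms by (auto simp: mhol_def mat_holomorphic_on_def)

lemma mhol_mult:
  assumes b: "mhol m b U" and c: "mhol m c U"
  shows "mhol m (\<lambda>w. b w * c w) U"
proof (rule mholI)
  fix w assume w: "w \<in> U"
  show "b w * c w \<in> carrier_mat m m" using mholD(1)[OF b w] mholD(1)[OF c w] by (rule mult_carrier_mat)
next
  fix i j assume ij: "i < m" "j < m"
  show "(\<lambda>w. (b w * c w) $$ (i, j)) holomorphic_on U"
  proof (rule holomorphic_transform)
    show "(\<lambda>w. \<Sum>l<m. b w $$ (i, l) * c w $$ (l, j)) holomorphic_on U"
      using ij by (intro holomorphic_intros mholD(2)[OF b] mholD(2)[OF c]) auto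
    fix w assume w: "w \<in> U"
    show "(\<Sum>l<m. b w $$ (i, l) * c w $$ (l, j)) = (b w * c w) $$ (i, j)"
      using mholD(1)[OF b w] mholD(1)[OF c w] ij by (simp add: scalar_prod_def atLeast0LessThan)
  qed
qed

lemma mhol_add:
  assumes b: "mhol m b U" and c: "mhol m c U"
  shows "mhol m (\<lambda>w. b w + c w) U"
proof (rule mholI)
  fix w assume w: "w \<in> U"
  show "b w + c w \<in> carrier_mat m m" using mholD(1)[OF c w] by (rule add_carrier_mat)
next
  fix i j assume ij: "i < m" "j < m"
  show "(\<lambda>w. (b w + c w) $$ (i, j)) holomorphic_on U"
  proof (rule holomorphic_transform)
    show "(\<lambda>w. b w $$ (i, j) + c w $$ (i, j)) holomorphic_on U"
      using ij by (intro holomorphic_intros mholD(2)[OF b] mholD(2)[OF c]) auto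
    fix w assume w: "w \<in> U"
    show "b w $$ (i, j) + c w $$ (i, j) = (b w + c w) $$ (i, j)"
      using mholD(1)[OF c w] ij by simp
  qed
qed

lemma mhol_smult:
  assumes b: "mhol m b U"
  shows "mhol m (\<lambda>w. w \<cdot>\<^sub>m b w) U"
proof (rule mholI)
  fix w assume w: "w \<in> U"
  show "w \<cdot>\<^sub>m b w \<in> carrier_mat m m" using mholD(1)[OF b w] by simp
next
  fix i j assume ij: "i < m" "j < m"
  show "(\<lambda>w. (w \<cdot>\<^sub>m b w) $$ (i, j)) holomorphic_on U"
  proof (rule holomorphic_transform)
    show "(\<lambda>w. w * b w $$ (i, j)) holomorphic_on U"
      using ij by (intro holomorphic_intros mholD(2)[OF b]) auto
    fix w assume w: "w \<in> U"
    show "w * b w $$ (i, j) = (w \<cdot>\<^sub>m b w) $$ (i, j)" using mholD(1)[OF b w] ij by simp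
  qed
qed

lemma mhol_const: "A \<in> carrier_mat m m \<Longrightarrow> mhol m (\<lambda>_. A) U"
  by (rule mholI) auto

lemma mhol_subset: "mhol m b U \<Longrightarrow> T \<subseteq> U \<Longrightarrow> mhol m b T"
  unfolding mhol_def mat_holomorphic_on_def by (blast intro: holomorphic_on_subset)

lemma mhol_mpoly: "mpoly m n b B \<Longrightarrow> mhol m b U"
  by (rule mholI) (rule mpolyD(2) mpoly_holomorphic, assumption+)+

text \<open>Equal series at 0 mean equal germs, and the identity theorem carries the equality over a
  connected domain.\<close>

lemma mexp_eq_extend:
  assumes "mexp m b B" "mexp m c B" "mhol m b U" "mhol m c U" "open U" "connected U" "0 \<in> U" and w: "w \<in> U"
  shows "b w = c w"
proof (rule eq_matI)
  have c: "b w \<in> carrier_mat m m" "c w \<in> carrier_mat m m"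
    using mholD(1)[OF assms(3) w] mholD(1)[OF assms(4) w] by auto
  then show "dim_row (b w) = dim_row (c w)" "dim_col (b w) = dim_col (c w)" by auto
  fix i j assume "i < dim_row (c w)" "j < dim_col (c w)"
  then have ij: "i < m" "j < m" using c by auto
  have "(\<lambda>w. b w $$ (i, j) - c w $$ (i, j)) has_fps_expansion ent m B i j - ent m B i j"
    by (intro has_fps_expansion_diff mexpD(2)[OF assms(1)] mexpD(2)[OF assms(2)] ij)
  then have z: "(\<lambda>w. b w $$ (i, j) - c w $$ (i, j)) has_fps_expansion 0" by simp
  have "(\<lambda>w. b w $$ (i, j) - c w $$ (i, j)) holomorphic_on U"
    by (intro holomorphic_intros mholD(2)[OF assms(3)] mholD(2)[OF assms(4)] ij)
  from has_fps_expansion_0_analytic_continuation[OF z this assms(5,6,7) w]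
  show "b w $$ (i, j) = c w $$ (i, j)" by simp
qed

lemma zero_set_no_limit_point:
  assumes h: "h holomorphic_on unit_disc" "h 0 \<noteq> (0 :: complex)" and z: "z \<in> unit_disc"
  shows "\<not> z islimpt {w \<in> unit_disc. h w = 0}"
proof
  assume lim: "z islimpt {w \<in> unit_disc. h w = 0}"
  have "h 0 = 0"
    by (rule analytic_continuation[OF h(1) _ _ _ z lim]) auto
  with h(2) show False by simp
qed

lemma mpoly_at_0:
  assumes b: "mpoly m n b B" and B: "fps_nth B 0 = 1"
  shows "b 0 = 1\<^sub>m m"
proof (rule eq_matI)
  have c: "b 0 \<in> carrier_mat m m" by (rule mpolyD(2)[OF b])
  then show "dim_row (b 0) = dim_row (1\<^sub>m m :: complex mat)" "dim_col (b 0) = dim_col (1\<^sub>m m :: complex mat)" by auto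
  fix i j assume "i < dim_row (1\<^sub>m m :: complex mat)" "j < dim_col (1\<^sub>m m :: complex mat)"
  then have ij: "i < m" "j < m" by auto
  have "(\<Sum>k\<le>n. comp (fps_nth B k) m $$ (i, j) * 0 ^ k) = comp (fps_nth B 0) m $$ (i, j)"
    unfolding sum.atMost_shift by simp
  then show "b 0 $$ (i, j) = 1\<^sub>m m $$ (i, j)"
    unfolding mpolyD(3)[OF b ij] using B by simp
qed

lemma zero_smult_add:
  fixes M X :: "'a :: semiring_0 mat"
  assumes "X \<in> carrier_mat k l" "dim_row M = k" "dim_col M = l"
  shows "0 \<cdot>\<^sub>m M + X = X"
  using assms by (intro eq_matI) auto

lemma S_mat_dim [simp]: "dim_row (S_mat m A k) = m + k * m" "dim_col (S_mat m A k) = m + k * m"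
  by (simp_all add: S_mat_def)

section \<open>Coefficient series of the four associated polynomials\<close>

lemma mpoly_rho:
  assumes "n \<ge> 1 \<Longrightarrow> V \<in> carrier_mat (n * m) m"
  shows "mpoly m n (rho_poly m n V) (coeff_fps n 1 (\<lambda>l. block m V l 0))"
proof (rule mpoly_coeff_fps)
  fix w
  show "rho_poly m n V w \<in> carrier_mat m m"
    using assms by (cases n) (auto simp: rho_poly_def e_row_def intro!: add_carrier_mat)
  fix i j assume ij: "i < m" "j < m"
  show "rho_poly m n V w $$ (i, j) = comp 1 m $$ (i, j) + w * (\<Sum>l<n. comp (block m V l 0) m $$ (i, j) * w ^ l)"
  proof (cases n)
    case (Suc k)
    then have V: "V \<in> carrier_mat (Suc k * m) m" using assms by simp
    then have "dim_row (e_row m k w * V) = m" "dim_col (e_row m k w * V) = m" by (auto simp: e_row_def)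
    then show ?thesis
      using ij Suc by (simp add: rho_poly_def e_row_mult_index[OF V ij] del: index_mult_mat(1))
  qed (use ij in \<open>simp add: rho_poly_def\<close>)
qed

lemma mpoly_pi:
  assumes "n \<ge> 1 \<Longrightarrow> V \<in> carrier_mat (n * m) m" and A: "A 0 \<in> carrier_mat m m"
  shows "mpoly m n (pi_poly m A n V)
    (coeff_fps n (emb m False (A 0)) (\<lambda>l. block m (y_vec m A n + S_mat m A (n - 1) * V) l 0))"
proof (rule mpoly_coeff_fps)
  fix w
  show "pi_poly m A n V w \<in> carrier_mat m m"
    using assms by (cases n) (auto simp: pi_poly_def e_row_def intro!: add_carrier_mat)
  fix i j assume ij: "i < m" "j < m"
  show "pi_poly m A n V w $$ (i, j) = comp (emb m False (A 0)) m $$ (i, j)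
      + w * (\<Sum>l<n. comp (block m (y_vec m A n + S_mat m A (n - 1) * V) l 0) m $$ (i, j) * w ^ l)"
  proof (cases n)
    case (Suc k)
    let ?U = "y_vec m A (Suc k) + S_mat m A k * V"
    have "S_mat m A k * V \<in> carrier_mat (Suc k * m) m"
      using assms(1) Suc S_mat_carrier[of m A k] by auto
    then have U: "?U \<in> carrier_mat (Suc k * m) m" by (rule add_carrier_mat)
    then have "dim_row (e_row m k w * ?U) = m" "dim_col (e_row m k w * ?U) = m"
      by (auto simp: e_row_def simp del: index_add_mat)
    then show ?thesis
      using ij Suc A by (simp add: pi_poly_def e_row_mult_index[OF U ij] comp_emb del: index_mult_mat(1))
  qed (use ij A in \<open>simp add: pi_poly_def comp_emb\<close>)
qed

lemma mpoly_tau: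
  assumes "n \<ge> 1 \<Longrightarrow> W \<in> carrier_mat m (n * m)"
  shows "mpoly m n (tau_poly m n W) (coeff_fps n 1 (\<lambda>l. block m W 0 (n - 1 - l)))"
proof (rule mpoly_coeff_fps)
  fix w
  show "tau_poly m n W w \<in> carrier_mat m m"
    by (cases n) (auto simp: tau_poly_def intro!: add_carrier_mat)
  fix i j assume ij: "i < m" "j < m"
  show "tau_poly m n W w $$ (i, j) = comp 1 m $$ (i, j) + w * (\<Sum>l<n. comp (block m W 0 (n - 1 - l)) m $$ (i, j) * w ^ l)"
  proof (cases n)
    case (Suc k)
    then have W: "W \<in> carrier_mat m (Suc k * m)" using assms by simp
    show ?thesis
      using ij Suc by (simp add: tau_poly_def mult_eps_col_index[OF W ij] del: index_mult_mat(1))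
  qed (use ij in \<open>simp add: tau_poly_def\<close>)
qed

lemma mpoly_sigma:
  assumes "n \<ge> 1 \<Longrightarrow> W \<in> carrier_mat m (n * m)" and A: "A 0 \<in> carrier_mat m m"
  shows "mpoly m n (sigma_poly m A n W)
    (coeff_fps n (emb m False (A 0)) (\<lambda>l. block m (W * S_mat m A (n - 1) + z_vec m A n) 0 (n - 1 - l)))"
proof (rule mpoly_coeff_fps)
  fix w
  show "sigma_poly m A n W w \<in> carrier_mat m m"
    using A by (cases n) (auto simp: sigma_poly_def intro!: add_carrier_mat)
  fix i j assume ij: "i < m" "j < m"
  show "sigma_poly m A n W w $$ (i, j) = comp (emb m False (A 0)) m $$ (i, j)
      + w * (\<Sum>l<n. comp (block m (W * S_mat m A (n - 1) + z_vec m A n) 0 (n - 1 - l)) m $$ (i, j) * w ^ l)"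
  proof (cases n)
    case (Suc k)
    have U: "W * S_mat m A k + z_vec m A (Suc k) \<in> carrier_mat m (Suc k * m)"
      by (rule add_carrier_mat) (rule z_vec_carrier)
    show ?thesis
      using ij Suc A by (simp add: sigma_poly_def mult_eps_col_index[OF U ij] comp_emb del: index_mult_mat(1))
  qed (use ij A in \<open>simp add: sigma_poly_def comp_emb\<close>)
qed

lemma emb_True_mult: "A \<in> carrier_mat m m \<Longrightarrow> B \<in> carrier_mat m m \<Longrightarrow>
    emb m True A * emb m True B = emb m True (A * B)"
  by (intro matfam_eqI) (simp add: comp_emb)

lemma mstar_emb_True: "A \<in> carrier_mat m m \<Longrightarrow> mstar (emb m True A) = emb m True (mat_adjoint A)"
  by (intro matfam_eqI) (simp add: comp_emb)

lemma emb_sqrt: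
  assumes "psd A" "A \<in> carrier_mat m m"
  defines "l \<equiv> emb m True (msqrt A)" and "li \<equiv> emb m True (mp_inv (msqrt A))"
  shows "mstar l = l" "l * l = emb m True A" "l * li * l = l" "li * l * li = li" "li * l = l * li"
    "mstar (l * li) = l * li" "mp_inv (msqrt A) \<in> carrier_mat m m"
proof -
  note s = msqrt[OF assms(1,2)]
  note i = mp_inv_hermitian[OF s(2) psd_adjoint[OF s(1)]]
  show "mp_inv (msqrt A) \<in> carrier_mat m m" by (rule i(1))
  show "mstar l = l" "l * l = emb m True A" "l * li * l = l" "li * l * li = li" "li * l = l * li"
    "mstar (l * li) = l * li"
    unfolding l_def li_def using s i psd_adjoint[OF s(1)]
    by (simp_all add: emb_True_mult mstar_emb_True)
qed

theorem theorem3p5: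
  fixes m n :: nat and J :: "complex mat" and A :: "nat \<Rightarrow> complex mat"
    and V W :: "complex mat" and f :: "complex \<Rightarrow> complex mat"
  assumes "m \<ge> 1"
    and "signature_mat m J"
    and "potapov_seq m J n A"
    and "n \<ge> 1 \<Longrightarrow> V \<in> Y_set m J A n"
    and "n \<ge> 1 \<Longrightarrow> W \<in> Z_set m J A n"
    and "f \<in> P_J0_int m J n A"
  shows "\<exists>S \<in> schur_class m. \<exists>E. (\<forall>z\<in>unit_disc. \<not> z islimpt E) \<and>
    (\<forall>w \<in> unit_disc - E.
      (let Lr = msqrt (Lnext m J A n); Rr = msqrt (Rnext m J A n) in
        invertible_mat (w \<cdot>\<^sub>m (J * tilde m n (sigma_poly m A n W) w * mp_inv Lr * S w * Rr)
                        + rho_poly m n V w) \<and>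
        f w = (w \<cdot>\<^sub>m (J * tilde m n (tau_poly m n W) w * mp_inv Lr * S w * Rr)
                        + pi_poly m A n V w)
              * minv (w \<cdot>\<^sub>m (J * tilde m n (sigma_poly m A n W) w * mp_inv Lr * S w * Rr)
                        + rho_poly m n V w) \<and>
        invertible_mat (w \<cdot>\<^sub>m (Lr * S w * mp_inv Rr * tilde m n (pi_poly m A n V) w * J)
                        + tau_poly m n W w) \<and>
        f w = minv (w \<cdot>\<^sub>m (Lr * S w * mp_inv Rr * tilde m n (pi_poly m A n V) w * J)
                        + tau_poly m n W w)
              * (w \<cdot>\<^sub>m (Lr * S w * mp_inv Rr * tilde m n (rho_poly m n V) w * J)
                        + sigma_poly m A n W w)))"
proof -
  interpret sg: signature m J by unfold_locales (rule assms(2))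
  let ?U = "hol_pts m f" and ?K = "unit_disc - hol_pts m f"
  define fs where "fs = taylor_fps m f"
  define rho where "rho = coeff_fps n 1 (\<lambda>l. block m V l 0)"
  define pi where "pi = coeff_fps n (emb m False (A 0)) (\<lambda>l. block m (y_vec m A n + S_mat m A (n - 1) * V) l 0)"
  define tau where "tau = coeff_fps n 1 (\<lambda>l. block m W 0 (n - 1 - l))"
  define sig where "sig = coeff_fps n (emb m False (A 0))
    (\<lambda>l. block m (W * S_mat m A (n - 1) + z_vec m A n) 0 (n - 1 - l))"
  define L where "L = Lnext m J A n"
  define R where "R = Rnext m J A n"
  have A0: "A 0 \<in> carrier_mat m m" using assms(3) by (simp add: potapov_seq_def)
  have f: "f \<in> P_J0 m J" using assms(6) by (simp add: P_J0_int_def)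
  have V: "n \<ge> 1 \<Longrightarrow> V \<in> carrier_mat (n * m) m" and W: "n \<ge> 1 \<Longrightarrow> W \<in> carrier_mat m (n * m)"
    using assms(4,5) by (auto simp: Y_set_def Z_set_def)
  interpret I: potapov_interpolation mstar mpos sg.PP fs rho pi sig tau n "emb m True L" "emb m True R"
    unfolding fs_def rho_def pi_def tau_def sig_def L_def R_def
    using sg.interpolation[OF assms(6,4,5)] by simp
  have L: "L \<in> carrier_mat m m" and R: "R \<in> carrier_mat m m"
    using A0 sg.J_mat(1) by (auto simp: L_def R_def Lnext_def Rnext_def intro!: minus_carrier_mat)
  \<comment> \<open>Semidefiniteness has to precede any use of \<open>msqrt\<close>, whose defining
    description is meaningful only then.\<close>
  have Lp: "psd L" and Rp: "psd R"
    using I.pos_L I.pos_R L R by (auto simp: mpos_def comp_emb dest!: spec[of _ m])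
  note Ls = emb_sqrt[OF Lp L] and Rs = emb_sqrt[OF Rp R]
  define Lr where "Lr = msqrt L"
  define Rr where "Rr = msqrt R"
  have car: "Lr \<in> carrier_mat m m" "mp_inv Lr \<in> carrier_mat m m" "Rr \<in> carrier_mat m m" "mp_inv Rr \<in> carrier_mat m m"
    using msqrt(2)[OF Lp L] msqrt(2)[OF Rp R] Ls(7) Rs(7) by (auto simp: Lr_def Rr_def)
  interpret I: potapov_interpolation_sqrt mstar mpos sg.PP fs rho pi sig tau n "emb m True L" "emb m True R"
    "emb m True Lr" "emb m True (mp_inv Lr)" "emb m True Rr" "emb m True (mp_inv Rr)"
    unfolding Lr_def Rr_def by unfold_locales (fact Ls Rs)+
  obtain S where S: "S \<in> schur_class m" and S_exp: "mexp m S I.S"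
    using schur_from_coeffs[OF I.S_contractive assms(1)] by blast
  have c: "comp sg.J m = J" "comp (emb m True Lr) m = Lr" "comp (emb m True (mp_inv Lr)) m = mp_inv Lr"
    "comp (emb m True Rr) m = Rr" "comp (emb m True (mp_inv Rr)) m = mp_inv Rr"
    using car by (simp_all add: sg.comp_J comp_emb)
  have f_exp: "mexp m f fs" unfolding fs_def by (rule sg.potapov_taylor_fps(2)[OF f])
  have poly: "mpoly m n (rho_poly m n V) rho" "mpoly m n (pi_poly m A n V) pi"
    "mpoly m n (tau_poly m n W) tau" "mpoly m n (sigma_poly m A n W) sig"
    unfolding rho_def pi_def tau_def sig_def
    by (rule mpoly_rho mpoly_pi mpoly_tau mpoly_sigma; (rule V W A0 | assumption)+)+
  note exps = mexp_add mexp_smult mexp_mult mexp_const c S_exp f_exp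
    poly[THEN mpoly_mexp] poly[THEN mpoly_tilde, THEN mpoly_mexp]
  have S_hol: "mhol m S unit_disc" using S by (auto simp: schur_class_def mhol_def)
  note hols = mhol_add mhol_smult mhol_mult mhol_const sg.J_mat(1) car S_hol
    poly[THEN mhol_mpoly] poly[THEN mpoly_tilde, THEN mhol_mpoly]
  define D1 where "D1 w = w \<cdot>\<^sub>m (J * tilde m n (sigma_poly m A n W) w * mp_inv Lr * S w * Rr) + rho_poly m n V w" for w
  define N1 where "N1 w = w \<cdot>\<^sub>m (J * tilde m n (tau_poly m n W) w * mp_inv Lr * S w * Rr) + pi_poly m A n V w" for w
  define D2 where "D2 w = w \<cdot>\<^sub>m (Lr * S w * mp_inv Rr * tilde m n (pi_poly m A n V) w * J) + tau_poly m n W w" for w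
  define N2 where "N2 w = w \<cdot>\<^sub>m (Lr * S w * mp_inv Rr * tilde m n (rho_poly m n V) w * J) + sigma_poly m A n W w" for w
  have hol: "mhol m D1 unit_disc" "mhol m N1 unit_disc" "mhol m D2 unit_disc" "mhol m N2 unit_disc"
    unfolding D1_def N1_def D2_def N2_def
    by (intro hols)+
  \<comment> \<open>The representation is used with denominators cleared; both sides then have one
    and the same series at 0, and no inverse function needs an expansion.\<close>
  have fD1: "mexp m (\<lambda>w. f w * D1 w) (fps_X * (fps_const sg.J * matfam.rev n tau * fps_const (emb m True (mp_inv Lr)) * I.S * fps_const (emb m True Rr)) + pi)"
    unfolding I.right_representation[symmetric] D1_def by (intro exps)
  have N1: "mexp m N1 (fps_X * (fps_const sg.J * matfam.rev n tau * fps_const (emb m True (mp_inv Lr)) * I.S * fps_const (emb m True Rr)) + pi)"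
    unfolding N1_def by (intro exps)
  have fD2: "mexp m (\<lambda>w. D2 w * f w) (fps_X * (fps_const (emb m True Lr) * I.S * fps_const (emb m True (mp_inv Rr)) * matfam.rev n rho * fps_const sg.J) + sig)"
    unfolding I.left_representation[symmetric] D2_def by (intro exps)
  have N2: "mexp m N2 (fps_X * (fps_const (emb m True Lr) * I.S * fps_const (emb m True (mp_inv Rr)) * matfam.rev n rho * fps_const sg.J) + sig)"
    unfolding N2_def by (intro exps)
  have K: "?K sparse_in unit_disc"
    using f by (simp add: P_J0_def meromorphic_disc_def sparse_in_open)
  have U_eq: "unit_disc - ?K = ?U" using hol_pts_subset by blast
  \<comment> \<open>Removing a sparse set leaves the disc connected, so equality at 0 reaches every
    holomorphy point of \<open>f\<close>.\<close>
  have U: "open ?U" "connected ?U" "0 \<in> ?U"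
    using open_hol_pts sparse_imp_connected[OF _ _ _ K] f by (auto simp: U_eq P_J0_def)
  have f_car: "f w \<in> carrier_mat m m" if "w \<in> unit_disc" for w
    using mexpD(1)[OF f_exp that] .
  have f_hol: "mhol m f ?U"
    using f_car hol_pts_subset hol_pts_holomorphic by (intro mholI) blast+
  note sub = hol_pts_subset[of m f]
  have eq1: "f w * D1 w = N1 w" if "w \<in> ?U" for w
    using mexp_eq_extend[OF fD1 N1 mhol_mult[OF f_hol mhol_subset[OF hol(1) sub]] mhol_subset[OF hol(2) sub] U that] .
  have eq2: "D2 w * f w = N2 w" if "w \<in> ?U" for w
    using mexp_eq_extend[OF fD2 N2 mhol_mult[OF mhol_subset[OF hol(3) sub] f_hol] mhol_subset[OF hol(4) sub] U that] .
  \<comment> \<open>The exceptional points are those where \<open>f\<close> is not holomorphic and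
    the zeros of the two determinants. The zeros do not accumulate in the disc, because both
    denominators are the identity at 0.\<close>
  define E where "E = ?K \<union> {w \<in> unit_disc. det (D1 w) = 0} \<union> {w \<in> unit_disc. det (D2 w) = 0}"
  have 0: "(0 :: complex) \<in> unit_disc" by simp
  have r0: "fps_nth rho 0 = 1" and t0: "fps_nth tau 0 = 1"
    by (simp_all add: rho_def tau_def coeff_fps_nth)
  have D0: "D1 0 = 1\<^sub>m m" "D2 0 = 1\<^sub>m m"
    unfolding D1_def D2_def mpoly_at_0[OF poly(1) r0] mpoly_at_0[OF poly(3) t0]
    using sg.J_mat(1) car by (auto intro: zero_smult_add)
  have lim: "\<forall>z\<in>unit_disc. \<not> z islimpt E"
  proof
    fix z :: complex assume z: "z \<in> unit_disc"
    have "\<not> z islimpt {w \<in> unit_disc. det (D1 w) = 0}"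
      by (rule zero_set_no_limit_point[OF det_holomorphic_on[OF mholD(1)[OF hol(1)] mholD(2)[OF hol(1)]] _ z])
        (simp_all add: D0)
    moreover have "\<not> z islimpt {w \<in> unit_disc. det (D2 w) = 0}"
      by (rule zero_set_no_limit_point[OF det_holomorphic_on[OF mholD(1)[OF hol(3)] mholD(2)[OF hol(3)]] _ z])
        (simp_all add: D0)
    moreover have "\<not> z islimpt ?K" using K z by (simp add: sparse_in_open)
    ultimately show "\<not> z islimpt E" by (simp add: E_def islimpt_Un)
  qed
  have main: "\<forall>w\<in>unit_disc - E. invertible_mat (D1 w) \<and> f w = N1 w * minv (D1 w)
    \<and> invertible_mat (D2 w) \<and> f w = minv (D2 w) * N2 w"
  proof
    fix w assume w: "w \<in> unit_disc - E"
    have wU: "w \<in> ?U" and d: "det (D1 w) \<noteq> 0" "det (D2 w) \<noteq> 0" and wd: "w \<in> unit_disc"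
      using w by (auto simp: E_def)
    note i1 = minv[OF mholD(1)[OF hol(1) wd] d(1)] and i2 = minv[OF mholD(1)[OF hol(3) wd] d(2)]
    have dims: "dim_row (D1 w) = m" "dim_col (D1 w) = m" "dim_row (D2 w) = m" "dim_col (D2 w) = m"
      "dim_row (minv (D1 w)) = m" "dim_col (minv (D2 w)) = m" "dim_row (f w) = m" "dim_col (f w) = m"
      using mholD(1)[OF hol(1) wd] mholD(1)[OF hol(3) wd] i1(1) i2(1) f_car[OF wd] by auto
    have "N1 w * minv (D1 w) = f w * (D1 w * minv (D1 w))"
      unfolding eq1[OF wU, symmetric] by (rule mat_mult_assoc) (simp_all add: dims)
    moreover have "minv (D2 w) * N2 w = minv (D2 w) * D2 w * f w"
      unfolding eq2[OF wU, symmetric] by (rule mat_mult_assoc[symmetric]) (simp_all add: dims)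
    ultimately show "invertible_mat (D1 w) \<and> f w = N1 w * minv (D1 w)
        \<and> invertible_mat (D2 w) \<and> f w = minv (D2 w) * N2 w"
      using i1 i2 f_car[OF wd] by simp
  qed
  show ?thesis
    by (intro bexI[OF _ S] exI[of _ E])
      (unfold Let_def L_def[symmetric] R_def[symmetric] Lr_def[symmetric] Rr_def[symmetric]
        D1_def[symmetric] N1_def[symmetric] D2_def[symmetric] N2_def[symmetric], rule conjI, rule lim, rule main)
qed

end
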